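(* Let $\lambda\in(\frac{\sqrt2}6,\frac56)$ and let $\mu_\lambda,\tau_{\mu_\lambda},\tau^*_{\mu_\lambda},\gamma_\lambda$ be as in the context. (i) The support $\{\alpha: d_{F^\lambda}(\alpha)\neq-\infty\}$ of $d_{F^\lambda}$ is $[\alpha_{\lambda,\min},1]$, where $\alpha_{\lambda,\min}=1-\frac{\log(6\lambda+1)}{\log6}$. (ii) For every $\alpha\in[\alpha_{\lambda,\min},1]$, $d_{F^\lambda}(\alpha)=\tau^*_{\mu_\lambda}(\alpha+\gamma_\lambda-1)$. In particular $d_{F^\lambda}$ is strictly concave on its support, its maximum equals $1$ and is reached at $\alpha_{\lambda,\mathcal L}=1-\frac{\log(36\lambda^2-1)}{4\log3+2\log6}$. (iii) Let $\mathrm{Gr}(d_{F^\lambda})=\{(\alpha,d_{F^\lambda}(\alpha)):\alpha\in[\alpha_{\lambda,\min},1]\}$ and let $\mathcal K(\mathbb R^2)$ be the space of nonempty compact subsets of $\mathbb R^2$ with the Hausdorff distance. The map $\lambda\in(\frac{\sqrt2}6,\frac56)\mapsto\mathrm{Gr}(d_{F^\lambda})\in\mathcal K(\mathbb R^2)$ is continuous except at $\lambda=\frac13$.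
   Context: Construction of $F^\lambda$: $F^\lambda_0\equiv0$ on $[0,1]$ (one interval of generation $0$). Given $F^\lambda_n$ with its $4^n$ closed intervals of generation $n$ (covering $[0,1]$, disjoint interiors, $F^\lambda_n$ affine on each), on each interval $[a,b]$ of generation $n$, with $\ell=b-a$ and $m$ the slope of $F^\lambda_n$ there, $F^\lambda_{n+1}$ coincides with $F^\lambda_n$ at $a,a+\ell/3,a+2\ell/3,b$, equals $F^\lambda_n(a+\ell/2)+\lambda\ell\sqrt{1+m^2}$ at $a+\ell/2$, and is affine on each of the four intervals $[a,a+\ell/3],[a+\ell/3,a+\ell/2],[a+\ell/2,a+2\ell/3],[a+2\ell/3,b]$ (generation $n+1$). $F^\lambda=\lim_n F^\lambda_n$ (finite and continuous for $\lambda\in(\frac16,\frac56)$). Pointwise regularity: for bounded $f$ on $[0,1]$, $x_0\in[0,1]$, $\alpha\ge0$, $f\in\mathcal C^\alpha(x_0)$ if there exist a polynomial $P$ of degree at most $\lfloor\alpha\rfloor$ and $C,\delta>0$ with $|f(x)-P(x-x_0)|\le C|x-x_0|^\alpha$ for all $x\in[0,1]$ with $|x-x_0|<\delta$; $h_f(x_0)=\sup\{\alpha\ge0: f\in\mathcal C^\alpha(x_0)\}$. The multifractal spectrum is $d_f(\alpha)=\dim_H\{x\in[0,1]:h_f(x)=\alpha\}$ with $\dim_H\emptyset=-\infty$. Measure: for $\lambda>\frac16$, $\gamma_\lambda\ge1$ is the unique real with $2\cdot3^{-\gamma_\lambda}+(6\lambda+1)6^{-\gamma_\lambda}+(6\lambda-1)6^{-\gamma_\lambda}=1$;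 $p_0=p_3=3^{-\gamma_\lambda}$, $p_1=(6\lambda+1)6^{-\gamma_\lambda}$, $p_2=(6\lambda-1)6^{-\gamma_\lambda}$; $S_0(x)=x/3$, $S_1(x)=x/6+1/3$, $S_2(x)=-x/6+2/3$, $S_3(x)=x/3+2/3$ with ratios $r_0=r_3=1/3$, $r_1=r_2=1/6$; $\mu_\lambda$ is the unique Borel probability measure with $\mu_\lambda=\sum_{i=0}^3p_i\,\mu_\lambda\circ S_i^{-1}$. $\tau_{\mu_\lambda}(q)$ is the unique real solution of $\sum_{i=0}^3p_i^q r_i^{-\tau_{\mu_\lambda}(q)}=1$, and $\tau^*_{\mu_\lambda}(\alpha)=\inf_{q\in\mathbb R}(\alpha q-\tau_{\mu_\lambda}(q))$. *)

theory Defs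
  imports "HOL-Analysis.Analysis" "HOL-Computational_Algebra.Polynomial"
begin

text \<open>F_n is encoded by the list of its breakpoints (x, F_n x), listed from left to right;
 consecutive breakpoints delimit the intervals of generation n on which F_n is affine.\<close>

fun refine :: "real \<Rightarrow> (real \<times> real) list \<Rightarrow> (real \<times> real) list" where
  "refine lam ((a, ya) # (b, yb) # rest) =
     (let l = b - a; m = (yb - ya) / l in
       [(a, ya), (a + l/3, ya + m * (l/3)),
        (a + l/2, ya + m * (l/2) + lam * l * sqrt (1 + m^2)),
        (a + 2*l/3, ya + m * (2*l/3))] @ refine lam ((b, yb) # rest))"
| "refine lam ps = ps"

definition Fpts :: "real \<Rightarrow> nat \<Rightarrow> (real \<times> real) list" where
  "Fpts lam n = (refine lam ^^ n) [(0, 0), (1, 0)]"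

fun interp :: "(real \<times> real) list \<Rightarrow> real \<Rightarrow> real" where
  "interp ((a, ya) # (b, yb) # rest) x =
     (if x \<le> b then ya + (yb - ya) / (b - a) * (x - a) else interp ((b, yb) # rest) x)"
| "interp ps x = 0"

definition Fn :: "real \<Rightarrow> nat \<Rightarrow> real \<Rightarrow> real" where
  "Fn lam n x = interp (Fpts lam n) x"

definition F :: "real \<Rightarrow> real \<Rightarrow> real" where
  "F lam x = lim (\<lambda>n. Fn lam n x)"

definition pointwise_Calpha :: "(real \<Rightarrow> real) \<Rightarrow> real \<Rightarrow> real \<Rightarrow> bool" where
  "pointwise_Calpha f x0 \<alpha> \<longleftrightarrow>
     (\<exists>P :: real poly. \<exists>C \<delta>. degree P \<le> nat \<lfloor>\<alpha>\<rfloor> \<and> C > 0 \<and> \<delta> > 0 \<and>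
        (\<forall>x\<in>{0..1}. \<bar>x - x0\<bar> < \<delta> \<longrightarrow> \<bar>f x - poly P (x - x0)\<bar> \<le> C * \<bar>x - x0\<bar> powr \<alpha>))"

definition hoelder_exp :: "(real \<Rightarrow> real) \<Rightarrow> real \<Rightarrow> ereal" where
  "hoelder_exp f x0 = Sup (ereal ` {\<alpha>. \<alpha> \<ge> 0 \<and> pointwise_Calpha f x0 \<alpha>})"

definition hausdorff_pre :: "real \<Rightarrow> real \<Rightarrow> 'a::metric_space set \<Rightarrow> ennreal" where
  "hausdorff_pre s \<delta> E =
     (INF U \<in> {U :: nat \<Rightarrow> 'a set. (\<forall>i. bounded (U i) \<and> diameter (U i) \<le> \<delta>) \<and> E \<subseteq> (\<Union>i. U i)}.
        (\<Sum>i. ennreal (diameter (U i) powr s)))"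

definition hausdorff_outer :: "real \<Rightarrow> 'a::metric_space set \<Rightarrow> ennreal" where
  "hausdorff_outer s E = (SUP \<delta> \<in> {0<..}. hausdorff_pre s \<delta> E)"

text \<open>Hausdorff dimension, with the convention dim_H {} = -\<infinity>.
 (For s > 0, diameter powr s agrees with the usual diam^s; H^s(E)=0 is upward closed in s,
 so taking the infimum over s > 0 gives the usual dimension.)\<close>
definition hdim :: "'a::metric_space set \<Rightarrow> ereal" where
  "hdim E = (if E = {} then -\<infinity> else Inf (ereal ` {s. s > 0 \<and> hausdorff_outer s E = 0}))"

definition spectrum_F :: "(real \<Rightarrow> real) \<Rightarrow> real \<Rightarrow> ereal" where
  "spectrum_F f \<alpha> = hdim {x \<in> {0..1}. hoelder_exp f x = ereal \<alpha>}"

definition gam :: "real \<Rightarrow> real" where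
  "gam lam = (THE g. g \<ge> 1 \<and>
     2 * 3 powr (-g) + (6*lam + 1) * 6 powr (-g) + (6*lam - 1) * 6 powr (-g) = 1)"

definition pw :: "real \<Rightarrow> nat \<Rightarrow> real" where
  "pw lam i = (if i = 1 then (6*lam + 1) * 6 powr (- gam lam)
              else if i = 2 then (6*lam - 1) * 6 powr (- gam lam)
              else 3 powr (- gam lam))"

definition rt :: "nat \<Rightarrow> real" where
  "rt i = (if i = 1 \<or> i = 2 then 1/6 else 1/3)"

definition tau :: "real \<Rightarrow> real \<Rightarrow> real" where
  "tau lam q = (THE t. (\<Sum>i<4. pw lam i powr q * rt i powr (- t)) = 1)"

definition tau_star :: "real \<Rightarrow> real \<Rightarrow> ereal" where
  "tau_star lam \<alpha> = (INF q. ereal (\<alpha> * q - tau lam q))"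

definition alpha_min :: "real \<Rightarrow> real" where
  "alpha_min lam = 1 - ln (6*lam + 1) / ln 6"

definition alpha_L :: "real \<Rightarrow> real" where
  "alpha_L lam = 1 - ln (36*lam^2 - 1) / (4 * ln 3 + 2 * ln 6)"

definition graph_spec :: "real \<Rightarrow> (real \<times> real) set" where
  "graph_spec lam = (\<lambda>\<alpha>. (\<alpha>, real_of_ereal (spectrum_F (F lam) \<alpha>))) ` {alpha_min lam..1}"

definition hausdist :: "'a::metric_space set \<Rightarrow> 'a set \<Rightarrow> real" where
  "hausdist A B = max (SUP a\<in>A. infdist a B) (SUP b\<in>B. infdist b A)"

end

theory Submission
  imports Defs "HOL-Probability.Probability" "HOL-Library.Sublist"
begin

text \<open>On a generation interval of length \<open>l\<close> and slope \<open>m\<close> the function oscillates by about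
  \<open>l * sqrt (1 + m\<^sup>2)\<close>, and adjacent intervals of comparable length have comparable slopes. Hence the
  pointwise exponent at a point is read off the lengths and slopes along any of its addresses.
  Passing to a child multiplies a large slope by \<open>u = 1\<close>, \<open>6 * lam + 1\<close> or \<open>6 * lam - 1\<close> in absolute
  value and the length by \<open>r = 1/3\<close>, \<open>1/6\<close> or \<open>1/6\<close>. Since \<open>p = u * r powr \<gamma>\<close> for each weight \<open>p\<close>, the number
  \<open>\<gamma>\<close> cancels: with \<open>\<kappa> = 1 - \<alpha>\<close>, the Legendre transform is the infimum of \<open>e - \<kappa> * q\<close> over all
  \<open>(q, e)\<close> with \<open>(\<Sum> u powr q * r powr e) \<le> 1\<close>. Coverings give the upper bound, once the sums of
  \<open>l powr e * (1 + m\<^sup>2) powr (q/2)\<close> over the generations are shown to decay. For the lower bound, the Lagrange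
  condition at a minimiser says that the Bernoulli weights \<open>u powr q * r powr e\<close> produce the exponent
  \<open>\<alpha>\<close> almost surely. When \<open>lam < 1/3\<close>, the factor \<open>6 * lam - 1\<close> is smaller than 1, but slopes never fall
  below 1 in absolute value again, so that exponents above 1 do not occur.\<close>

section \<open>The limit function on a cell\<close>

text \<open>With \<open>c = 6 * lam\<close>, a middle child turns the slope \<open>m\<close> into
  \<open>m + c * sn m\<close> or \<open>m - c * sn m\<close>, so the recursion is multiplicative
  only for large slopes. This is the obstacle on both sides: at slope 0, where the construction
  starts, the factors \<open>c + 1\<close> and \<open>c - 1\<close> are wrong, and for
  \<open>c < 2\<close> moderate slopes can recur. The upper bound therefore replaces
  \<open>sn m powr q\<close> by a Lyapunov function corrected at small slopes, and the lower bound
  looks back to the last time at which the slope was moderate. The bound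
  \<open>c\<^sup>2 > 2\<close> also gives \<open>(c + 1) * (c - 1) > 1\<close>: the two middle
  factors together expand. Minimisers need not exist. They escape to \<open>q = \<infinity>\<close>
  at the smallest exponent and, if \<open>c \<ge> 2\<close>, to \<open>q = -\<infinity>\<close> at
  exponent 1. There explicit Bernoulli weights replace the Lagrange weights; at exponent 1 they
  charge types 0 and 3, and also type 2 when \<open>c = 2\<close>. The value at exponent 1 thus
  differs between \<open>c = 2\<close> and \<open>c > 2\<close>. Upper semicontinuity in the
  parameter is automatic; lower semicontinuity needs bounded \<open>q\<close>, or concavity where
  \<open>q\<close> escapes.\<close>

definition sn :: "real \<Rightarrow> real" where "sn m = sqrt (1 + m^2)"

lemma sn_ge1: "sn m \<ge> 1" and abs_le_sn: "\<bar>m\<bar> \<le> sn m" and sn_sq: "sn m ^ 2 = 1 + m^2"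
  and sn_le: "sn m \<le> 1 + \<bar>m\<bar>"
proof -
  show "sn m \<ge> 1" by (simp add: sn_def)
  show "\<bar>m\<bar> \<le> sn m" unfolding sn_def by (rule real_le_rsqrt) simp
  show "sn m ^ 2 = 1 + m^2" unfolding sn_def by (simp add: add_nonneg_nonneg)
  show "sn m \<le> 1 + \<bar>m\<bar>" unfolding sn_def
    by (rule real_le_lsqrt) (auto simp: power2_eq_square algebra_simps)
qed

lemma sn_pos [simp]: "sn m > 0" using sn_ge1[of m] by linarith

lemma sn_minus [simp]: "sn (- m) = sn m" by (simp add: sn_def)

type_synonym state = "real \<times> real \<times> real \<times> real"

text \<open>A rise of \<open>lam * l * sn m\<close> above the chord within length \<open>l/6\<close>
  changes the slope by \<open>6 * lam * sn m\<close>. Following single states avoids breakpoint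
  lists in all later arguments.\<close>

fun kid :: "real \<Rightarrow> state \<Rightarrow> nat \<Rightarrow> state" where
  "kid lam (a, y, l, m) k =
     (if k = 0 then (a, y, l/3, m)
      else if k = 1 then (a + l/3, y + m * (l/3), l/6, m + 6 * lam * sn m)
      else if k = 2 then (a + l/2, y + m * (l/2) + lam * l * sn m, l/6, m - 6 * lam * sn m)
      else (a + 2*l/3, y + m * (2*l/3), l/3, m))"

definition left :: "state \<Rightarrow> real" where "left s = fst s"
definition hgt :: "state \<Rightarrow> real" where "hgt s = fst (snd s)"
definition len :: "state \<Rightarrow> real" where "len s = fst (snd (snd s))"
definition slp :: "state \<Rightarrow> real" where "slp s = snd (snd (snd s))"

lemma state_sel [simp]: "left (a,y,l,m) = a" "hgt (a,y,l,m) = y" "len (a,y,l,m) = l" "slp (a,y,l,m) = m"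
  by (simp_all add: left_def hgt_def len_def slp_def)

definition itv :: "state \<Rightarrow> real set" where "itv s = {left s .. left s + len s}"
definition aff :: "state \<Rightarrow> real \<Rightarrow> real" where "aff s x = hgt s + slp s * (x - left s)"

section \<open>Refinement of breakpoint lists\<close>

lemma refine_hd: "\<exists>zs. refine lam (p # xs) = p # zs"
  by (cases p; cases xs) (auto simp: Let_def split: prod.splits)

text \<open>Refinement acts on consecutive pairs independently and keeps the last point, so a list
  may be cut at any breakpoint \<open>p\<close>; \<open>butlast\<close> removes the second copy of
  \<open>p\<close>.\<close>

lemma refine_append: "refine lam (xs @ p # ys) = butlast (refine lam (xs @ [p])) @ refine lam (p # ys)
   \<and> last (refine lam (xs @ [p])) = p \<and> refine lam (xs @ [p]) \<noteq> []"
proof (induction xs)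
  case Nil
  show ?case by simp
next
  case (Cons u us)
  show ?case
  proof (cases us)
    case Nil
    show ?thesis unfolding Nil by (cases u; cases p; simp add: Let_def)
  next
    case (Cons v vs)
    show ?thesis using Cons.IH unfolding Cons by (cases u; cases v; simp add: Let_def)
  qed
qed

lemma refine_pow_hd: "\<exists>zs. (refine lam ^^ n) (p # xs) = p # zs"
  by (induction n) (auto dest: refine_hd[THEN exE], metis refine_hd)

lemma refine_pow_append: "(refine lam ^^ n) (xs @ p # ys) = butlast ((refine lam ^^ n) (xs @ [p])) @ (refine lam ^^ n) (p # ys)
   \<and> last ((refine lam ^^ n) (xs @ [p])) = p \<and> (refine lam ^^ n) (xs @ [p]) \<noteq> []"
proof (induction n)
  case 0 show ?case by simp
next
  case (Suc n)
  let ?R = "refine lam ^^ n"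
  obtain zs where zs: "?R (p # ys) = p # zs" using refine_pow_hd by blast
  have e: "?R (xs @ [p]) = butlast (?R (xs @ [p])) @ [p]"
    using Suc by (metis append_butlast_last_id)
  have "?R (xs @ p # ys) = butlast (?R (xs @ [p])) @ p # zs" using Suc zs by simp
  then show ?case using refine_append[of lam "butlast (?R (xs @ [p]))" p zs] e zs
    by simp
qed

text \<open>The right end is dropped so that adjacent pieces concatenate without repeating their
  common breakpoint.\<close>

definition segs :: "real \<Rightarrow> nat \<Rightarrow> real \<times> real \<Rightarrow> real \<times> real \<Rightarrow> (real \<times> real) list" where
  "segs lam n p q = butlast ((refine lam ^^ n) [p, q])"

lemma refine_single: "(refine lam ^^ n) [q] = [q]"
proof -
  have "refine lam [q] = [q]" by (cases q) simp
  then show ?thesis by (induction n) simp_all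
qed

lemma refine_pow_Cons: "(refine lam ^^ n) (p # q # ys) = segs lam n p q @ (refine lam ^^ n) (q # ys)"
  using refine_pow_append[of n lam "[p]" q ys] by (simp add: segs_def)

definition left_pt :: "state \<Rightarrow> real \<times> real" where "left_pt s = (left s, hgt s)"
definition right_pt :: "state \<Rightarrow> real \<times> real" where "right_pt s = (left s + len s, hgt s + slp s * len s)"

lemma kid_ends:
  "left_pt (kid lam s 0) = left_pt s" "left_pt (kid lam s 1) = right_pt (kid lam s 0)" "left_pt (kid lam s 2) = right_pt (kid lam s 1)"
  "left_pt (kid lam s 3) = right_pt (kid lam s 2)" "right_pt (kid lam s 3) = right_pt s"
  by (cases s; simp add: left_pt_def right_pt_def algebra_simps)+

lemma refine_state:
  assumes "len s > 0"
  shows "refine lam [left_pt s, right_pt s] = [left_pt (kid lam s 0), left_pt (kid lam s 1), left_pt (kid lam s 2), left_pt (kid lam s 3), right_pt (kid lam s 3)]"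
proof -
  obtain a y l m where s: "s = (a,y,l,m)" by (cases s)
  with assms have l: "l > 0" by simp
  have "(y + m * l - y) / (a + l - a) = m" using l by simp
  then show ?thesis unfolding s left_pt_def right_pt_def using l
    by (simp add: Let_def sn_def algebra_simps)
qed

text \<open>The iteration is unrolled at its first step instead of its last, so the remaining
  \<open>n\<close> steps act inside the four children. This turns generations into a recursion over
  states.\<close>

lemma refine_pow_state:
  assumes "len s > 0"
  shows "(refine lam ^^ Suc n) [left_pt s, right_pt s] =
    segs lam n (left_pt (kid lam s 0)) (right_pt (kid lam s 0)) @ segs lam n (left_pt (kid lam s 1)) (right_pt (kid lam s 1)) @
    segs lam n (left_pt (kid lam s 2)) (right_pt (kid lam s 2)) @ (refine lam ^^ n) [left_pt (kid lam s 3), right_pt (kid lam s 3)]"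
proof -
  have "(refine lam ^^ Suc n) [left_pt s, right_pt s] = (refine lam ^^ n) (refine lam [left_pt s, right_pt s])"
    by (simp add: funpow_Suc_right del: funpow.simps)
  then show ?thesis
    by (simp only: refine_state[OF assms] refine_pow_Cons kid_ends(2-4))
qed

lemma refine_segs: "(refine lam ^^ n) [p, q] = segs lam n p q @ [q]"
  using refine_pow_Cons[of n lam p q "[]"] by (simp add: refine_single)

lemma segs_hd: "\<exists>zs. segs lam n p q = p # zs"
proof -
  obtain zs where "(refine lam ^^ n) [p, q] = p # zs" using refine_pow_hd by blast
  moreover have "zs \<noteq> []"
  proof
    have "length (refine lam zs) \<ge> length zs" for zs
    proof (induction zs)
      case (Cons u us)
      then show ?case by (cases u; cases us) (auto simp: Let_def)
    qed simp
    then have "length ((refine lam ^^ n) [p, q]) \<ge> 2"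
      by (induction n) (auto, meson le_trans)
    moreover assume "zs = []"
    ultimately show False using \<open>(refine lam ^^ n) [p, q] = p # zs\<close> by simp
  qed
  ultimately show ?thesis unfolding segs_def by auto
qed

text \<open>\<open>interp\<close> stops at the first right end that is at least \<open>x\<close>. If
  all abscissae in \<open>zs\<close> are at most that of \<open>p\<close>, an \<open>x\<close>
  beyond \<open>p\<close> passes over all of \<open>zs\<close>.\<close>

lemma interp_append:
  assumes "zs \<noteq> []" "\<And>z. z \<in> set zs \<Longrightarrow> fst z \<le> fst p"
  shows "interp (zs @ p # ys) x = (if x \<le> fst p then interp (zs @ [p]) x else interp (p # ys) x)"
  using assms
proof (induction zs)
  case Nil then show ?case by simp
next
  case (Cons u us)
  show ?case
  proof (cases us)
    case Nil
    show ?thesis unfolding Nil by (cases u; cases p; simp)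
  next
    case (Cons v vs)
    have *: "fst v \<le> fst p" using Cons.prems(2) unfolding Cons by simp
    have "interp (us @ p # ys) x = (if x \<le> fst p then interp (us @ [p]) x else interp (p # ys) x)"
      using Cons.IH Cons.prems(2) Cons by auto
    then show ?thesis using * unfolding Cons by (cases u; cases v; simp)
  qed
qed

text \<open>Here \<open>n\<close> counts generations below the cell \<open>s\<close>, which plays
  the part of the initial segment.\<close>

definition cell_approx :: "real \<Rightarrow> nat \<Rightarrow> state \<Rightarrow> real \<Rightarrow> real" where
  "cell_approx lam n s x = interp ((refine lam ^^ n) [left_pt s, right_pt s]) x"

lemma kid_len: "len (kid lam s k) = (if k = 1 \<or> k = 2 then len s / 6 else len s / 3)"
  by (cases s) auto

lemma kid_len_pos: "len s > 0 \<Longrightarrow> len (kid lam s k) > 0"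
  by (simp add: kid_len)

lemma fst_end_pts [simp]: "fst (left_pt s) = left s" "fst (right_pt s) = left s + len s"
  by (simp_all add: left_pt_def right_pt_def)

lemma kid_left: "left (kid lam s 0) = left s" "left (kid lam s 1) = left s + len s / 3"
   "left (kid lam s 2) = left s + len s / 2" "left (kid lam s 3) = left s + 2 * len s / 3"
  by (cases s; simp)+

lemma segs_le:
  assumes "len s > 0" "z \<in> set (segs lam n (left_pt s) (right_pt s))"
  shows "fst z \<le> left s + len s"
  using assms
proof (induction n arbitrary: s)
  case 0 then show ?case by (simp add: segs_def)
next
  case (Suc n)
  have "segs lam (Suc n) (left_pt s) (right_pt s) = butlast ((refine lam ^^ Suc n) [left_pt s, right_pt s])"
    by (simp only: segs_def)
  also have "\<dots> = segs lam n (left_pt (kid lam s 0)) (right_pt (kid lam s 0)) @ segs lam n (left_pt (kid lam s 1)) (right_pt (kid lam s 1)) @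
    segs lam n (left_pt (kid lam s 2)) (right_pt (kid lam s 2)) @ segs lam n (left_pt (kid lam s 3)) (right_pt (kid lam s 3))"
    unfolding refine_pow_state[OF Suc.prems(1)] by (simp add: refine_segs butlast_append)
  finally obtain k where k: "k \<in> {0,1,2,3::nat}" "z \<in> set (segs lam n (left_pt (kid lam s k)) (right_pt (kid lam s k)))"
    using Suc.prems(2) by auto
  have "fst z \<le> left (kid lam s k) + len (kid lam s k)"
    using Suc.IH[OF kid_len_pos[OF Suc.prems(1)] k(2)] .
  then show ?case using k(1) Suc.prems(1) by (auto simp: kid_left kid_len simp del: One_nat_def)
qed

lemma cell_approx_0: "len s > 0 \<Longrightarrow> x \<le> left s + len s \<Longrightarrow> cell_approx lam 0 s x = aff s x"
  by (cases s) (simp add: cell_approx_def left_pt_def right_pt_def aff_def)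

text \<open>The self-similar recursion behind everything that follows. As in \<open>interp\<close>,
  a common end point is evaluated in the left child.\<close>

lemma cell_approx_Suc:
  assumes "len s > 0"
  shows "cell_approx lam (Suc n) s x = (if x \<le> left s + len s / 3 then cell_approx lam n (kid lam s 0) x
     else if x \<le> left s + len s / 2 then cell_approx lam n (kid lam s 1) x
     else if x \<le> left s + 2 * len s / 3 then cell_approx lam n (kid lam s 2) x
     else cell_approx lam n (kid lam s 3) x)"
proof -
  define A where "A k = segs lam n (left_pt (kid lam s k)) (right_pt (kid lam s k))" for k
  have A: "z \<in> set (A k) \<Longrightarrow> fst z \<le> left (kid lam s k) + len (kid lam s k)" for z k
    unfolding A_def using segs_le[OF kid_len_pos[OF assms]] by blast
  have ne: "A k \<noteq> []" for k unfolding A_def using segs_hd by (metis list.distinct(1))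
  have hd: "A k @ [right_pt (kid lam s k)] = left_pt (kid lam s k) # tl (A k @ [right_pt (kid lam s k)])" for k
    unfolding A_def using segs_hd[of lam n "left_pt (kid lam s k)" "right_pt (kid lam s k)"] by auto
  have AG: "interp (A k @ [right_pt (kid lam s k)]) x = cell_approx lam n (kid lam s k) x" for k
    by (simp add: A_def cell_approx_def refine_segs)
  have lk: "left (kid lam s 0) + len (kid lam s 0) = left s + len s / 3"
    "left (kid lam s 1) + len (kid lam s 1) = left s + len s / 2"
    "left (kid lam s 2) + len (kid lam s 2) = left s + 2 * len s / 3"
    by (simp_all add: kid_left kid_len del: One_nat_def)
  have step: "interp (A k @ right_pt (kid lam s k) # ys) x =
     (if x \<le> left (kid lam s k) + len (kid lam s k) then cell_approx lam n (kid lam s k) x else interp (right_pt (kid lam s k) # ys) x)" for k ys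
    using interp_append[OF ne, of k "right_pt (kid lam s k)" ys x] A[of _ k] AG[of k] by simp
  have "cell_approx lam (Suc n) s x = interp (A 0 @ A 1 @ A 2 @ A 3 @ [right_pt (kid lam s 3)]) x"
    unfolding cell_approx_def refine_pow_state[OF assms] A_def
    by (simp add: refine_segs[of n lam "left_pt (kid lam s 3)"] del: One_nat_def)
  \<comment> \<open>\<open>B3\<close>, \<open>B2\<close> and \<open>B1\<close> are the lists that
    follow the three inner breakpoints; each remaining list is shown to start with a shared
    breakpoint, so that \<open>step\<close> applies three times.\<close>
  moreover define B3 where "B3 = tl (A 3 @ [right_pt (kid lam s 3)])"
  have B3: "A 3 @ [right_pt (kid lam s 3)] = right_pt (kid lam s 2) # B3"
    using hd[of 3] unfolding B3_def kid_ends(4) .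
  define B2 where "B2 = tl (A 2) @ right_pt (kid lam s 2) # B3"
  have B2: "A 2 @ right_pt (kid lam s 2) # B3 = right_pt (kid lam s 1) # B2"
    using segs_hd[of lam n "left_pt (kid lam s 2)" "right_pt (kid lam s 2)"] unfolding B2_def A_def kid_ends(3) by auto
  define B1 where "B1 = tl (A 1) @ right_pt (kid lam s 1) # B2"
  have B1: "A 1 @ right_pt (kid lam s 1) # B2 = right_pt (kid lam s 0) # B1"
    using segs_hd[of lam n "left_pt (kid lam s 1)" "right_pt (kid lam s 1)"] unfolding B1_def A_def kid_ends(2) by auto
  ultimately have "cell_approx lam (Suc n) s x = interp (A 0 @ right_pt (kid lam s 0) # B1) x"
    by (simp add: B3 B2 B1)
  also have "\<dots> = (if x \<le> left s + len s / 3 then cell_approx lam n (kid lam s 0) x else interp (A 1 @ right_pt (kid lam s 1) # B2) x)"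
    unfolding step lk B1 ..
  also have "interp (A 1 @ right_pt (kid lam s 1) # B2) x = 
     (if x \<le> left s + len s / 2 then cell_approx lam n (kid lam s 1) x else interp (A 2 @ right_pt (kid lam s 2) # B3) x)"
    unfolding step lk B2 ..
  also have "interp (A 2 @ right_pt (kid lam s 2) # B3) x = 
     (if x \<le> left s + 2 * len s / 3 then cell_approx lam n (kid lam s 2) x else interp (A 3 @ [right_pt (kid lam s 3)]) x)"
    unfolding step lk B3 ..
  finally show ?thesis unfolding AG .
qed

definition root :: state where "root = (0, 0, 1, 0)"

lemma Fn_cell_approx: "Fn lam n x = cell_approx lam n root x"
  by (simp add: Fn_def Fpts_def cell_approx_def root_def left_pt_def right_pt_def)

section \<open>Growth of slopes, contraction and convergence\<close>

locale koch =
  fixes lam :: real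
  assumes lam_gt: "sqrt 2 / 6 < lam" and lam_lt: "lam < 5/6"
begin

definition c :: real where "c = 6 * lam"

lemma c_bounds: "c > sqrt 2" "c > 1" "c < 5" "c > 0" "c\<^sup>2 > 2"
proof -
  show 1: "c > sqrt 2" using lam_gt by (simp add: c_def)
  show 2: "c > 1" using 1 by (smt (verit) real_sqrt_gt_1_iff)
  show "c < 5" using lam_lt by (simp add: c_def)
  show "c > 0" using 2 by simp
  show "c\<^sup>2 > 2" using 1 by (metis abs_of_pos less_trans real_sqrt_abs real_sqrt_less_iff \<open>c > 0\<close>)
qed

lemma lam_pos: "lam > 0" using c_bounds unfolding c_def by simp

abbreviation "kd \<equiv> kid lam"

lemma kid_slp: "slp (kd s 0) = slp s" "slp (kd s 1) = slp s + c * sn (slp s)"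
   "slp (kd s 2) = slp s - c * sn (slp s)" "slp (kd s 3) = slp s"
  by (cases s; simp add: c_def)+

lemma sn_nonneg [simp]: "0 \<le> sn m" using sn_pos[of m] by linarith

text \<open>Expanding \<open>1 + (m + e)^2\<close> gives \<open>(sn m)^2 + 2 * m * e + e^2\<close>,
  and \<open>\<bar>m\<bar> \<le> sn m\<close> bounds the mixed term; the result is a perfect
  square.\<close>

lemma sn_up: "sn (m + c * sn m) \<le> (c + 1) * sn m" "sn (m - c * sn m) \<le> (c + 1) * sn m"
proof -
  have A: "sn (m + e) \<le> (c + 1) * sn m" if "e = c * sn m \<or> e = - (c * sn m)" for e m
  proof -
    have "m * e \<le> \<bar>m\<bar> * \<bar>e\<bar>" by (metis abs_ge_self abs_mult)
    also have "\<dots> \<le> sn m * \<bar>e\<bar>" using abs_le_sn by (simp add: mult_right_mono)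
    also have "\<bar>e\<bar> = c * sn m" using that c_bounds sn_pos[of m] by (auto simp: abs_mult)
    finally have "m * e \<le> c * (sn m)^2" by (simp add: power2_eq_square algebra_simps)
    moreover have "e^2 = c^2 * (sn m)^2" using that by (auto simp: power_mult_distrib)
    moreover have "1 + (m + e)^2 = (sn m)^2 + 2 * (m * e) + e^2" by (simp add: sn_sq power2_sum)
    moreover have "((c + 1) * sn m)^2 = (sn m)^2 + 2 * (c * (sn m)^2) + c^2 * (sn m)^2"
      by (simp add: power2_eq_square algebra_simps)
    ultimately have "1 + (m + e)^2 \<le> ((c + 1) * sn m)^2" by linarith
    then show ?thesis unfolding sn_def[of "m + e"] using c_bounds by (intro real_le_lsqrt) (auto simp: less_imp_le)
  qed
  show "sn (m + c * sn m) \<le> (c + 1) * sn m" using A by blast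
  show "sn (m - c * sn m) \<le> (c + 1) * sn m" using A[of "- (c * sn m)" m] by simp
qed

lemma sn_low: "(c - 1) * sn m \<le> sn (m + c * sn m)" "(c - 1) * sn m \<le> sn (m - c * sn m)"
proof -
  have "c * sn m - \<bar>m\<bar> \<le> \<bar>m + c * sn m\<bar>" "c * sn m - \<bar>m\<bar> \<le> \<bar>m - c * sn m\<bar>" by linarith+
  moreover have "(c - 1) * sn m \<le> c * sn m - \<bar>m\<bar>" using abs_le_sn[of m] by (simp add: algebra_simps)
  ultimately show "(c - 1) * sn m \<le> sn (m + c * sn m)" "(c - 1) * sn m \<le> sn (m - c * sn m)"
    using abs_le_sn by (meson order_trans)+
qed

text \<open>The minimum of \<open>c * sn m - \<bar>m\<bar>\<close> is \<open>sqrt (c\<^sup>2 - 1)\<close>: this is where \<open>lam > sqrt 2 / 6\<close> enters.\<close>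
lemma slope_ge1: "c * sn m - \<bar>m\<bar> \<ge> 1"
proof -
  have "(1 + \<bar>m\<bar>)^2 \<le> (c * sn m)^2"
  proof -
    have "(1 + \<bar>m\<bar>)^2 \<le> 2 * (1 + m^2)" using sum_squares_bound[of 1 "\<bar>m\<bar>"] by (simp add: power2_sum)
    also have "\<dots> \<le> c^2 * (1 + m^2)" using c_bounds by (intro mult_right_mono) auto
    finally show ?thesis by (simp add: power_mult_distrib sn_sq)
  qed
  then have "1 + \<bar>m\<bar> \<le> c * sn m" by (rule power2_le_imp_le) (use c_bounds sn_pos[of m] in \<open>auto simp: less_imp_le\<close>)
  then show ?thesis by simp
qed

text \<open>Contraction factor of \<open>wid\<close>: outer children have a third of the length at
  the same slope, middle ones a sixth of the length at \<open>c + 1\<close> times the slope factor.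
  It is below 1 because \<open>lam < 5/6\<close>.\<close>

definition rho :: real where "rho = (max 2 (c + 1)) / 6"

lemma rho: "0 < rho" "rho < 1" "1/3 \<le> rho" "(c+1)/6 \<le> rho"
  using c_bounds by (auto simp: rho_def max_def)

text \<open>Sum of the geometric series of \<open>lam * rho ^ n\<close>, which bounds the peaks
  added in all later generations relative to \<open>wid\<close>.\<close>

definition KK :: real where "KK = lam / (1 - rho)"

lemma KK: "KK * rho + lam = KK" "KK > 0"
  using rho lam_pos by (auto simp: KK_def field_simps)

text \<open>Euclidean length of the chord over the cell; the peak added in the next generation is
  \<open>lam\<close> times it.\<close>

definition wid :: "state \<Rightarrow> real" where "wid s = len s * sn (slp s)"

lemma kid_cases: "k < (4::nat) \<longleftrightarrow> k = 0 \<or> k = 1 \<or> k = 2 \<or> k = 3" by auto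

text \<open>The single constant \<open>(c - 1) / (c + 1)\<close> lies below both 1, for the outer
  children, and \<open>c - 1\<close>, for the middle ones. The two bounds together compare
  siblings.\<close>

lemma kid_sn:
  assumes "k < 4"
  shows "sn (slp (kd s k)) \<le> (c + 1) * sn (slp s)" "(c - 1) / (c + 1) * sn (slp s) \<le> sn (slp (kd s k))"
proof -
  have 1: "sn (slp s) \<le> (c + 1) * sn (slp s)" using c_bounds sn_pos[of "slp s"] by simp
  show "sn (slp (kd s k)) \<le> (c + 1) * sn (slp s)"
    using assms sn_up[of "slp s"] 1 unfolding kid_cases by (auto simp: kid_slp simp del: One_nat_def)
  have 2: "(c - 1) / (c + 1) * sn (slp s) \<le> (c - 1) * sn (slp s)"
    using c_bounds sn_pos[of "slp s"] by (intro mult_right_mono) (auto simp: field_simps)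
  have 3: "(c - 1) / (c + 1) * sn (slp s) \<le> sn (slp s)"
    using c_bounds sn_pos[of "slp s"] by (simp add: field_simps)
  show "(c - 1) / (c + 1) * sn (slp s) \<le> sn (slp (kd s k))"
    using assms sn_low[of "slp s"] 2 3 unfolding kid_cases by (auto simp: kid_slp simp del: One_nat_def)
qed

lemma kid_wid:
  assumes "len s > 0" "k < 4"
  shows "wid (kd s k) \<le> rho * wid s"
proof -
  have "len s / 3 * sn (slp s) \<le> rho * wid s"
    using rho(3) assms(1) unfolding wid_def by (simp add: mult_right_mono less_imp_le)
  moreover have "len s / 6 * ((c + 1) * sn (slp s)) \<le> rho * wid s"
    using mult_right_mono[OF rho(4), of "wid s"] assms(1) unfolding wid_def by (simp add: less_imp_le)
  moreover have "len s / 6 * sn (slp s + c * sn (slp s)) \<le> len s / 6 * ((c + 1) * sn (slp s))"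
      "len s / 6 * sn (slp s - c * sn (slp s)) \<le> len s / 6 * ((c + 1) * sn (slp s))"
    using sn_up assms(1) by (intro mult_left_mono; simp)+
  ultimately show ?thesis using assms(2)
    unfolding kid_cases by (auto simp: wid_def kid_len kid_slp simp del: One_nat_def)
qed

lemma wid_pos: "len s > 0 \<Longrightarrow> wid s > 0" by (simp add: wid_def)

lemma itv_kid_cases:
  assumes "x \<in> itv s"
  obtains k where "k < 4" "x \<in> itv (kd s k)"
     "\<And>n. len s > 0 \<Longrightarrow> cell_approx lam (Suc n) s x = cell_approx lam n (kd s k) x"
proof -
  define k :: nat where "k = (if x \<le> left s + len s / 3 then 0 else if x \<le> left s + len s / 2 then 1
     else if x \<le> left s + 2 * len s / 3 then 2 else 3)"
  have "cell_approx lam (Suc n) s x = cell_approx lam n (kd s k) x" if "len s > 0" for n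
    unfolding cell_approx_Suc[OF that] k_def by simp
  moreover have "x \<in> itv (kd s k)" using assms
    unfolding k_def itv_def by (auto simp: kid_left kid_len simp del: One_nat_def)
  moreover have "k < 4" unfolding k_def by simp
  ultimately show ?thesis using that by blast
qed

lemma itv_kid_subset: "len s > 0 \<Longrightarrow> k < 4 \<Longrightarrow> itv (kd s k) \<subseteq> itv s"
  unfolding itv_def kid_cases by (auto simp: kid_left kid_len simp del: One_nat_def)

text \<open>One refinement adds a tent of height \<open>lam * wid s\<close> over the middle third
  and nothing elsewhere.\<close>

lemma aff_kid:
  assumes "len s > 0" "k < 4" "x \<in> itv (kd s k)"
  shows "\<bar>aff (kd s k) x - aff s x\<bar> \<le> lam * wid s"
proof -
  obtain a y l m where s: "s = (a,y,l,m)" by (cases s)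
  have l: "l > 0" using assms s by simp
  define q where "q = lam * sn m"
  have q: "q > 0" using lam_pos by (simp add: q_def)
  consider "k = 0 \<or> k = 3" | "k = 1" | "k = 2" using assms(2) by fastforce
  then show ?thesis
  proof cases
    case 1
    then show ?thesis using s l q by (auto simp: aff_def wid_def algebra_simps q_def less_imp_le)
  next
    case 2
    then have x: "a + l/3 \<le> x" "x \<le> a + l/2" using assms(3) s by (auto simp: itv_def)
    have "aff (kd s k) x - aff s x = q * (6 * (x - (a + l/3)))"
      using 2 s by (simp add: aff_def algebra_simps q_def)
    moreover have "q * (6 * (x - (a + l/3))) \<le> q * l" using x q by (intro mult_left_mono) auto
    moreover have "q * (6 * (x - (a + l/3))) \<ge> 0" using x q by (intro mult_nonneg_nonneg) auto
    ultimately show ?thesis using s by (simp add: wid_def q_def mult.commute mult.left_commute)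
  next
    case 3
    then have x: "a + l/2 \<le> x" "x \<le> a + l/2 + l/6" using assms(3) s by (auto simp: itv_def)
    have "aff (kd s k) x - aff s x = q * (l - 6 * (x - (a + l/2)))"
      using 3 s by (simp add: aff_def algebra_simps q_def)
    moreover have "q * (l - 6 * (x - (a + l/2))) \<le> q * l" using x q by (intro mult_left_mono) auto
    moreover have "q * (l - 6 * (x - (a + l/2))) \<ge> 0" using x q by (intro mult_nonneg_nonneg) auto
    ultimately show ?thesis using s by (simp add: wid_def q_def mult.commute mult.left_commute)
  qed
qed

lemma cell_approx_aff:
  assumes "len s > 0" "x \<in> itv s"
  shows "\<bar>cell_approx lam n s x - aff s x\<bar> \<le> KK * wid s"
  using assms
proof (induction n arbitrary: s)
  case 0
  then show ?case using KK wid_pos[OF 0(1)] by (simp add: cell_approx_0 itv_def less_imp_le)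
next
  case (Suc n)
  obtain k where k: "k < 4" "x \<in> itv (kd s k)" "cell_approx lam (Suc n) s x = cell_approx lam n (kd s k) x"
    using itv_kid_cases[OF Suc.prems(2)] Suc.prems(1) by metis
  have "\<bar>cell_approx lam n (kd s k) x - aff (kd s k) x\<bar> \<le> KK * wid (kd s k)"
    using Suc.IH[OF kid_len_pos k(2)] Suc.prems(1) by simp
  also have "\<dots> \<le> KK * (rho * wid s)" using kid_wid[OF Suc.prems(1) k(1)] KK by (intro mult_left_mono) auto
  finally have "\<bar>cell_approx lam (Suc n) s x - aff s x\<bar> \<le> KK * (rho * wid s) + lam * wid s"
    using aff_kid[OF Suc.prems(1) k(1,2)] unfolding k(3) by linarith
  also have "\<dots> = KK * wid s" using arg_cong[OF KK(1), of "\<lambda>t. t * wid s"] by (simp add: algebra_simps)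
  finally show ?case .
qed

lemma cell_approx_step:
  assumes "len s > 0" "x \<in> itv s"
  shows "\<bar>cell_approx lam (Suc n) s x - cell_approx lam n s x\<bar> \<le> lam * wid s * rho ^ n"
  using assms
proof (induction n arbitrary: s)
  case 0
  obtain k where k: "k < 4" "x \<in> itv (kd s k)" "cell_approx lam (Suc 0) s x = cell_approx lam 0 (kd s k) x"
    using itv_kid_cases[OF 0(2)] 0(1) by metis
  then show ?case using aff_kid[OF 0(1) k(1,2)] 0 kid_len_pos[OF 0(1), of lam k]
    by (simp add: cell_approx_0 itv_def)
next
  case (Suc n)
  obtain k where k: "k < 4" "x \<in> itv (kd s k)" "\<And>n. cell_approx lam (Suc n) s x = cell_approx lam n (kd s k) x"
    using itv_kid_cases[OF Suc.prems(2)] Suc.prems(1) by metis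
  have "\<bar>cell_approx lam (Suc n) (kd s k) x - cell_approx lam n (kd s k) x\<bar> \<le> lam * wid (kd s k) * rho ^ n"
    using Suc.IH[OF kid_len_pos k(2)] Suc.prems(1) by simp
  also have "\<dots> \<le> lam * (rho * wid s) * rho ^ n"
    using kid_wid[OF Suc.prems(1) k(1)] lam_pos rho by (intro mult_right_mono mult_left_mono) auto
  finally show ?case unfolding k(3)[of "Suc n"] k(3)[of n] by (simp add: mult_ac)
qed

lemma cell_approx_convergent:
  assumes "len s > 0" "x \<in> itv s"
  shows "convergent (\<lambda>n. cell_approx lam n s x)"
proof -
  have "summable (\<lambda>n. cell_approx lam (Suc n) s x - cell_approx lam n s x)"
  proof (rule summable_comparison_test')
    show "summable (\<lambda>n. lam * wid s * rho ^ n)" using rho by (intro summable_mult summable_geometric) auto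
    show "norm (cell_approx lam (Suc n) s x - cell_approx lam n s x) \<le> lam * wid s * rho ^ n" if "n \<ge> 0" for n
      using cell_approx_step[OF assms] by simp
  qed
  then have "convergent (\<lambda>n. \<Sum>i<n. cell_approx lam (Suc i) s x - cell_approx lam i s x)" by (simp only: summable_iff_convergent)
  then have "convergent (\<lambda>n. cell_approx lam n s x - cell_approx lam 0 s x)" 
    by (simp add: sum_lessThan_telescope[of "\<lambda>n. cell_approx lam n s x"])
  then have "convergent (\<lambda>n. (cell_approx lam n s x - cell_approx lam 0 s x) + cell_approx lam 0 s x)"
    by (rule convergent_add) (rule convergent_const)
  then show ?thesis by simp
qed

definition cell_limit :: "state \<Rightarrow> real \<Rightarrow> real" where "cell_limit s x = lim (\<lambda>n. cell_approx lam n s x)"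

lemma cell_limit_lim: "len s > 0 \<Longrightarrow> x \<in> itv s \<Longrightarrow> (\<lambda>n. cell_approx lam n s x) \<longlonglongrightarrow> cell_limit s x"
  using cell_approx_convergent by (simp add: cell_limit_def convergent_LIMSEQ_iff)

lemma cell_limit_aff: 
  assumes "len s > 0" "x \<in> itv s"
  shows "\<bar>cell_limit s x - aff s x\<bar> \<le> KK * wid s"
proof (rule LIMSEQ_le_const2)
  show "(\<lambda>n. \<bar>cell_approx lam n s x - aff s x\<bar>) \<longlonglongrightarrow> \<bar>cell_limit s x - aff s x\<bar>"
    by (intro tendsto_intros cell_limit_lim assms)
  show "\<exists>N. \<forall>n\<ge>N. \<bar>cell_approx lam n s x - aff s x\<bar> \<le> KK * wid s" using cell_approx_aff[OF assms] by blast
qed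

lemma cell_approx_ends:
  assumes "len s > 0"
  shows "cell_approx lam n s (left s) = hgt s" "cell_approx lam n s (left s + len s) = hgt s + slp s * len s"
proof -
  have *: "hgt (kd s 0) = hgt s" "hgt (kd s 3) + slp (kd s 3) * len (kd s 3) = hgt s + slp s * len s" for s
    by (cases s; simp add: field_simps)+
  show "cell_approx lam n s (left s) = hgt s" using assms
  proof (induction n arbitrary: s)
    case 0 then show ?case by (simp add: cell_approx_0 aff_def)
  next
    case (Suc n)
    then show ?case using Suc.IH[OF kid_len_pos[OF Suc.prems], of lam 0]
      by (simp add: cell_approx_Suc * kid_left)
  qed
  show "cell_approx lam n s (left s + len s) = hgt s + slp s * len s" using assms
  proof (induction n arbitrary: s)
    case 0 then show ?case by (simp add: cell_approx_0 aff_def)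
  next
    case (Suc n)
    have e: "left (kd s 3) + len (kd s 3) = left s + len s" by (simp add: kid_left kid_len)
    show ?case using Suc.IH[OF kid_len_pos[OF Suc.prems], of lam 3] Suc.prems e
      by (simp add: cell_approx_Suc *)
  qed
qed

lemma cell_limit_ends:
  assumes "len s > 0"
  shows "cell_limit s (left s) = hgt s" "cell_limit s (left s + len s) = hgt s + slp s * len s"
  using cell_approx_ends[OF assms] by (simp_all add: cell_limit_def)

text \<open>\<open>cell_approx\<close> evaluates a common end point in the left child only. The
  other child gives the same limit because breakpoint heights never change; non-adjacent closed
  children do not meet, which excludes the remaining cases.\<close>

lemma cell_limit_kid:
  assumes "len s > 0" "k < 4" "x \<in> itv (kd s k)"
  shows "cell_limit s x = cell_limit (kd s k) x"
proof -
  have xs: "x \<in> itv s" using itv_kid_subset assms by blast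
  obtain j where j: "j < 4" "x \<in> itv (kd s j)" "\<And>n. cell_approx lam (Suc n) s x = cell_approx lam n (kd s j) x"
    using itv_kid_cases[OF xs] assms(1) by metis
  have "(\<lambda>n. cell_approx lam (Suc n) s x) \<longlonglongrightarrow> cell_limit s x" using cell_limit_lim[OF assms(1) xs] by (rule LIMSEQ_Suc)
  then have "(\<lambda>n. cell_approx lam n (kd s j) x) \<longlonglongrightarrow> cell_limit s x" unfolding j(3) .
  then have e: "cell_limit s x = cell_limit (kd s j) x"
    using cell_limit_lim[OF kid_len_pos[OF assms(1)] j(2)] LIMSEQ_unique by blast
  have adj: "cell_limit (kd s i) x = cell_limit (kd s (Suc i)) x" if "i < 3" "x = left (kd s i) + len (kd s i)" "x = left (kd s (Suc i))" for i
  proof -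
    have "left_pt (kd s (Suc i)) = right_pt (kd s i)" using that(1) kid_ends(2-4)[of lam s]
      by (metis One_nat_def less_Suc_eq less_one numeral_2_eq_2 numeral_3_eq_3 not_less0)
    then have "hgt (kd s (Suc i)) = hgt (kd s i) + slp (kd s i) * len (kd s i)" by (simp add: left_pt_def right_pt_def)
    then show ?thesis using cell_limit_ends[OF kid_len_pos[OF assms(1), of lam i]] cell_limit_ends[OF kid_len_pos[OF assms(1), of lam "Suc i"]] that by simp
  qed
  have "cell_limit (kd s j) x = cell_limit (kd s k) x"
  proof -
    have l: "len s > 0" by fact
    consider "j = k" | "j = Suc k" | "k = Suc j" | "j > Suc k" | "k > Suc j" by linarith
    then show ?thesis
    proof cases
      case 2
      have "k = 0 \<or> k = 1 \<or> k = 2" using 2 j by auto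
      then have "x = left (kd s k) + len (kd s k)" "x = left (kd s (Suc k))"
        using assms(3) j(2) 2 l by (auto simp: itv_def kid_left kid_len numeral_2_eq_2[symmetric] numeral_3_eq_3[symmetric] kid_left(2)[simplified])
      then show ?thesis using adj[of k] 2 j by auto
    next
      case 3
      have "j = 0 \<or> j = 1 \<or> j = 2" using 3 assms by auto
      then have "x = left (kd s j) + len (kd s j)" "x = left (kd s (Suc j))"
        using assms(3) j(2) 3 l by (auto simp: itv_def kid_left kid_len numeral_2_eq_2[symmetric] numeral_3_eq_3[symmetric] kid_left(2)[simplified])
      then show ?thesis using adj[of j] 3 assms by auto
    next
      case 4
      then have "(k, j) \<in> {(0,2),(0,3),(1,3)}" using j(1) by auto
      then show ?thesis using assms(3) j(2) l by (auto simp: itv_def kid_left kid_len kid_left(2)[simplified])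
    next
      case 5
      then have "(j, k) \<in> {(0,2),(0,3),(1,3)}" using assms(2) by auto
      then show ?thesis using assms(3) j(2) l by (auto simp: itv_def kid_left kid_len kid_left(2)[simplified])
    qed simp
  qed
  with e show ?thesis by simp
qed

inductive cell :: "state \<Rightarrow> bool" where
  cell_root: "cell root"
| cell_kid: "cell s \<Longrightarrow> k < 4 \<Longrightarrow> cell (kd s k)"

lemma cell_basic: "cell s \<Longrightarrow> 0 < len s \<and> len s \<le> 1 \<and> 0 \<le> left s \<and> left s + len s \<le> 1 \<and> (\<forall>x\<in>itv s. F lam x = cell_limit s x)"
proof (induction rule: cell.induct)
  case cell_root
  show ?case by (auto simp: root_def F_def Fn_cell_approx cell_limit_def)
next
  case (cell_kid s k)
  have 1: "itv (kd s k) \<subseteq> itv s" using itv_kid_subset cell_kid by auto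
  then have "left (kd s k) \<in> itv s" "left (kd s k) + len (kd s k) \<in> itv s"
    using kid_len_pos[of s lam k] cell_kid by (auto simp: itv_def subset_iff)
  then have "0 \<le> left (kd s k) \<and> left (kd s k) + len (kd s k) \<le> 1"
    using cell_kid by (auto simp: itv_def)
  moreover have "\<forall>x\<in>itv (kd s k). F lam x = cell_limit (kd s k) x"
    using cell_limit_kid cell_kid 1 by (metis subsetD)
  moreover have "0 < len (kd s k)" "len (kd s k) \<le> 1"
    using cell_kid by (auto simp: kid_len)
  ultimately show ?case by blast
qed

end

section \<open>Pointwise regularity along addresses\<close>

text \<open>The second difference of \<open>u * Q u\<close> is \<open>u\<close> times that of
  \<open>Q\<close> plus \<open>2 * h\<close> times a first difference of \<open>Q\<close>, so the
  induction must carry the bounds on values and first differences along.\<close>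

lemma poly_second_difference:
  fixes P :: "real poly"
  shows "\<exists>K\<ge>0. (\<forall>u. \<bar>u\<bar> \<le> 1 \<longrightarrow> \<bar>poly P u\<bar> \<le> K) \<and>
     (\<forall>u v. \<bar>u\<bar> \<le> 1 \<and> \<bar>v\<bar> \<le> 1 \<longrightarrow> \<bar>poly P u - poly P v\<bar> \<le> K * \<bar>u - v\<bar>) \<and>
     (\<forall>u h. \<bar>u\<bar> \<le> 1 \<and> \<bar>u + h\<bar> \<le> 1 \<and> \<bar>u + 2*h\<bar> \<le> 1 \<longrightarrow>
        \<bar>poly P u - 2 * poly P (u + h) + poly P (u + 2*h)\<bar> \<le> K * h^2)"
proof (induction P)
  case 0
  show ?case by (rule exI[of _ 0]) simp
next
  case (pCons a Q)
  then obtain K where K: "K \<ge> 0" "\<And>u. \<bar>u\<bar> \<le> 1 \<Longrightarrow> \<bar>poly Q u\<bar> \<le> K"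
     "\<And>u v. \<bar>u\<bar> \<le> 1 \<Longrightarrow> \<bar>v\<bar> \<le> 1 \<Longrightarrow> \<bar>poly Q u - poly Q v\<bar> \<le> K * \<bar>u - v\<bar>"
     "\<And>u h. \<bar>u\<bar> \<le> 1 \<Longrightarrow> \<bar>u + h\<bar> \<le> 1 \<Longrightarrow> \<bar>u + 2*h\<bar> \<le> 1 \<Longrightarrow>
        \<bar>poly Q u - 2 * poly Q (u + h) + poly Q (u + 2*h)\<bar> \<le> K * h^2" by blast
  let ?K = "\<bar>a\<bar> + 3 * K"
  have 1: "\<bar>poly (pCons a Q) u\<bar> \<le> ?K" if "\<bar>u\<bar> \<le> 1" for u
  proof -
    have "\<bar>u * poly Q u\<bar> \<le> 1 * K" unfolding abs_mult using that K by (intro mult_mono) auto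
    then show ?thesis using K(1) by simp
  qed
  have 2: "\<bar>poly (pCons a Q) u - poly (pCons a Q) v\<bar> \<le> ?K * \<bar>u - v\<bar>" if "\<bar>u\<bar> \<le> 1" "\<bar>v\<bar> \<le> 1" for u v
  proof -
    have "poly (pCons a Q) u - poly (pCons a Q) v = u * (poly Q u - poly Q v) + (u - v) * poly Q v"
      by (simp add: algebra_simps)
    also have "\<bar>\<dots>\<bar> \<le> \<bar>u\<bar> * \<bar>poly Q u - poly Q v\<bar> + \<bar>u - v\<bar> * \<bar>poly Q v\<bar>"
      by (metis abs_mult abs_triangle_ineq)
    also have "\<dots> \<le> 1 * (K * \<bar>u - v\<bar>) + \<bar>u - v\<bar> * K"
      using that K by (intro add_mono mult_mono) auto
    also have "\<dots> \<le> ?K * \<bar>u - v\<bar>" using K(1) by (simp add: algebra_simps)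
    finally show ?thesis .
  qed
  have 3: "\<bar>poly (pCons a Q) u - 2 * poly (pCons a Q) (u + h) + poly (pCons a Q) (u + 2*h)\<bar> \<le> ?K * h^2"
    if "\<bar>u\<bar> \<le> 1" "\<bar>u + h\<bar> \<le> 1" "\<bar>u + 2*h\<bar> \<le> 1" for u h
  proof -
    have "poly (pCons a Q) u - 2 * poly (pCons a Q) (u + h) + poly (pCons a Q) (u + 2*h)
       = u * (poly Q u - 2 * poly Q (u + h) + poly Q (u + 2*h)) + 2 * h * (poly Q (u + 2*h) - poly Q (u + h))"
      by (simp add: algebra_simps)
    also have "\<bar>\<dots>\<bar> \<le> \<bar>u\<bar> * \<bar>poly Q u - 2 * poly Q (u + h) + poly Q (u + 2*h)\<bar>
          + \<bar>2 * h\<bar> * \<bar>poly Q (u + 2*h) - poly Q (u + h)\<bar>"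
      by (metis abs_mult abs_triangle_ineq)
    also have "\<dots> \<le> 1 * (K * h^2) + \<bar>2 * h\<bar> * (K * \<bar>(u + 2*h) - (u + h)\<bar>)"
      using that by (intro add_mono mult_mono K) auto
    also have "\<dots> = 3 * K * h^2" by (simp add: power2_eq_square algebra_simps abs_mult)
    also have "\<dots> \<le> ?K * h^2" by (simp add: algebra_simps)
    finally show ?thesis .
  qed
  show ?case using 1 2 3 K(1) by (intro exI[of _ ?K]) auto
qed

context koch
begin

section \<open>Oscillation on a cell and next to it\<close>

lemma cell_len: "cell s \<Longrightarrow> len s > 0" using cell_basic by blast

lemma cell_F:
  assumes "cell s"
  shows "F lam (left s) = hgt s" "F lam (left s + len s) = hgt s + slp s * len s"
    "F lam (left s + len s / 2) = hgt s + slp s * (len s / 2) + lam * wid s"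
    "\<And>x. x \<in> itv s \<Longrightarrow> \<bar>F lam x - aff s x\<bar> \<le> KK * wid s"
proof -
  have F: "F lam x = cell_limit t x" if "x \<in> itv t" "cell t" for x t using cell_basic that by blast
  have l: "len s > 0" using cell_len assms .
  show "F lam (left s) = hgt s" "F lam (left s + len s) = hgt s + slp s * len s"
    using F[OF _ assms] cell_limit_ends[OF l] l by (simp_all add: itv_def)
  have k: "cell (kd s 1)" using assms cell.intros by simp
  have e: "left (kd s 1) + len (kd s 1) = left s + len s / 2"
    "hgt (kd s 1) + slp (kd s 1) * len (kd s 1) = hgt s + slp s * (len s / 2) + lam * wid s"
    by (cases s; simp add: wid_def algebra_simps)+
  show "F lam (left s + len s / 2) = hgt s + slp s * (len s / 2) + lam * wid s"
  proof -
    have "left s + len s / 2 \<in> itv (kd s 1)" unfolding itv_def e using e(1) cell_len[OF k] by auto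
    from F[OF this k] show ?thesis using cell_limit_ends(2)[OF cell_len[OF k]] unfolding e by simp
  qed
  show "\<bar>F lam x - aff s x\<bar> \<le> KK * wid s" if "x \<in> itv s" for x
    using cell_limit_aff[OF l that] F[OF that assms] by simp
qed

text \<open>Two deviations from the chord, \<open>KK\<close> each, and the variation 1 of the chord
  itself, in units of \<open>wid\<close>.\<close>

definition KO :: real where "KO = 2 * KK + 1"

lemma KO_pos: "KO > 0" using KK by (simp add: KO_def)

lemma osc:
  assumes "cell s" "x \<in> itv s" "z \<in> itv s"
  shows "\<bar>F lam x - F lam z\<bar> \<le> KO * wid s"
proof -
  have l: "len s > 0" using cell_len assms by blast
  have "\<bar>x - z\<bar> \<le> len s" using assms by (auto simp: itv_def)
  then have "\<bar>slp s\<bar> * \<bar>x - z\<bar> \<le> sn (slp s) * len s" using abs_le_sn by (intro mult_mono) auto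
  moreover have "aff s x - aff s z = slp s * (x - z)" by (simp add: aff_def algebra_simps)
  ultimately have "\<bar>aff s x - aff s z\<bar> \<le> wid s" by (simp add: abs_mult wid_def mult.commute)
  then show ?thesis using cell_F(4)[OF assms(1,2)] cell_F(4)[OF assms(1,3)]
    unfolding KO_def distrib_right by linarith
qed

lemma scale_bracket:
  fixes l d :: real
  assumes "0 < d" "d \<le> l"
  obtains j where "l / 3 ^ j \<ge> d" "l / 3 ^ j \<le> 3 * d"
proof -
  obtain n where n: "(1/3) ^ n < d / l" using real_arch_pow_inv[of "d/l" "1/3"] assms by auto
  then have ex: "\<exists>n. l / 3 ^ n < d" using assms by (auto simp: field_simps power_divide intro!: exI[of _ n])
  define m where "m = (LEAST n. l / 3 ^ n < d)"
  have m: "l / 3 ^ m < d" unfolding m_def using ex by (rule LeastI_ex)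
  then have "m \<noteq> 0" using assms by (intro notI) simp
  then obtain j where j: "m = Suc j" by (cases m) auto
  have "\<not> l / 3 ^ j < d" using not_less_Least[of j "\<lambda>n. l / 3 ^ n < d"] j unfolding m_def by simp
  moreover have "l / 3 ^ j \<le> 3 * d" using m unfolding j by (simp add: field_simps)
  ultimately show ?thesis using that[of j] by linarith
qed

lemma iterate_end_kid:
  fixes k :: nat
  assumes "cell s" "k = 0 \<or> k = 3"
  defines "t j \<equiv> ((\<lambda>s. kd s k) ^^ j) s"
  shows "cell (t j)" "slp (t j) = slp s" "len (t j) = len s / 3 ^ j"
     "k = 0 \<Longrightarrow> left (t j) = left s" "k = 3 \<Longrightarrow> left (t j) + len (t j) = left s + len s"
proof -
  have T: "t 0 = s" "t (Suc j) = kd (t j) k" for j by (simp_all add: t_def)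
  have "cell (t j) \<and> slp (t j) = slp s \<and> len (t j) = len s / 3 ^ j \<and> (k = 0 \<longrightarrow> left (t j) = left s) \<and>
     (k = 3 \<longrightarrow> left (t j) + len (t j) = left s + len s)"
    by (induction j) (use assms in \<open>auto simp: T kid_slp kid_len kid_left intro!: cell.intros\<close>)
  then show "cell (t j)" "slp (t j) = slp s" "len (t j) = len s / 3 ^ j"
     "k = 0 \<Longrightarrow> left (t j) = left s" "k = 3 \<Longrightarrow> left (t j) + len (t j) = left s + len s" by auto
qed

text \<open>End children of end children keep the end point and the slope while their lengths shrink
  by 3. One of them has length between \<open>d\<close> and \<open>3 * d\<close>, and its
  oscillation gives the bound.\<close>

lemma lipschitz_at_ends:
  assumes "cell s" "x \<in> itv s"
  shows "\<bar>F lam x - F lam (left s)\<bar> \<le> 3 * KO * (x - left s) * sn (slp s)"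
    "\<bar>F lam x - F lam (left s + len s)\<bar> \<le> 3 * KO * (left s + len s - x) * sn (slp s)"
proof -
  have main: "\<bar>F lam x - F lam e\<bar> \<le> 3 * KO * d * sn (slp s)"
    if "k = 0 \<and> e = left s \<and> d = x - left s \<or> k = 3 \<and> e = left s + len s \<and> d = left s + len s - x" for k :: nat and e d
  proof (cases "d = 0")
    case True
    then show ?thesis using that by auto
  next
    case False
    then have d: "0 < d" "d \<le> len s" using that assms(2) by (auto simp: itv_def)
    obtain j where j: "len s / 3 ^ j \<ge> d" "len s / 3 ^ j \<le> 3 * d" using scale_bracket[OF d] .
    define t where "t = ((\<lambda>s. kd s k) ^^ j) s"
    have k: "k = 0 \<or> k = 3" using that by auto
    note T = iterate_end_kid[OF assms(1) k, of j, folded t_def]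
    have "x \<in> itv t" "e \<in> itv t" using that T j(1) d assms(2) cell_len[OF T(1)] by (auto simp: itv_def)
    then have "\<bar>F lam x - F lam e\<bar> \<le> KO * wid t" using osc T(1) by blast
    also have "wid t \<le> 3 * d * sn (slp s)" unfolding wid_def T(2,3) using j(2) by (intro mult_right_mono) auto
    then have "KO * wid t \<le> KO * (3 * d * sn (slp s))" using KO_pos by (intro mult_left_mono) auto
    finally show ?thesis by (simp add: mult_ac)
  qed
  show "\<bar>F lam x - F lam (left s)\<bar> \<le> 3 * KO * (x - left s) * sn (slp s)"
    using main[of 0 "left s" "x - left s"] by simp
  show "\<bar>F lam x - F lam (left s + len s)\<bar> \<le> 3 * KO * (left s + len s - x) * sn (slp s)"
    using main[of 3 "left s + len s"] by simp
qed

text \<open>The ratio \<open>(c + 1)^2 / (c - 1)\<close> compares the slopes of siblings through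
  their parent; the factor 6 pays for gaps that are only a sixth of the parent's length.\<close>

definition KN :: real where "KN = 6 * KO * ((c + 1)^2 / (c - 1))"

lemma KN_pos: "KN > 0" using KO_pos c_bounds by (auto simp: KN_def intro!: divide_pos_pos mult_pos_pos)

lemma sibling_sn:
  assumes "k < 4" "j < 4"
  shows "KO * sn (slp s) \<le> KN / 6 * sn (slp (kd s k))" "6 * KO * sn (slp (kd s j)) \<le> KN * sn (slp (kd s k))"
proof -
  have a: "sn (slp s) \<le> (c + 1) / (c - 1) * sn (slp (kd s k))"
    using kid_sn(2)[OF assms(1), of s] c_bounds by (simp add: field_simps)
  have b: "(c + 1) * sn (slp s) \<le> (c + 1)^2 / (c - 1) * sn (slp (kd s k))"
    using mult_left_mono[OF a, of "c + 1"] c_bounds by (simp add: power2_eq_square)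
  have d: "sn (slp (kd s j)) \<le> (c + 1)^2 / (c - 1) * sn (slp (kd s k))"
    using kid_sn(1)[OF assms(2), of s] b by simp
  show "6 * KO * sn (slp (kd s j)) \<le> KN * sn (slp (kd s k))"
    using mult_left_mono[OF d, of "6 * KO"] KO_pos by (simp add: KN_def mult_ac)
  have "sn (slp s) \<le> (c + 1) * sn (slp s)" using c_bounds by simp
  then have "sn (slp s) \<le> (c + 1)^2 / (c - 1) * sn (slp (kd s k))" using b by linarith
  from mult_left_mono[OF this, of KO] have "KO * sn (slp s) \<le> KO * ((c + 1)^2 / (c - 1)) * sn (slp (kd s k))"
    using KO_pos by (simp only: mult.assoc less_imp_le simp_thms)
  also have "KO * ((c + 1)^2 / (c - 1)) = KN / 6"
    unfolding KN_def by (metis mult.assoc nonzero_mult_div_cancel_left zero_neq_numeral)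
  finally show "KO * sn (slp s) \<le> KN / 6 * sn (slp (kd s k))" .
qed

text \<open>At distances comparable to the parent's length the oscillation over the whole parent is
  good enough.\<close>

lemma gap_bound:
  assumes "cell s" "k < 4" "x \<in> itv s" "z \<in> itv s" "len s / 6 \<le> d"
  shows "\<bar>F lam x - F lam z\<bar> \<le> KN * d * sn (slp (kd s k))"
proof -
  have "\<bar>F lam x - F lam z\<bar> \<le> KO * wid s" using osc assms by blast
  also have "\<dots> = len s * (KO * sn (slp s))" by (simp add: wid_def)
  also have "\<dots> \<le> len s * (KN / 6 * sn (slp (kd s k)))"
    using sibling_sn(1)[OF assms(2,2)] cell_len[OF assms(1)] by (intro mult_left_mono) auto
  also have "\<dots> = (len s / 6) * (KN * sn (slp (kd s k)))" by simp
  also have "\<dots> \<le> d * (KN * sn (slp (kd s k)))" using assms(5) KN_pos by (intro mult_right_mono) auto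
  finally show ?thesis by (simp add: mult_ac)
qed

text \<open>A digit 3 changes neither the right end point nor the slope, so adjacent cells of comparable size
  descend from siblings, possibly through digits 3 and 0 only, and hence have comparable slopes.\<close>
lemma neighbour_right:
  assumes "cell s" "left s + len s \<le> z" "z \<le> 1" "z \<le> left s + 2 * len s"
  shows "\<bar>F lam z - F lam (left s + len s)\<bar> \<le> KN * (z - (left s + len s)) * sn (slp s)"
  using assms
proof (induction s rule: cell.induct)
  case cell_root
  then show ?case by (simp add: root_def)
next
  case (cell_kid s k)
  let ?b = "left (kd s k) + len (kd s k)"
  have l: "len s > 0" using cell_len cell_kid by blast
  show ?case
  proof (cases "k = 3")
    case True
    have e: "?b = left s + len s" "slp (kd s k) = slp s" using True by (simp_all add: kid_left kid_len kid_slp)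
    have "len (kd s k) = len s / 3" using True by (simp add: kid_len)
    moreover have "z \<le> ?b + len (kd s k)" using cell_kid.prems by simp
    ultimately have "z \<le> left s + 2 * len s" using e(1) l by linarith
    then show ?thesis using cell_kid.IH cell_kid.prems unfolding e by blast
  next
    case False
    \<comment> \<open>The right neighbour is now a sibling. Either \<open>z\<close> lies in it and
      the Lipschitz bound at its left end applies, or \<open>z\<close> lies beyond it and
      \<open>gap_bound\<close> does.\<close>
    then have k: "k = 0 \<or> k = 1 \<or> k = 2" "Suc k < 4" using cell_kid by auto
    have e: "left (kd s (Suc k)) = ?b" using k(1)
      by (auto simp: kid_left kid_len numeral_2_eq_2[symmetric] numeral_3_eq_3[symmetric] kid_left(2)[simplified])
    have b: "?b \<in> itv s" "?b + len (kd s k) \<le> left s + len s" using k(1) l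
      by (auto simp: itv_def kid_left kid_len kid_left(2)[simplified])
    show ?thesis
    proof (cases "z \<in> itv (kd s (Suc k))")
      case True
      have c: "cell (kd s (Suc k))" using cell_kid k by (intro cell.intros)
      have "3 * KO * sn (slp (kd s (Suc k))) \<le> 6 * KO * sn (slp (kd s (Suc k)))" using KO_pos by simp
      also have "\<dots> \<le> KN * sn (slp (kd s k))" using sibling_sn(2) cell_kid k by blast
      finally have "(z - ?b) * (3 * KO * sn (slp (kd s (Suc k)))) \<le> (z - ?b) * (KN * sn (slp (kd s k)))"
        using cell_kid.prems by (intro mult_left_mono) auto
      moreover have "3 * KO * (z - ?b) * sn (slp (kd s (Suc k))) = (z - ?b) * (3 * KO * sn (slp (kd s (Suc k))))"
        "KN * (z - ?b) * sn (slp (kd s k)) = (z - ?b) * (KN * sn (slp (kd s k)))" by (simp_all only: mult_ac)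
      ultimately show ?thesis using lipschitz_at_ends(1)[OF c True] unfolding e by linarith
    next
      case False
      have "len s / 6 \<le> len (kd s (Suc k))" using l by (simp add: kid_len)
      then have "len s / 6 \<le> z - ?b" using False cell_kid.prems unfolding itv_def e by auto
      moreover have "z \<in> itv s" using b cell_kid.prems by (auto simp: itv_def)
      ultimately show ?thesis using gap_bound b cell_kid by blast
    qed
  qed
qed

text \<open>Mirror image of \<open>neighbour_right\<close>: digit 0 keeps the left end point and the
  slope.\<close>

lemma neighbour_left:
  assumes "cell s" "z \<le> left s" "0 \<le> z" "left s - len s \<le> z"
  shows "\<bar>F lam z - F lam (left s)\<bar> \<le> KN * (left s - z) * sn (slp s)"
  using assms
proof (induction s rule: cell.induct)
  case cell_root
  then show ?case by (simp add: root_def)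
next
  case (cell_kid s k)
  let ?a = "left (kd s k)"
  have l: "len s > 0" using cell_len cell_kid by blast
  show ?case
  proof (cases "k = 0")
    case True
    have e: "?a = left s" "slp (kd s k) = slp s" using True by (simp_all add: kid_left kid_len kid_slp)
    have "len (kd s k) = len s / 3" using True by (simp add: kid_len)
    then show ?thesis using cell_kid.IH cell_kid.prems l unfolding e by simp
  next
    case False
    then obtain j where j: "k = Suc j" by (cases k) auto
    then have k: "j = 0 \<or> j = 1 \<or> j = 2" "j < 4" using cell_kid by auto
    have e: "left (kd s j) + len (kd s j) = ?a" using k(1) unfolding j
      by (auto simp: kid_left kid_len numeral_2_eq_2[symmetric] numeral_3_eq_3[symmetric] kid_left(2)[simplified])
    have b: "?a \<in> itv s" "left s \<le> ?a - len (kd s k)" using k(1) l unfolding j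
      by (auto simp: itv_def kid_left kid_len numeral_2_eq_2[symmetric] numeral_3_eq_3[symmetric] kid_left(2)[simplified])
    show ?thesis
    proof (cases "z \<in> itv (kd s j)")
      case True
      have c: "cell (kd s j)" using cell_kid k by (intro cell.intros)
      have "3 * KO * sn (slp (kd s j)) \<le> 6 * KO * sn (slp (kd s j))" using KO_pos by simp
      also have "\<dots> \<le> KN * sn (slp (kd s k))" using sibling_sn(2) cell_kid k by blast
      finally have "(?a - z) * (3 * KO * sn (slp (kd s j))) \<le> (?a - z) * (KN * sn (slp (kd s k)))"
        using cell_kid.prems by (intro mult_left_mono) auto
      moreover have "3 * KO * (?a - z) * sn (slp (kd s j)) = (?a - z) * (3 * KO * sn (slp (kd s j)))"
        "KN * (?a - z) * sn (slp (kd s k)) = (?a - z) * (KN * sn (slp (kd s k)))" by (simp_all only: mult_ac)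
      ultimately show ?thesis using lipschitz_at_ends(2)[OF c True] unfolding e by linarith
    next
      case False
      have "len s / 6 \<le> len (kd s j)" using l by (simp add: kid_len)
      then have "len s / 6 \<le> ?a - z" using False cell_kid.prems e unfolding itv_def by auto
      moreover have "z \<in> itv s" using b cell_kid.prems by (auto simp: itv_def)
      ultimately show ?thesis using gap_bound b cell_kid by blast
    qed
  qed
qed

definition KM :: real where "KM = KO + KN"

text \<open>A ball around \<open>x\<close> of radius \<open>len s\<close> may leave \<open>s\<close>
  on either side. The estimate passes through the end point of \<open>s\<close>: \<open>osc\<close>
  inside, the neighbour lemmas outside.\<close>

lemma near_bound:
  assumes "cell s" "x \<in> itv s" "z \<in> {0..1}" "\<bar>z - x\<bar> \<le> len s"
  shows "\<bar>F lam z - F lam x\<bar> \<le> KM * wid s"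
proof -
  have l: "len s > 0" using cell_len assms by blast
  have w: "wid s > 0" using wid_pos l .
  have N: "KN * d * sn (slp s) \<le> KN * wid s" if "d \<le> len s" for d
    using that KN_pos unfolding wid_def by (simp add: mult_left_mono mult_right_mono mult.assoc)
  have O: "\<bar>F lam e - F lam x\<bar> \<le> KO * wid s" if "e \<in> itv s" for e using osc assms that by blast
  consider "z \<in> itv s" | "z < left s" | "z > left s + len s" unfolding itv_def by force
  then show ?thesis
  proof cases
    case 1
    then show ?thesis using O[OF 1] mult_pos_pos[OF KN_pos w] unfolding KM_def distrib_right by linarith
  next
    case 2
    have z: "left s - len s \<le> z" using assms 2 by (auto simp: itv_def)
    have "\<bar>F lam z - F lam (left s)\<bar> \<le> KN * wid s"
      using neighbour_left[OF assms(1), of z] z 2 assms(3) N[of "left s - z"] by auto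
    moreover have "\<bar>F lam (left s) - F lam x\<bar> \<le> KO * wid s" using O l by (simp add: itv_def)
    ultimately show ?thesis by (simp add: KM_def distrib_right)
  next
    case 3
    have z: "z \<le> left s + 2 * len s" using assms 3 by (auto simp: itv_def)
    have "\<bar>F lam z - F lam (left s + len s)\<bar> \<le> KN * wid s"
      using neighbour_right[OF assms(1), of z] z 3 assms(3) N[of "z - (left s + len s)"] by auto
    moreover have "\<bar>F lam (left s + len s) - F lam x\<bar> \<le> KO * wid s" using O l by (simp add: itv_def)
    ultimately show ?thesis by (simp add: KM_def distrib_right)
  qed
qed

end

text \<open>Types 1 and 2 are the children along which a large slope is multiplied by about
  \<open>6 * lam + 1\<close> and \<open>6 * lam - 1\<close>; which of the two middle children has which type depends
  on the sign of the slope.\<close>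
definition dig :: "real \<Rightarrow> nat \<Rightarrow> nat" where
  "dig m t = (if m < 0 \<and> t = 1 then 2 else if m < 0 \<and> t = 2 then 1 else t)"

lemma dig_dig [simp]: "dig m (dig m t) = t" by (simp add: dig_def)
lemma dig_less [simp]: "dig m t < 4 \<longleftrightarrow> t < 4" by (simp add: dig_def)

context koch
begin

section \<open>Addresses and the pointwise exponent\<close>

definition step :: "state \<Rightarrow> nat \<Rightarrow> state" where "step s t = kd s (dig (slp s) t)"

text \<open>Addresses list types instead of positions, so that the asymptotic growth factor is a
  function of the letter alone and independent letters give independent factors.\<close>

primrec path :: "(nat \<Rightarrow> nat) \<Rightarrow> nat \<Rightarrow> state" where
  "path \<omega> 0 = root"
| "path \<omega> (Suc n) = step (path \<omega> n) (\<omega> n)"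

lemma path_cell: "(\<And>i. \<omega> i < 4) \<Longrightarrow> cell (path \<omega> n)"
  by (induction n) (auto simp: step_def intro!: cell.intros)

lemma step_len: "len (step s t) = (if t = 1 \<or> t = 2 then len s / 6 else len s / 3)"
  by (simp add: step_def kid_len dig_def)

lemma path_len: "len (path \<omega> n) > 0" "len (path \<omega> n) \<le> (1/3)^n" "len (path \<omega> n) \<le> 1"
   "len (path \<omega> (Suc n)) \<ge> len (path \<omega> n) / 6"
proof -
  show 1: "len (path \<omega> n) > 0" for n by (induction n) (auto simp: root_def step_len)
  show 2: "len (path \<omega> n) \<le> (1/3)^n" 
  proof (induction n)
    case (Suc n)
    then show ?case using 1[of n] by (auto simp: step_len)
  qed (simp add: root_def)
  show "len (path \<omega> n) \<le> 1" using 2 by (meson order_trans power_le_one zero_le_divide_1_iff zero_le_numeral divide_le_eq_1_pos one_le_numeral zero_less_numeral)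
  show "len (path \<omega> (Suc n)) \<ge> len (path \<omega> n) / 6" using 1[of n] by (simp add: step_len)
qed

lemma address_exists:
  assumes "x \<in> {0..1}"
  obtains \<omega> where "\<And>i. \<omega> i < 4" "\<And>n. x \<in> itv (path \<omega> n)"
proof -
  have ex: "\<exists>t<4. x \<in> itv (step s t)" if xs: "x \<in> itv s" for s
  proof -
    obtain k where "k < 4" "x \<in> itv (kd s k)" by (rule itv_kid_cases[OF xs])
    then show ?thesis by (intro exI[of _ "dig (slp s) k"]) (simp add: step_def)
  qed
  define ch where "ch s = (SOME t. t < 4 \<and> x \<in> itv (step s t))" for s
  have ch: "ch s < 4 \<and> x \<in> itv (step s (ch s))" if "x \<in> itv s" for s
    unfolding ch_def by (rule someI_ex) (use ex[OF that] in blast)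
  define S where "S = rec_nat root (\<lambda>_ s. step s (ch s))"
  define \<omega> where "\<omega> n = ch (S n)" for n
  have S: "S 0 = root" "S (Suc n) = step (S n) (ch (S n))" for n by (simp_all add: S_def)
  have p: "path \<omega> n = S n" for n by (induction n) (auto simp: S \<omega>_def)
  have x: "x \<in> itv (S n)" for n
  proof (induction n)
    case 0 then show ?case using assms by (simp add: S root_def itv_def)
  next
    case (Suc n) then show ?case using ch by (simp add: S)
  qed
  show ?thesis using that[of \<omega>] x ch unfolding \<omega>_def p by (metis \<omega>_def p)
qed

lemma path_wid_le1: "(\<And>i. \<omega> i < 4) \<Longrightarrow> wid (path \<omega> n) \<le> 1"
proof (induction n)
  case 0 then show ?case by (simp add: wid_def root_def sn_def)
next
  case (Suc n)
  have "wid (path \<omega> (Suc n)) \<le> rho * wid (path \<omega> n)"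
    using kid_wid[OF path_len(1)] Suc.prems by (simp add: step_def)
  also have "\<dots> \<le> 1 * wid (path \<omega> n)" using rho wid_pos[OF path_len(1)] by (intro mult_right_mono) (auto simp: less_imp_le)
  finally show ?case using Suc by simp
qed

text \<open>The second difference of \<open>F lam\<close> over the two ends and the midpoint of a
  cell is exactly \<open>-2 * lam * wid\<close>, whereas a polynomial contributes only the square of
  the length. Hence the cap at 2 on the exponent.\<close>

lemma wid_le_of_Calpha:
  assumes "pointwise_Calpha (F lam) x \<beta>" "\<beta> \<ge> 0" "\<And>i. \<omega> i < 4" "\<And>n. x \<in> itv (path \<omega> n)"
  obtains C where "C > 0" "\<And>n. wid (path \<omega> n) \<le> C * len (path \<omega> n) powr (min \<beta> 2)"
proof -
  obtain P C \<delta> where C: "C > 0" "\<delta> > 0"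
    "\<And>z. z\<in>{0..1} \<Longrightarrow> \<bar>z - x\<bar> < \<delta> \<Longrightarrow> \<bar>F lam z - poly P (z - x)\<bar> \<le> C * \<bar>z - x\<bar> powr \<beta>"
    using assms(1) unfolding pointwise_Calpha_def by blast
  obtain K where K: "K \<ge> 0" "\<And>u h. \<bar>u\<bar> \<le> 1 \<Longrightarrow> \<bar>u + h\<bar> \<le> 1 \<Longrightarrow> \<bar>u + 2*h\<bar> \<le> 1 \<Longrightarrow>
        \<bar>poly P u - 2 * poly P (u + h) + poly P (u + 2*h)\<bar> \<le> K * h^2"
    using poly_second_difference[of P] by blast
  define \<gamma> where "\<gamma> = min \<beta> 2"
  \<comment> \<open>The first entry collects four errors \<open>C\<close> (the midpoint counts
    twice) and the polynomial's \<open>K\<close>; the second serves cells not shorter than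
    \<open>\<delta>\<close>, where \<open>wid \<le> 1\<close> is enough.\<close>
  define D where "D = max ((4 * C + K) / (2 * lam)) (1 / \<delta> powr \<gamma>)"
  have "wid (path \<omega> n) \<le> D * len (path \<omega> n) powr \<gamma>" for n
  proof -
    define s where "s = path \<omega> n"
    define l where "l = len s"
    have l: "0 < l" "l \<le> 1" using path_len unfolding l_def s_def by auto
    have s: "cell s" unfolding s_def using path_cell assms(3) .
    have g: "\<gamma> \<le> \<beta>" "\<gamma> \<le> 2" "\<gamma> \<ge> 0" using assms(2) by (auto simp: \<gamma>_def)
    show ?thesis
    proof (cases "l < \<delta>")
      case True
      have x: "x \<in> itv s" using assms(4) s_def by simp
      have B: "\<bar>F lam z - poly P (z - x)\<bar> \<le> C * l powr \<gamma>" if "z \<in> itv s" for z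
      proof -
        have zx: "\<bar>z - x\<bar> \<le> l" using that x unfolding itv_def l_def by auto
        have "z \<in> {0..1}" using that cell_basic[OF s] by (auto simp: itv_def)
        then have "\<bar>F lam z - poly P (z - x)\<bar> \<le> C * \<bar>z - x\<bar> powr \<beta>" using C(3) zx True by simp
        also have "\<dots> \<le> C * l powr \<beta>" using C zx assms(2) by (intro mult_left_mono powr_mono2) auto
        also have "\<dots> \<le> C * l powr \<gamma>" using C l g by (intro mult_left_mono powr_mono') auto
        finally show ?thesis .
      qed
      define u where "u = left s - x"
      have i: "left s \<in> itv s" "left s + l/2 \<in> itv s" "left s + l \<in> itv s" using l by (auto simp: itv_def l_def)
      have e: "left s - x = u" "left s + l/2 - x = u + l/2" "left s + l - x = u + 2 * (l/2)" by (auto simp: u_def)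
      have "\<bar>u\<bar> \<le> 1" "\<bar>u + l/2\<bar> \<le> 1" "\<bar>u + 2*(l/2)\<bar> \<le> 1" using x l unfolding itv_def l_def[symmetric] u_def by auto
      then have k: "\<bar>poly P u - 2 * poly P (u + l/2) + poly P (u + 2*(l/2))\<bar> \<le> K * (l/2)^2" by (rule K(2))
      have "(l/2)^2 \<le> l^2" using l by (intro power_mono) auto
      also have "l^2 = l powr 2" using l by (simp add: powr_numeral)
      also have "\<dots> \<le> l powr \<gamma>" using l g by (intro powr_mono') auto
      finally have k2: "K * (l/2)^2 \<le> K * l powr \<gamma>" using K by (intro mult_left_mono) auto
      have "F lam (left s) - 2 * F lam (left s + l/2) + F lam (left s + l) = - 2 * lam * wid s"
        using cell_F(1-3)[OF s] by (simp add: l_def algebra_simps)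
      then have "2 * lam * wid s \<le> 4 * (C * l powr \<gamma>) + K * l powr \<gamma>"
        using B[OF i(1)] B[OF i(2)] B[OF i(3)] k k2 unfolding e by linarith
      then have "wid s \<le> (4 * C + K) / (2 * lam) * l powr \<gamma>" using lam_pos by (simp add: field_simps)
      also have "\<dots> \<le> D * l powr \<gamma>" unfolding D_def by (intro mult_right_mono) auto
      finally show ?thesis unfolding s_def l_def .
    next
      case False
      have "wid s \<le> 1" using path_wid_le1 assms(3) s_def by simp
      also have "1 \<le> 1 / \<delta> powr \<gamma> * l powr \<gamma>" using powr_mono2[of \<gamma> \<delta> l] g C False by (simp add: field_simps)
      also have "\<dots> \<le> D * l powr \<gamma>" unfolding D_def by (intro mult_right_mono) auto
      finally show ?thesis unfolding s_def l_def .
    qed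
  qed
  moreover have "D > 0" using C by (simp add: D_def less_max_iff_disj)
  ultimately show ?thesis using that unfolding \<gamma>_def by blast
qed

text \<open>The constant polynomial suffices: \<open>near_bound\<close> is applied to the last cell
  on the path that is not shorter than the distance to \<open>x\<close>.\<close>

lemma Calpha_of_wid_le:
  assumes "\<beta> \<ge> 0" "\<And>i. \<omega> i < 4" "\<And>n. x \<in> itv (path \<omega> n)"
    "C > 0" "\<And>n. wid (path \<omega> n) \<le> C * len (path \<omega> n) powr \<beta>"
  shows "pointwise_Calpha (F lam) x \<beta>"
proof -
  have KM: "KM > 0" using KO_pos KN_pos by (simp add: KM_def)
  have "\<bar>F lam z - F lam x\<bar> \<le> KM * C * 6 powr \<beta> * \<bar>z - x\<bar> powr \<beta>" if z: "z \<in> {0..1}" "\<bar>z - x\<bar> < 1" for z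
  proof (cases "z = x")
    case False
    define d where "d = \<bar>z - x\<bar>"
    have d: "d > 0" "d < 1" using False z by (auto simp: d_def)
    obtain N where "(1/3)^N < d" using real_arch_pow_inv[of d "1/3"] d by auto
    then have ex: "\<exists>n. len (path \<omega> n) < d" using path_len(2)[of \<omega> N] by (intro exI[of _ N]) auto
    \<comment> \<open>The predecessor \<open>j\<close> of this index has length at least
      \<open>d\<close>, and at most \<open>6 * d\<close> because one step shrinks by at most
      6.\<close>
    define m where "m = (LEAST n. len (path \<omega> n) < d)"
    have m: "len (path \<omega> m) < d" unfolding m_def using ex by (rule LeastI_ex)
    have "m \<noteq> 0" using m d by (intro notI) (simp add: root_def)
    then obtain j where j: "m = Suc j" by (cases m) auto
    have nj: "\<not> len (path \<omega> j) < d" using not_less_Least[of j "\<lambda>n. len (path \<omega> n) < d"] j unfolding m_def by simp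
    have lj: "len (path \<omega> j) \<le> 6 * d" using m path_len(4)[of \<omega> j] unfolding j by simp
    have "\<bar>F lam z - F lam x\<bar> \<le> KM * wid (path \<omega> j)"
      using near_bound[OF path_cell assms(3) z(1)] assms(2) nj unfolding d_def by simp
    also have "\<dots> \<le> KM * (C * len (path \<omega> j) powr \<beta>)" using assms(5) KM by (intro mult_left_mono) auto
    also have "\<dots> \<le> KM * (C * (6 * d) powr \<beta>)" using lj KM assms path_len(1)[of \<omega> j]
      by (intro mult_left_mono powr_mono2) auto
    also have "\<dots> = KM * C * 6 powr \<beta> * d powr \<beta>" using d by (simp add: powr_mult)
    finally show ?thesis unfolding d_def .
  qed simp
  then show ?thesis unfolding pointwise_Calpha_def using KM assms(4)
    by (intro exI[of _ "[:F lam x:]"] exI[of _ "KM * C * 6 powr \<beta>"] exI[of _ 1]) simp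
qed

end

section \<open>Upper bound by coverings\<close>

text \<open>A pressure: the sum of \<open>u powr q * r powr e\<close> over the four types, that is,
  the one-step growth of sums of \<open>len powr e * \<bar>slp\<bar> powr q\<close> in the limit of
  large slopes.\<close>

definition pres :: "real \<Rightarrow> real \<Rightarrow> real \<Rightarrow> real" where
  "pres lam q e = 2 * 3 powr (-e) + ((6*lam + 1) powr q + (6*lam - 1) powr q) * 6 powr (-e)"

definition words :: "nat \<Rightarrow> nat list set" where
  "words n = {w. length w = n \<and> set w \<subseteq> {..<4}}"

lemma words_0: "words 0 = {[]}" by (auto simp: words_def)

lemma words_Suc: "words (Suc n) = (\<lambda>(w, t). w @ [t]) ` (words n \<times> {..<4})"
proof
  show "words (Suc n) \<subseteq> (\<lambda>(w, t). w @ [t]) ` (words n \<times> {..<4})"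
  proof
    fix w assume w: "w \<in> words (Suc n)"
    then have "w \<noteq> []" by (auto simp: words_def)
    then have "w = butlast w @ [last w]" by simp
    moreover have "butlast w \<in> words n" "last w < 4"
      using w \<open>w \<noteq> []\<close> in_set_butlastD[of _ w] last_in_set[of w] by (auto simp: words_def subset_iff)
    ultimately show "w \<in> (\<lambda>(w, t). w @ [t]) ` (words n \<times> {..<4})" by force
  qed
qed (auto simp: words_def)

lemma finite_words: "finite (words n)"
  by (induction n) (simp_all add: words_0 words_Suc)

lemma sum_words_Suc: "(\<Sum>w\<in>words (Suc n). f w) = (\<Sum>w\<in>words n. \<Sum>t<4. f (w @ [t]))"
proof -
  have "inj_on (\<lambda>(w, t). w @ [t]) (words n \<times> {..<4})" by (auto simp: inj_on_def)
  then have "(\<Sum>w\<in>words (Suc n). f w) = (\<Sum>p\<in>words n \<times> {..<4}. f (fst p @ [snd p]))"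
    unfolding words_Suc by (subst sum.reindex) (auto simp: case_prod_unfold)
  then show ?thesis by (simp add: sum.cartesian_product case_prod_unfold)
qed

lemma sum_less_4: "(\<Sum>t<(4::nat). f t) = f 0 + f 1 + f 2 + (f 3 :: real)"
  by (simp add: eval_nat_numeral)

context koch
begin

lemma pres_c: "pres lam q e = 2 * 3 powr (-e) + ((c + 1) powr q + (c - 1) powr q) * 6 powr (-e)"
  by (simp add: pres_def c_def)

lemma pres_antimono: "e \<le> e' \<Longrightarrow> pres lam q e' \<le> pres lam q e"
  unfolding pres_def by (intro add_mono mult_left_mono powr_mono) auto

text \<open>The fastest possible growth of slopes against lengths, attained asymptotically by
  choosing type 1 forever: the slope gains \<open>c + 1\<close> while the length loses 6.\<close>

definition kmax :: real where "kmax = ln (c + 1) / ln 6"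

lemma kmax: "0 < kmax" "kmax < 1" "6 powr kmax = c + 1" "alpha_min lam = 1 - kmax"
proof -
  show "0 < kmax" "kmax < 1" "6 powr kmax = c + 1" using c_bounds by (auto simp: kmax_def powr_def field_simps)
  show "alpha_min lam = 1 - kmax" by (simp add: alpha_min_def kmax_def c_def)
qed

lemma step_sn: "t < 4 \<Longrightarrow> sn (slp (step s t)) \<le> (c + 1) * sn (slp s)"
  using kid_sn(1) by (simp add: step_def)

lemma step_slp03: "t = 0 \<or> t = 3 \<Longrightarrow> slp (step s t) = slp s"
  by (auto simp: step_def dig_def kid_slp)

lemma step_slp12: "\<bar>slp (step s 1)\<bar> = c * sn (slp s) + \<bar>slp s\<bar>" "\<bar>slp (step s 2)\<bar> = c * sn (slp s) - \<bar>slp s\<bar>"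
proof -
  have "c * sn (slp s) \<ge> \<bar>slp s\<bar>" using slope_ge1[of "slp s"] by linarith
  then show "\<bar>slp (step s 1)\<bar> = c * sn (slp s) + \<bar>slp s\<bar>" "\<bar>slp (step s 2)\<bar> = c * sn (slp s) - \<bar>slp s\<bar>"
    by (auto simp: step_def dig_def kid_slp kid_slp(2)[simplified])
qed

lemma path_len_decseq: "len (path \<omega> (Suc n)) \<le> len (path \<omega> n)"
  using path_len(1)[of \<omega> n] by (simp add: step_len)

text \<open>The quantity \<open>sn * len powr kmax\<close> never increases along a path: a middle
  child multiplies it by at most \<open>(c + 1) / 6 powr kmax\<close>, which is 1.\<close>

lemma path_wid_min:
  assumes "\<And>i. \<omega> i < 4"
  shows "wid (path \<omega> n) \<le> len (path \<omega> n) powr (1 - kmax)"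
proof -
  have "sn (slp (path \<omega> n)) * len (path \<omega> n) powr kmax \<le> 1"
  proof (induction n)
    case 0 show ?case by (simp add: root_def sn_def)
  next
    case (Suc n)
    let ?s = "path \<omega> n"
    show ?case
    proof (cases "\<omega> n = 1 \<or> \<omega> n = 2")
      case True
      have "sn (slp (path \<omega> (Suc n))) * len (path \<omega> (Suc n)) powr kmax
         \<le> ((c + 1) * sn (slp ?s)) * (len ?s / 6) powr kmax"
      proof -
        have e: "len (path \<omega> (Suc n)) = len ?s / 6" using True by (auto simp: step_len)
        have "sn (slp (path \<omega> (Suc n))) \<le> (c + 1) * sn (slp ?s)" using step_sn[OF assms[of n], of ?s] by simp
        then show ?thesis unfolding e by (rule mult_right_mono) simp
      qed
      also have "\<dots> = sn (slp ?s) * len ?s powr kmax"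
        using path_len(1)[of \<omega> n] c_bounds by (simp add: powr_divide kmax)
      finally show ?thesis using Suc by simp
    next
      case False
      then have "\<omega> n = 0 \<or> \<omega> n = 3" using assms[of n] by auto
      then have "slp (path \<omega> (Suc n)) = slp ?s" using step_slp03[of "\<omega> n" ?s] by simp
      moreover have "len (path \<omega> (Suc n)) powr kmax \<le> len ?s powr kmax"
        by (rule powr_mono2[OF less_imp_le[OF kmax(1)] less_imp_le[OF path_len(1)] path_len_decseq])
      ultimately have "sn (slp (path \<omega> (Suc n))) * len (path \<omega> (Suc n)) powr kmax \<le> sn (slp ?s) * len ?s powr kmax"
        by (simp add: mult_left_mono del: path.simps)
      then show ?thesis using Suc by simp
    qed
  qed
  moreover have "len (path \<omega> n) powr (1 - kmax) * len (path \<omega> n) powr kmax = len (path \<omega> n)"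
    using path_len(1)[of \<omega> n] by (simp add: powr_add[symmetric])
  ultimately have "wid (path \<omega> n) * len (path \<omega> n) powr kmax \<le> len (path \<omega> n) powr (1 - kmax) * len (path \<omega> n) powr kmax"
    using path_len(1)[of \<omega> n] by (simp add: wid_def mult.assoc)
  then show ?thesis using path_len(1)[of \<omega> n] by simp
qed

lemma len_powr_tendsto:
  assumes "a > 0"
  shows "(\<lambda>n. len (path \<omega> n) powr a) \<longlonglongrightarrow> 0"
proof (rule tendsto_sandwich)
  show "\<forall>\<^sub>F n in sequentially. 0 \<le> len (path \<omega> n) powr a" by simp
  show "\<forall>\<^sub>F n in sequentially. len (path \<omega> n) powr a \<le> ((1/3) powr a) ^ n"
  proof (intro always_eventually allI)
    fix n
    have "len (path \<omega> n) powr a \<le> ((1/3)^n) powr a"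
      using path_len[of \<omega> n] assms by (intro powr_mono2) auto
    also have "\<dots> = ((1/3) powr a) ^ n" by (simp add: powr_realpow[symmetric] powr_powr mult.commute)
    finally show "len (path \<omega> n) powr a \<le> ((1/3) powr a) ^ n" .
  qed
  have "(1/3::real) powr a < 1 powr a" using assms by (intro powr_less_mono2) auto
  then show "(\<lambda>n. ((1/3) powr a) ^ n) \<longlonglongrightarrow> 0" by (intro LIMSEQ_realpow_zero) auto
qed simp

lemma len_powr_small:
  assumes "a < b"
  shows "\<forall>\<^sub>F n in sequentially. C * len (path \<omega> n) powr b < len (path \<omega> n) powr a"
proof -
  have "(\<lambda>n. C * len (path \<omega> n) powr (b - a)) \<longlonglongrightarrow> C * 0"
    by (intro tendsto_mult tendsto_const len_powr_tendsto) (use assms in simp)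
  then have "\<forall>\<^sub>F n in sequentially. C * len (path \<omega> n) powr (b - a) < 1"
    by (rule order_tendstoD(2)) simp
  then show ?thesis
  proof (rule eventually_mono)
    fix n assume "C * len (path \<omega> n) powr (b - a) < 1"
    then have "C * len (path \<omega> n) powr (b - a) * len (path \<omega> n) powr a < 1 * len (path \<omega> n) powr a"
      using path_len(1)[of \<omega> n] by (intro mult_strict_right_mono) auto
    then show "C * len (path \<omega> n) powr b < len (path \<omega> n) powr a"
      using path_len(1)[of \<omega> n] by (simp add: powr_diff)
  qed
qed

lemma hoelder_upper: "\<beta> \<ge> 0 \<Longrightarrow> pointwise_Calpha f x \<beta> \<Longrightarrow> ereal \<beta> \<le> hoelder_exp f x"
  unfolding hoelder_exp_def by (intro Sup_upper) auto

lemma hoelder_less: "ereal \<beta> < hoelder_exp f x \<Longrightarrow> \<exists>\<beta>'>\<beta>. \<beta>' \<ge> 0 \<and> pointwise_Calpha f x \<beta>'"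
  unfolding hoelder_exp_def less_Sup_iff by auto

text \<open>Since \<open>sn \<ge> 1\<close>, \<open>wid\<close> is at least the length of the cell;
  an exponent above 1 would make it of smaller order.\<close>

lemma Calpha_le_1:
  assumes "x \<in> {0..1}" "pointwise_Calpha (F lam) x \<beta>" "\<beta> \<ge> 0"
  shows "\<beta> \<le> 1"
proof (rule ccontr)
  assume b: "\<not> \<beta> \<le> 1"
  obtain \<omega> where w: "\<And>i. \<omega> i < 4" "\<And>n. x \<in> itv (path \<omega> n)" using address_exists assms(1) by blast
  obtain C where C: "C > 0" "\<And>n. wid (path \<omega> n) \<le> C * len (path \<omega> n) powr (min \<beta> 2)"
    using wid_le_of_Calpha[OF assms(2,3) w] by blast
  have "\<forall>\<^sub>F n in sequentially. C * len (path \<omega> n) powr (min \<beta> 2) < len (path \<omega> n) powr 1"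
    using b by (intro len_powr_small) auto
  from eventually_happens'[OF sequentially_bot this]
  obtain n where "C * len (path \<omega> n) powr (min \<beta> 2) < len (path \<omega> n) powr 1" by blast
  then have n: "C * len (path \<omega> n) powr (min \<beta> 2) < len (path \<omega> n)" using path_len(1)[of \<omega> n] by simp
  have "len (path \<omega> n) * 1 \<le> wid (path \<omega> n)" unfolding wid_def
    using path_len(1)[of \<omega> n] sn_ge1 by (intro mult_left_mono) auto
  then show False using n C(2)[of n] by simp
qed

lemma hoelder_range:
  assumes "x \<in> {0..1}"
  shows "ereal (alpha_min lam) \<le> hoelder_exp (F lam) x" "hoelder_exp (F lam) x \<le> 1"
proof -
  obtain \<omega> where w: "\<And>i. \<omega> i < 4" "\<And>n. x \<in> itv (path \<omega> n)" using address_exists assms(1) by blast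
  show "ereal (alpha_min lam) \<le> hoelder_exp (F lam) x" unfolding kmax(4)
    by (intro hoelder_upper Calpha_of_wid_le[of _ \<omega> _ 1]) (use w kmax path_wid_min in auto)
  show "hoelder_exp (F lam) x \<le> 1" unfolding hoelder_exp_def
    by (rule Sup_least) (use Calpha_le_1[OF assms] in auto)
qed

lemma Calpha_of_eventually_wid_le:
  assumes "\<beta> \<ge> 0" "\<And>i. \<omega> i < 4" "\<And>n. x \<in> itv (path \<omega> n)"
    and N: "\<And>n. n \<ge> N \<Longrightarrow> wid (path \<omega> n) \<le> len (path \<omega> n) powr \<beta>"
  shows "pointwise_Calpha (F lam) x \<beta>"
proof -
  let ?l = "\<lambda>n. len (path \<omega> n)"
  have l: "?l n > 0" for n by (rule path_len(1))
  \<comment> \<open>The finitely many early generations are absorbed into the constant.\<close>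
  define C where "C = (\<Sum>n<N. wid (path \<omega> n) / ?l n powr \<beta>) + 1"
  have pos: "0 \<le> wid (path \<omega> n) / ?l n powr \<beta>" for n using wid_pos[OF l] by (simp add: less_imp_le)
  then have "C \<ge> 1" unfolding C_def by (simp add: sum_nonneg)
  have "wid (path \<omega> n) \<le> C * ?l n powr \<beta>" for n
  proof (cases "n < N")
    case True
    then have "wid (path \<omega> n) / ?l n powr \<beta> \<le> C"
      unfolding C_def using member_le_sum[of n "{..<N}" "\<lambda>n. wid (path \<omega> n) / ?l n powr \<beta>"] pos by auto
    then show ?thesis using l[of n] by (simp add: field_simps)
  next
    case False
    then show ?thesis using N[of n] mult_right_mono[OF \<open>C \<ge> 1\<close>, of "?l n powr \<beta>"] by simp
  qed
  then show ?thesis using assms(1-3) \<open>C \<ge> 1\<close> by (intro Calpha_of_wid_le[of _ \<omega> _ C]) auto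
qed

text \<open>For \<open>q \<ge> 0\<close> this uses that the exponent is not larger than \<open>\<alpha>\<close>, for \<open>q < 0\<close> that it is not
  smaller.\<close>
lemma frequently_good:
  assumes h: "hoelder_exp (F lam) x = ereal \<alpha>" and x: "x \<in> {0..1}" and \<epsilon>: "\<epsilon> > 0"
    and w: "\<And>i. \<omega> i < 4" "\<And>n. x \<in> itv (path \<omega> n)"
  shows "\<exists>n\<ge>N. 1 \<le> len (path \<omega> n) powr ((1 - \<alpha>) * q - \<epsilon> * \<bar>q\<bar>) * sn (slp (path \<omega> n)) powr q"
proof -
  let ?l = "\<lambda>n. len (path \<omega> n)" and ?s = "\<lambda>n. sn (slp (path \<omega> n))"
  have l: "?l n > 0" for n by (rule path_len(1))
  have a: "\<alpha> \<le> 1" "\<alpha> > 0" using hoelder_range[OF x] kmax unfolding h by auto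
  show ?thesis
  proof (cases "q \<ge> 0")
    case True
    have "\<exists>n\<ge>N. ?l n powr (\<alpha> + \<epsilon>) \<le> wid (path \<omega> n)"
    proof (rule ccontr)
      assume "\<not> ?thesis"
      then have b: "n \<ge> N \<Longrightarrow> wid (path \<omega> n) \<le> ?l n powr (\<alpha> + \<epsilon>)" for n by force
      have "pointwise_Calpha (F lam) x (\<alpha> + \<epsilon>)"
        using a \<epsilon> b by (intro Calpha_of_eventually_wid_le[OF _ w]) auto
      then have "ereal (\<alpha> + \<epsilon>) \<le> hoelder_exp (F lam) x" using a \<epsilon> by (intro hoelder_upper) auto
      then show False using h \<epsilon> by simp
    qed
    then obtain n where n: "n \<ge> N" "?l n powr (\<alpha> + \<epsilon>) \<le> wid (path \<omega> n)" by blast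
    have "?l n powr (\<alpha> + \<epsilon>) / ?l n \<le> ?s n" using n l[of n] by (simp add: wid_def field_simps)
    then have "?l n powr (\<alpha> + \<epsilon> - 1) \<le> ?s n" using l[of n] by (simp add: powr_diff)
    then have "(?l n powr (\<alpha> + \<epsilon> - 1)) powr q \<le> ?s n powr q"
      by (rule powr_mono2[OF True powr_ge_zero])
    then have "?l n powr ((1 - \<alpha>) * q - \<epsilon> * \<bar>q\<bar>) * (?l n powr (\<alpha> + \<epsilon> - 1)) powr q
       \<le> ?l n powr ((1 - \<alpha>) * q - \<epsilon> * \<bar>q\<bar>) * ?s n powr q" by (intro mult_left_mono) auto
    moreover have "?l n powr ((1 - \<alpha>) * q - \<epsilon> * \<bar>q\<bar>) * (?l n powr (\<alpha> + \<epsilon> - 1)) powr q = 1"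
    proof -
      have "(1 - \<alpha>) * q - \<epsilon> * \<bar>q\<bar> + (\<alpha> + \<epsilon> - 1) * q = 0" using True by (simp add: algebra_simps)
      then show ?thesis using l[of n] unfolding powr_powr powr_add[symmetric] by simp
    qed
    ultimately show ?thesis using n(1) by (intro exI[of _ n]) simp
  next
    case False
    have "ereal (\<alpha> - \<epsilon>) < hoelder_exp (F lam) x" using h \<epsilon> by simp
    then obtain \<beta> where \<beta>: "\<beta> > \<alpha> - \<epsilon>" "\<beta> \<ge> 0" "pointwise_Calpha (F lam) x \<beta>" using hoelder_less by blast
    obtain C where C: "C > 0" "\<And>n. wid (path \<omega> n) \<le> C * ?l n powr (min \<beta> 2)"
      using wid_le_of_Calpha[OF \<beta>(3,2) w] by blast
    have "\<forall>\<^sub>F n in sequentially. C * ?l n powr (min \<beta> 2) < ?l n powr (\<alpha> - \<epsilon>)"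
      using \<beta> a \<epsilon> by (intro len_powr_small) auto
    then have "\<forall>\<^sub>F n in sequentially. C * ?l n powr (min \<beta> 2) < ?l n powr (\<alpha> - \<epsilon>) \<and> n \<ge> N"
      using eventually_ge_at_top by (rule eventually_conj)
    then obtain n where n: "n \<ge> N" "C * ?l n powr (min \<beta> 2) < ?l n powr (\<alpha> - \<epsilon>)"
      by (auto simp: eventually_sequentially)
    then have "wid (path \<omega> n) \<le> ?l n powr (\<alpha> - \<epsilon>)" using C(2)[of n] by simp
    then have "?s n \<le> ?l n powr (\<alpha> - \<epsilon>) / ?l n" using l[of n] by (simp add: wid_def field_simps)
    then have "?s n \<le> ?l n powr (\<alpha> - \<epsilon> - 1)" using l[of n] by (simp add: powr_diff)
    then have "(?l n powr (\<alpha> - \<epsilon> - 1)) powr q \<le> ?s n powr q"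
      by (rule powr_mono2'[OF _ sn_pos, rotated]) (use False in simp)
    then have "?l n powr ((1 - \<alpha>) * q - \<epsilon> * \<bar>q\<bar>) * (?l n powr (\<alpha> - \<epsilon> - 1)) powr q
       \<le> ?l n powr ((1 - \<alpha>) * q - \<epsilon> * \<bar>q\<bar>) * ?s n powr q" by (intro mult_left_mono) auto
    moreover have "?l n powr ((1 - \<alpha>) * q - \<epsilon> * \<bar>q\<bar>) * (?l n powr (\<alpha> - \<epsilon> - 1)) powr q = 1"
    proof -
      have "(1 - \<alpha>) * q - \<epsilon> * \<bar>q\<bar> + (\<alpha> - \<epsilon> - 1) * q = 0" using False by (simp add: algebra_simps)
      then show ?thesis using l[of n] unfolding powr_powr powr_add[symmetric] by simp
    qed
    ultimately show ?thesis using n(1) by (intro exI[of _ n]) simp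
  qed
qed

text \<open>\<open>sn m powr q\<close> contracts by about \<open>pres lam q e\<close> only at large
  slopes, so \<open>V\<close> modifies it. For \<open>q < 0\<close> it is
  \<open>\<bar>m\<bar> powr q\<close> with a separate value at slope 0, and
  \<open>c * sn m \<ge> c * \<bar>m\<bar>\<close> has the right direction. For
  \<open>q \<ge> 0\<close> a large constant is added, which dominates on bounded slopes.\<close>

lemma lyapunov_exists:
  assumes G: "pres lam q e < 1"
  obtains V \<theta> where "0 < \<theta>" "\<theta> < 1" "\<And>m. sn m powr q \<le> V \<bar>m\<bar>"
    "\<And>m. 2 * 3 powr (-e) * V \<bar>m\<bar> + 6 powr (-e) * (V (c * sn m + \<bar>m\<bar>) + V (c * sn m - \<bar>m\<bar>)) \<le> \<theta> * V \<bar>m\<bar>"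
proof (cases "q \<ge> 0")
  case False
  define B where "B = pres lam q e"
  have B: "B < 1" "0 < B" "2 * 3 powr (-e) < B" using G c_bounds by (auto simp: B_def pres_c add_pos_pos)
  \<comment> \<open>Large enough for the inequality at slope 0, where both middle children have
    slope \<open>c\<close> in absolute value.\<close>
  define D where "D = 1 + 2 * 6 powr (-e) * c powr q / (B - 2 * 3 powr (-e))"
  define V where "V m = (if m = 0 then D else m powr q)" for m :: real
  have D: "D \<ge> 1" "2 * 3 powr (-e) * D + 6 powr (-e) * (2 * c powr q) \<le> B * D"
  proof -
    show "D \<ge> 1" using B by (simp add: D_def)
    have "(B - 2 * 3 powr (-e)) * D = (B - 2 * 3 powr (-e)) + 2 * 6 powr (-e) * c powr q"
      using B(3) by (simp add: D_def field_simps)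
    then show "2 * 3 powr (-e) * D + 6 powr (-e) * (2 * c powr q) \<le> B * D" using B(3) by (simp add: algebra_simps)
  qed
  have 1: "sn m powr q \<le> V \<bar>m\<bar>" for m
  proof (cases "m = 0")
    case True then show ?thesis using D by (simp add: V_def sn_def)
  next
    case m: False
    then show ?thesis using False abs_le_sn[of m] by (auto simp: V_def intro!: powr_mono2')
  qed
  have 2: "2 * 3 powr (-e) * V \<bar>m\<bar> + 6 powr (-e) * (V (c * sn m + \<bar>m\<bar>) + V (c * sn m - \<bar>m\<bar>)) \<le> B * V \<bar>m\<bar>" for m
  proof (cases "m = 0")
    case True
    then show ?thesis using D(2) c_bounds by (simp add: V_def sn_def)
  next
    case m: False
    have cs: "c * \<bar>m\<bar> \<le> c * sn m" using abs_le_sn[of m] c_bounds by simp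
    have "V (c * sn m + \<bar>m\<bar>) \<le> ((c + 1) * \<bar>m\<bar>) powr q"
    proof -
      have "c * sn m + \<bar>m\<bar> \<noteq> 0" using cs c_bounds m by (smt (verit) mult_pos_pos)
      then have "V (c * sn m + \<bar>m\<bar>) = (c * sn m + \<bar>m\<bar>) powr q" by (simp add: V_def)
      also have "\<dots> \<le> ((c + 1) * \<bar>m\<bar>) powr q" using False cs m c_bounds
        by (intro powr_mono2') (auto simp: algebra_simps add_pos_pos)
      finally show ?thesis .
    qed
    moreover have "V (c * sn m - \<bar>m\<bar>) \<le> ((c - 1) * \<bar>m\<bar>) powr q"
    proof -
      have "c * sn m - \<bar>m\<bar> \<noteq> 0" using slope_ge1[of m] by linarith
      then have "V (c * sn m - \<bar>m\<bar>) = (c * sn m - \<bar>m\<bar>) powr q" by (simp add: V_def)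
      also have "\<dots> \<le> ((c - 1) * \<bar>m\<bar>) powr q" using False cs m c_bounds
        by (intro powr_mono2') (auto simp: algebra_simps add_pos_pos)
      finally show ?thesis .
    qed
    ultimately have "6 powr (-e) * (V (c * sn m + \<bar>m\<bar>) + V (c * sn m - \<bar>m\<bar>))
      \<le> 6 powr (-e) * (((c + 1) * \<bar>m\<bar>) powr q + ((c - 1) * \<bar>m\<bar>) powr q)" by (intro mult_left_mono add_mono) auto
    also have "((c + 1) * \<bar>m\<bar>) powr q = (c + 1) powr q * \<bar>m\<bar> powr q" using c_bounds by (simp add: powr_mult)
    also have "((c - 1) * \<bar>m\<bar>) powr q = (c - 1) powr q * \<bar>m\<bar> powr q" using c_bounds by (simp add: powr_mult)
    also have "6 powr (-e) * ((c + 1) powr q * \<bar>m\<bar> powr q + (c - 1) powr q * \<bar>m\<bar> powr q) =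
        ((c + 1) powr q + (c - 1) powr q) * 6 powr (-e) * V \<bar>m\<bar>"
      using m by (simp add: V_def algebra_simps)
    finally show ?thesis by (simp add: B_def pres_c distrib_right)
  qed
  show ?thesis using that[of B V] B 1 2 by blast
next
  case True
  define A where "A = 2 * 3 powr (-e) + 2 * 6 powr (-e)"
  define B where "B = pres lam q e"
  \<comment> \<open>The product of the two factors is \<open>c\<^sup>2 - 1 > 1\<close>, and a number
    and its reciprocal add up to at least 2. Hence constants contract by \<open>A\<close>, which is
    at most \<open>B\<close> and so below 1.\<close>
  have ab: "2 \<le> (c + 1) powr q + (c - 1) powr q"
  proof -
    define a where "a = (c + 1) powr q"
    have a: "a \<ge> 1" using True c_bounds by (simp add: a_def ge_one_powr_ge_zero)
    have "1 \<le> ((c + 1) * (c - 1)) powr q" using True c_bounds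
      by (intro ge_one_powr_ge_zero) (auto simp: algebra_simps power2_eq_square)
    also have "\<dots> = a * (c - 1) powr q" using c_bounds by (simp add: powr_mult a_def)
    finally have "1 / a \<le> (c - 1) powr q" using a by (simp add: field_simps)
    moreover have "2 \<le> a + 1 / a"
    proof -
      have "0 \<le> (a - 1)^2 / a" using a by simp
      also have "(a - 1)^2 / a = a + 1 / a - 2" using a by (simp add: power2_eq_square field_simps)
      finally show ?thesis by simp
    qed
    ultimately show ?thesis unfolding a_def by linarith
  qed
  have AB: "0 < A" "A \<le> B" "B < 1"
    using ab G by (auto simp: A_def B_def pres_c add_pos_pos)
  \<comment> \<open>A slack factor on slopes: this exponent yields \<open>y > 1\<close> while
    \<open>y powr q * B\<close> equals \<open>B powr ((q + 1) / (2 * q + 1))\<close>, still below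
    1.\<close>
  define y where "y = B powr (-1 / (2 * q + 1))"
  have y: "y > 1" "y powr q * B < 1"
  proof -
    have "(1/B) powr 0 < (1/B) powr (1 / (2 * q + 1))" using AB True by (intro powr_less_mono) (auto simp: field_simps)
    then show "y > 1" unfolding y_def using AB by (simp add: powr_divide powr_minus_divide)
    have "y powr q * B = B powr (-1 / (2 * q + 1) * q) * B powr 1" using AB by (simp add: y_def powr_powr)
    also have "\<dots> = B powr (-1 / (2 * q + 1) * q + 1)" by (rule powr_add[symmetric])
    also have "-1 / (2 * q + 1) * q + 1 = (q + 1) / (2 * q + 1)" using True by (simp add: field_simps)
    also have "B powr ((q + 1) / (2 * q + 1)) < 1 powr ((q + 1) / (2 * q + 1))"
      using AB True by (intro powr_less_mono2) auto
    finally show "y powr q * B < 1" by simp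
  qed
  \<comment> \<open>From slope factor \<open>M\<close> on, the additive error 2 in
    \<open>small\<close> is absorbed by \<open>y\<close>. Below \<open>M\<close> the power terms
    contribute at most \<open>E\<close>, and \<open>D\<close> makes \<open>E + A * D\<close> equal
    to \<open>(1 + A) / 2 * D\<close>.\<close>
  define M where "M = 2 / ((c - 1) * (y - 1))"
  define E where "E = A * ((c + 1) * M) powr q"
  define D where "D = E / ((1 + A) / 2 - A)"
  define V where "V m = sn m powr q + D" for m
  define \<theta> where "\<theta> = max (y powr q * B) ((1 + A) / 2)"
  have M: "M > 0" using y c_bounds by (simp add: M_def)
  have E: "E \<ge> 0" using AB by (simp add: E_def)
  have D: "D \<ge> 0" "E = D * ((1 + A) / 2 - A)" using AB E by (auto simp: D_def)
  have th: "0 < \<theta>" "\<theta> < 1" using AB y by (auto simp: \<theta>_def less_max_iff_disj)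
  have up: "sn (c * sn m + \<bar>m\<bar>) \<le> (c + 1) * sn m" "sn (c * sn m - \<bar>m\<bar>) \<le> (c + 1) * sn m" for m
    using sn_up[of "\<bar>m\<bar>"] sn_minus[of "c * sn m - \<bar>m\<bar>"] by (auto simp: sn_def add.commute)
  have small: "sn (c * sn m - \<bar>m\<bar>) \<le> (c - 1) * sn m + 2" for m
  proof -
    have "sn m - 1 \<le> \<bar>m\<bar>" using sn_le[of m] by simp
    moreover have "sn (c * sn m - \<bar>m\<bar>) \<le> 1 + (c * sn m - \<bar>m\<bar>)" using sn_le[of "c * sn m - \<bar>m\<bar>"] slope_ge1[of m] by simp
    ultimately show ?thesis by (simp add: algebra_simps)
  qed
  have main: "2 * 3 powr (-e) * V \<bar>m\<bar> + 6 powr (-e) * (V (c * sn m + \<bar>m\<bar>) + V (c * sn m - \<bar>m\<bar>)) \<le> \<theta> * V \<bar>m\<bar>" for m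
  proof -
    have sa: "sn \<bar>m\<bar> = sn m" by (simp add: sn_def)
    define X where "X = 2 * 3 powr (-e) * sn m powr q + 6 powr (-e) * (sn (c * sn m + \<bar>m\<bar>) powr q + sn (c * sn m - \<bar>m\<bar>) powr q)"
    have L: "2 * 3 powr (-e) * V \<bar>m\<bar> + 6 powr (-e) * (V (c * sn m + \<bar>m\<bar>) + V (c * sn m - \<bar>m\<bar>)) = X + A * D"
      unfolding V_def sa X_def A_def by (simp add: algebra_simps)
    have "X + A * D \<le> \<theta> * V \<bar>m\<bar>"
    proof (cases "sn m \<ge> M")
      case True': True
      have "2 \<le> (c - 1) * (y - 1) * sn m"
      proof -
        have "0 < (c - 1) * (y - 1)" using y c_bounds by simp
        then show ?thesis using True' unfolding M_def by (simp add: pos_divide_le_eq mult.commute)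
      qed
      then have s2: "sn (c * sn m - \<bar>m\<bar>) \<le> (c - 1) * (y * sn m)" using small[of m] by (simp add: algebra_simps)
      have s1: "sn (c * sn m + \<bar>m\<bar>) \<le> (c + 1) * (y * sn m)"
      proof -
        have "1 * sn m \<le> y * sn m" using y by (intro mult_right_mono) auto
        then have "(c + 1) * sn m \<le> (c + 1) * (y * sn m)" using c_bounds by simp
        then show ?thesis using up(1)[of m] by simp
      qed
      have s0: "sn m \<le> y * sn m" using y by simp
      have "X \<le> 2 * 3 powr (-e) * (y * sn m) powr q + 6 powr (-e) * (((c + 1) * (y * sn m)) powr q + ((c - 1) * (y * sn m)) powr q)"
        unfolding X_def using s0 s1 s2 True by (intro add_mono mult_left_mono powr_mono2) auto
      also have "((c + 1) * (y * sn m)) powr q = (c + 1) powr q * (y * sn m) powr q" using c_bounds y by (simp add: powr_mult)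
      also have "((c - 1) * (y * sn m)) powr q = (c - 1) powr q * (y * sn m) powr q" using c_bounds y by (simp add: powr_mult)
      also have "2 * 3 powr (-e) * (y * sn m) powr q + 6 powr (-e) * ((c + 1) powr q * (y * sn m) powr q + (c - 1) powr q * (y * sn m) powr q)
          = B * (y * sn m) powr q"
        unfolding B_def pres_c by (simp add: algebra_simps)
      also have "(y * sn m) powr q = y powr q * sn m powr q" using y by (simp add: powr_mult)
      also have "B * (y powr q * sn m powr q) \<le> \<theta> * sn m powr q"
      proof -
        have "(y powr q * B) * sn m powr q \<le> \<theta> * sn m powr q" unfolding \<theta>_def by (intro mult_right_mono) auto
        then show ?thesis by (simp add: mult_ac)
      qed
      finally have "X \<le> \<theta> * sn m powr q" .
      moreover have "A * D \<le> \<theta> * D" using D AB unfolding \<theta>_def by (intro mult_right_mono) (auto simp: le_max_iff_disj)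
      ultimately show ?thesis unfolding V_def sa by (simp add: algebra_simps)
    next
      case False
      have k: "(c + 1) * sn m \<le> (c + 1) * M" using False c_bounds by simp
      have k0: "sn m \<le> (c + 1) * M" using k c_bounds sn_pos[of m] by (smt (verit) mult_le_cancel_right1)
      have "X \<le> 2 * 3 powr (-e) * ((c + 1) * M) powr q + 6 powr (-e) * (((c + 1) * M) powr q + ((c + 1) * M) powr q)"
        unfolding X_def using k0 order_trans[OF up(1) k] order_trans[OF up(2) k] True
        by (intro add_mono mult_left_mono powr_mono2) auto
      also have "\<dots> = E" by (simp add: E_def A_def algebra_simps)
      finally have "X + A * D \<le> E + A * D" by simp
      also have "\<dots> = (1 + A) / 2 * D" unfolding D(2) by (simp add: field_simps)
      also have "\<dots> \<le> \<theta> * D" using D unfolding \<theta>_def by (intro mult_right_mono) auto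
      also have "\<dots> \<le> \<theta> * V \<bar>m\<bar>" using th unfolding V_def by (intro mult_left_mono) auto
      finally show ?thesis .
    qed
    then show ?thesis using L by simp
  qed
  have "sn m powr q \<le> V \<bar>m\<bar>" for m using D by (simp add: V_def sn_def)
  then show ?thesis using that[of \<theta> V] th main by blast
qed

definition st :: "nat list \<Rightarrow> state" where "st w = foldl step root w"

lemma st_simps: "st [] = root" "st (w @ [t]) = step (st w) t" by (simp_all add: st_def)

lemma path_st: "path \<omega> n = st (map \<omega> [0..<n])"
  by (induction n) (simp_all add: st_simps)

lemma st_len: "w \<in> words n \<Longrightarrow> 0 < len (st w) \<and> len (st w) \<le> (1/3)^n"
proof (induction n arbitrary: w)
  case 0 then show ?case by (simp add: words_0 st_simps root_def)
next
  case (Suc n)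
  then obtain v t where w: "w = v @ [t]" "v \<in> words n" by (auto simp: words_Suc)
  show ?case using Suc.IH[OF w(2)] unfolding w(1) st_simps step_len by auto
qed

text \<open>The one-step inequality for \<open>V\<close> is summed over all words of a generation;
  \<open>V\<close> dominates the power of \<open>sn\<close>.\<close>

lemma sum_words_decay:
  assumes "pres lam q e < 1"
  obtains K \<theta> where "K > 0" "0 < \<theta>" "\<theta> < 1"
    "\<And>n. (\<Sum>w\<in>words n. len (st w) powr e * sn (slp (st w)) powr q) \<le> K * \<theta> ^ n"
proof -
  obtain V \<theta> where V: "0 < \<theta>" "\<theta> < 1" "\<And>m. sn m powr q \<le> V \<bar>m\<bar>"
    "\<And>m. 2 * 3 powr (-e) * V \<bar>m\<bar> + 6 powr (-e) * (V (c * sn m + \<bar>m\<bar>) + V (c * sn m - \<bar>m\<bar>)) \<le> \<theta> * V \<bar>m\<bar>"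
    by (rule lyapunov_exists[OF assms, of thesis]) (rule that)
  define Z where "Z n = (\<Sum>w\<in>words n. len (st w) powr e * V \<bar>slp (st w)\<bar>)" for n
  have one: "(\<Sum>t<4. len (step s t) powr e * V \<bar>slp (step s t)\<bar>) \<le> \<theta> * (len s powr e * V \<bar>slp s\<bar>)" if "len s > 0" for s
  proof -
    have l: "(len s / 3) powr e = len s powr e * 3 powr (-e)" "(len s / 6) powr e = len s powr e * 6 powr (-e)"
      using that by (simp_all add: powr_divide powr_minus_divide)
    have "(\<Sum>t<4. len (step s t) powr e * V \<bar>slp (step s t)\<bar>) =
       len s powr e * (2 * 3 powr (-e) * V \<bar>slp s\<bar> + 6 powr (-e) * (V (c * sn (slp s) + \<bar>slp s\<bar>) + V (c * sn (slp s) - \<bar>slp s\<bar>)))"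
      unfolding sum_less_4 step_slp12 by (simp add: step_len step_slp03 l algebra_simps)
    also have "\<dots> \<le> len s powr e * (\<theta> * V \<bar>slp s\<bar>)" using V(4) by (intro mult_left_mono) auto
    finally show ?thesis by (simp add: mult_ac)
  qed
  have Z: "Z n \<le> V 0 * \<theta> ^ n" for n
  proof (induction n)
    case 0
    then show ?case by (simp add: Z_def words_0 st_simps root_def)
  next
    case (Suc n)
    have "Z (Suc n) = (\<Sum>w\<in>words n. \<Sum>t<4. len (step (st w) t) powr e * V \<bar>slp (step (st w) t)\<bar>)"
      unfolding Z_def sum_words_Suc st_simps ..
    also have "\<dots> \<le> (\<Sum>w\<in>words n. \<theta> * (len (st w) powr e * V \<bar>slp (st w)\<bar>))"
      by (intro sum_mono one) (use st_len in blast)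
    also have "\<dots> = \<theta> * Z n" by (simp add: Z_def sum_distrib_left)
    also have "\<dots> \<le> \<theta> * (V 0 * \<theta> ^ n)" using Suc V by (intro mult_left_mono) auto
    finally show ?case by (simp add: mult_ac)
  qed
  have "(\<Sum>w\<in>words n. len (st w) powr e * sn (slp (st w)) powr q) \<le> Z n" for n
    unfolding Z_def using V(3) by (intro sum_mono mult_left_mono) auto
  then have "(\<Sum>w\<in>words n. len (st w) powr e * sn (slp (st w)) powr q) \<le> V 0 * \<theta> ^ n" for n
    using Z[of n] order_trans by blast
  moreover have "V 0 > 0" using V(3)[of 0] by (auto simp: sn_def)
  ultimately show ?thesis using that V(1,2) by blast
qed

lemma diameter_itv: "len s > 0 \<Longrightarrow> diameter (itv s) = len s"
  unfolding itv_def by (simp add: diameter_closed_interval)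

text \<open>Each point of the level set lies in good cells of arbitrarily late generations, and for
  good cells \<open>len powr \<sigma>\<close> is dominated by the decaying sums. Covering by all
  good cells from generation \<open>N\<close> on costs the tail of a geometric series.\<close>

lemma level_set_null:
  assumes G: "pres lam q e < 1" and \<sigma>: "\<sigma> > 0" "\<sigma> > e - (1 - \<alpha>) * q"
  shows "hausdorff_outer \<sigma> {x \<in> {0..1}. hoelder_exp (F lam) x = ereal \<alpha>} = 0"
proof -
  let ?E = "{x \<in> {0..1}. hoelder_exp (F lam) x = ereal \<alpha>}"
  \<comment> \<open>The room between \<open>\<sigma>\<close> and
    \<open>e - (1 - \<alpha>) * q\<close> is divided so that \<open>e' = e + \<epsilon>\<close>
    after the loss of \<open>\<epsilon> * \<bar>q\<bar>\<close> in
    \<open>frequently_good\<close>.\<close>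
  define \<epsilon> where "\<epsilon> = (\<sigma> + (1 - \<alpha>) * q - e) / (\<bar>q\<bar> + 1)"
  define e' where "e' = \<sigma> + (1 - \<alpha>) * q - \<epsilon> * \<bar>q\<bar>"
  have \<epsilon>: "\<epsilon> > 0" using \<sigma> by (simp add: \<epsilon>_def)
  have "\<epsilon> * (\<bar>q\<bar> + 1) = \<sigma> + (1 - \<alpha>) * q - e" by (simp add: \<epsilon>_def)
  then have "e \<le> e'" using \<epsilon> unfolding e'_def by (simp add: algebra_simps)
  then have "pres lam q e' < 1" using pres_antimono[of e e' q] G by simp
  then obtain K \<theta> where K: "K > 0" "0 < \<theta>" "\<theta> < 1"
    "\<And>n. (\<Sum>w\<in>words n. len (st w) powr e' * sn (slp (st w)) powr q) \<le> K * \<theta> ^ n"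
    using sum_words_decay by blast
  define good where "good w \<longleftrightarrow> 1 \<le> len (st w) powr ((1 - \<alpha>) * q - \<epsilon> * \<bar>q\<bar>) * sn (slp (st w)) powr q" for w
  have good: "len (st w) powr \<sigma> \<le> len (st w) powr e' * sn (slp (st w)) powr q" if "good w" for w
  proof -
    have "len (st w) powr \<sigma> * 1 \<le> len (st w) powr \<sigma> * (len (st w) powr ((1 - \<alpha>) * q - \<epsilon> * \<bar>q\<bar>) * sn (slp (st w)) powr q)"
      using that unfolding good_def by (intro mult_left_mono) auto
    also have "\<dots> = len (st w) powr e' * sn (slp (st w)) powr q"
      unfolding mult.assoc[symmetric] powr_add[symmetric] e'_def by (simp add: add_diff_eq)
    finally show ?thesis by simp
  qed
  have pre: "hausdorff_pre \<sigma> \<delta> ?E \<le> ennreal \<eta>" if \<delta>: "\<delta> > 0" and \<eta>: "\<eta> > 0" for \<delta> \<eta>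
  proof -
    have "(\<lambda>n. K * \<theta> ^ n / (1 - \<theta>)) \<longlonglongrightarrow> K * 0 / (1 - \<theta>)"
      using K by (intro tendsto_divide tendsto_mult tendsto_const LIMSEQ_realpow_zero) auto
    then have "\<forall>\<^sub>F n in sequentially. K * \<theta> ^ n / (1 - \<theta>) < \<eta>" by (rule order_tendstoD(2)) (use \<eta> in simp)
    moreover have "\<forall>\<^sub>F n in sequentially. (1/3::real)^n < \<delta>"
      using \<delta> by (intro order_tendstoD(2)[OF LIMSEQ_realpow_zero]) auto
    ultimately have "\<forall>\<^sub>F n in sequentially. K * \<theta> ^ n / (1 - \<theta>) < \<eta> \<and> (1/3::real)^n < \<delta>" by (rule eventually_conj)
    then obtain N where N: "K * \<theta> ^ N / (1 - \<theta>) < \<eta>" "(1/3::real)^N < \<delta>" by (auto simp: eventually_sequentially)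
    \<comment> \<open>Covers are indexed by natural numbers, so words enter through their codes.
      Requiring \<open>to_nat w = i\<close> makes each word occur once, which the reindexing of the
      sum needs.\<close>
    define ok where "ok i \<longleftrightarrow> (let w = from_nat i :: nat list in to_nat w = i \<and> w \<in> words (length w) \<and> N \<le> length w \<and> good w)" for i
    define U where "U i = (if ok i then itv (st (from_nat i)) else {})" for i
    have cover: "?E \<subseteq> (\<Union>i. U i)"
    proof
      fix x assume x: "x \<in> ?E"
      then obtain \<omega> where w: "\<And>i. \<omega> i < 4" "\<And>n. x \<in> itv (path \<omega> n)" using address_exists by blast
      obtain n where n: "n \<ge> N" "good (map \<omega> [0..<n])"
        using frequently_good[of x \<alpha> \<epsilon> \<omega> N q] x w \<epsilon> unfolding good_def path_st by blast
      define v where "v = map \<omega> [0..<n]"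
      have "v \<in> words (length v)" using w(1) by (auto simp: words_def v_def)
      moreover have "N \<le> length v" using n by (simp add: v_def)
      ultimately have "ok (to_nat v)" using n unfolding ok_def by (simp add: v_def Let_def)
      then have "x \<in> U (to_nat v)" using w(2)[of n] unfolding path_st U_def v_def by simp
      then show "x \<in> (\<Union>i. U i)" by blast
    qed
    have Ul: "0 < len (st (from_nat i)) \<and> len (st (from_nat i)) < \<delta>" if "ok i" for i
    proof -
      have "len (st (from_nat i)) \<le> (1/3)^length (from_nat i :: nat list)"
        "0 < len (st (from_nat i))" using that st_len unfolding ok_def Let_def by blast+
      moreover have "(1/3::real)^length (from_nat i :: nat list) \<le> (1/3)^N"
        using that unfolding ok_def Let_def by (intro power_decreasing) auto
      ultimately show ?thesis using N(2) by linarith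
    qed
    have bd: "bounded (U i) \<and> diameter (U i) \<le> \<delta>" for i
    proof (cases "ok i")
      case True
      have "bounded (itv (st (from_nat i)))" unfolding itv_def by simp
      then show ?thesis using Ul[OF True] True diameter_itv by (simp add: U_def)
    qed (use \<delta> in \<open>simp add: U_def\<close>)
    have "(\<Sum>i. ennreal (diameter (U i) powr \<sigma>)) \<le> ennreal \<eta>"
      unfolding suminf_eq_SUP
    proof (rule SUP_least)
      fix k
      define I where "I = {i. i < k \<and> ok i}"
      define W where "W = (from_nat ` I :: nat list set)"
      define M where "M = Suc (Max (insert 0 (length ` W)))"
      have fin: "finite I" "finite W" by (auto simp: I_def W_def)
      have inj: "inj_on (from_nat :: nat \<Rightarrow> nat list) I"
        by (rule inj_onI) (metis (mono_tags, lifting) I_def mem_Collect_eq ok_def)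
      have WM: "W \<subseteq> (\<Union>n\<in>{N..<M}. words n)"
      proof
        fix w assume w: "w \<in> W"
        then have "w \<in> words (length w)" "N \<le> length w" by (auto simp: W_def I_def ok_def Let_def)
        moreover have "length w < M" unfolding M_def less_Suc_eq_le using w fin by (intro Max_ge) auto
        ultimately show "w \<in> (\<Union>n\<in>{N..<M}. words n)" by auto
      qed
      have "(\<Sum>i<k. diameter (U i) powr \<sigma>) = (\<Sum>i\<in>I. diameter (U i) powr \<sigma>)"
        by (intro sum.mono_neutral_right) (auto simp: I_def U_def)
      also have "\<dots> = (\<Sum>i\<in>I. len (st (from_nat i)) powr \<sigma>)"
        by (intro sum.cong refl) (use Ul in \<open>auto simp: I_def U_def diameter_itv\<close>)
      also have "\<dots> = (\<Sum>w\<in>W. len (st w) powr \<sigma>)" unfolding W_def sum.reindex[OF inj] by simp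
      also have "\<dots> \<le> (\<Sum>w\<in>W. len (st w) powr e' * sn (slp (st w)) powr q)"
        by (intro sum_mono good) (auto simp: W_def I_def ok_def Let_def)
      also have "\<dots> \<le> (\<Sum>w\<in>(\<Union>n\<in>{N..<M}. words n). len (st w) powr e' * sn (slp (st w)) powr q)"
        using WM finite_words by (intro sum_mono2) auto
      also have "\<dots> = (\<Sum>n\<in>{N..<M}. \<Sum>w\<in>words n. len (st w) powr e' * sn (slp (st w)) powr q)"
        by (intro sum.UNION_disjoint) (use finite_words in \<open>auto simp: words_def\<close>)
      also have "\<dots> \<le> (\<Sum>n\<in>{N..<M}. K * \<theta> ^ n)" by (intro sum_mono K(4))
      also have "\<dots> \<le> K * \<theta> ^ N / (1 - \<theta>)"
      proof -
        have "(\<Sum>n\<in>{N..<M}. \<theta> ^ n) \<le> \<theta> ^ N / (1 - \<theta>)"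
        proof (cases "N \<le> M")
          case True
          have "(1 - \<theta>) * (\<Sum>n\<in>{N..<j}. \<theta> ^ n) = \<theta> ^ N - \<theta> ^ j" if "N \<le> j" for j
            using that
          proof (induction j rule: dec_induct)
            case (step n)
            have "(1 - \<theta>) * \<theta> ^ n = \<theta> ^ n - \<theta> ^ Suc n" by (simp add: algebra_simps)
            then show ?case using step by (simp add: distrib_left del: power_Suc)
          qed simp
          from this[OF True] have "(\<Sum>n\<in>{N..<M}. \<theta> ^ n) * (1 - \<theta>) \<le> \<theta> ^ N"
            using K by (simp add: mult.commute)
          then show ?thesis using K by (simp add: pos_le_divide_eq)
        next
          case False
          then show ?thesis using K by simp
        qed
        then show ?thesis using K by (simp add: sum_distrib_left[symmetric] mult_left_mono times_divide_eq_right[symmetric] del: times_divide_eq_right)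
      qed
      finally have "(\<Sum>i<k. diameter (U i) powr \<sigma>) \<le> \<eta>" using N(1) by simp
      then show "(\<Sum>i<k. ennreal (diameter (U i) powr \<sigma>)) \<le> ennreal \<eta>"
        by (subst sum_ennreal) (auto intro: ennreal_leI)
    qed
    moreover have "U \<in> {U. (\<forall>i. bounded (U i) \<and> diameter (U i) \<le> \<delta>) \<and> ?E \<subseteq> (\<Union>i. U i)}" using bd cover by blast
    ultimately show ?thesis unfolding hausdorff_pre_def by (rule INF_lower2[rotated])
  qed
  have "hausdorff_pre \<sigma> \<delta> ?E = 0" if "\<delta> > 0" for \<delta>
  proof -
    have "hausdorff_pre \<sigma> \<delta> ?E \<le> 0 + ennreal \<eta>" if "\<eta> > 0" for \<eta> using pre[OF \<open>\<delta> > 0\<close> that] by simp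
    then have "hausdorff_pre \<sigma> \<delta> ?E \<le> 0" by (rule ennreal_le_epsilon)
    then show ?thesis by simp
  qed
  then have "hausdorff_outer \<sigma> ?E = (SUP \<delta>\<in>{0::real<..}. 0)"
    unfolding hausdorff_outer_def by (intro SUP_cong refl) simp
  then show ?thesis by simp
qed

lemma spectrum_le:
  assumes "pres lam q e < 1" "\<sigma> > 0" "\<sigma> > e - (1 - \<alpha>) * q"
  shows "spectrum_F (F lam) \<alpha> \<le> ereal \<sigma>"
  unfolding spectrum_F_def hdim_def using level_set_null[OF assms] assms(2)
  by (auto intro!: Inf_lower)

end

section \<open>Bernoulli measures and mass distribution\<close>

definition bern :: "nat pmf \<Rightarrow> (nat \<Rightarrow> nat) measure" where
  "bern p = PiM UNIV (\<lambda>_. measure_pmf p)"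

lemma space_bern [simp]: "space (bern p) = UNIV"
  by (simp add: bern_def space_PiM)

lemma prob_space_bern: "prob_space (bern p)"
  unfolding bern_def by (rule prob_space_PiM) (rule prob_space_measure_pmf)

lemma component_bern [measurable]: "(\<lambda>\<omega>. f (\<omega> i)) \<in> bern p \<rightarrow>\<^sub>M borel" for f :: "nat \<Rightarrow> real"
proof -
  have "(\<lambda>\<omega>. \<omega> i) \<in> bern p \<rightarrow>\<^sub>M measure_pmf p" unfolding bern_def by (rule measurable_component_singleton) simp
  then show ?thesis by (rule measurable_compose) simp
qed

lemma distr_component_bern: "distr (bern p) (measure_pmf p) (\<lambda>\<omega>. \<omega> i) = measure_pmf p"
proof -
  interpret product_prob_space "\<lambda>_::nat. measure_pmf p" UNIV by unfold_locales
  show ?thesis unfolding bern_def by (rule PiM_component) simp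
qed

lemma emeasure_bern:
  assumes "finite J"
  shows "emeasure (bern p) {\<omega>. \<forall>i\<in>J. \<omega> i = w i} = (\<Prod>i\<in>J. ennreal (pmf p (w i)))"
proof -
  interpret product_prob_space "\<lambda>_::nat. measure_pmf p" UNIV by unfold_locales
  show ?thesis using emeasure_PiM_Collect[of J "\<lambda>i. {w i}"] assms
    by (simp add: bern_def space_PiM emeasure_pmf_single)
qed

lemma sets_bern_cylinder: "{\<omega>. Q (map \<omega> [0..<n])} \<in> sets (bern p)"
proof -
  have s: "{\<omega>. \<omega> i = k} \<in> sets (bern p)" for i k
  proof -
    have "(\<lambda>\<omega>. \<omega> i) -` {k} \<inter> space (bern p) \<in> sets (bern p)"
      unfolding bern_def by (rule measurable_sets[OF measurable_component_singleton]) auto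
    then show ?thesis by (simp add: vimage_def)
  qed
  have "{\<omega>. map \<omega> [0..<n] = w} \<in> sets (bern p)" for w
  proof (cases "length w = n")
    case True
    then have "{\<omega>. map \<omega> [0..<n] = w} = space (bern p) \<inter> (\<Inter>i\<in>{..<n}. {\<omega>. \<omega> i = w ! i})"
      by (auto simp: list_eq_iff_nth_eq)
    also have "\<dots> \<in> sets (bern p)"
    proof (cases "n = 0")
      case False
      then show ?thesis by (intro sets.Int sets.finite_INT s sets.top) auto
    next
      case True
      then show ?thesis using sets.top[of "bern p"] by simp
    qed
    finally show ?thesis .
  next
    case False
    then have "{\<omega>. map \<omega> [0..<n] = w} = {}" by auto
    then show ?thesis by simp
  qed
  then have "(\<Union>w\<in>{w. Q w}. {\<omega>. map \<omega> [0..<n] = w}) \<in> sets (bern p)"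
    by (intro sets.countable_UN') auto
  moreover have "(\<Union>w\<in>{w. Q w}. {\<omega>. map \<omega> [0..<n] = w}) = {\<omega>. Q (map \<omega> [0..<n])}" by auto
  ultimately show ?thesis by simp
qed

lemma AE_bern_support: "AE \<omega> in bern p. \<forall>i. \<omega> i \<in> set_pmf p"
proof -
  have "AE \<omega> in bern p. \<omega> i \<in> set_pmf p" for i unfolding bern_def
    by (rule AE_PiM_component) (auto intro: prob_space_measure_pmf AE_measure_pmf)
  then show ?thesis by (simp add: AE_all_countable)
qed

lemma indep_bern: "prob_space.indep_vars (bern p) (\<lambda>_. borel) (\<lambda>i \<omega>. f (\<omega> i)) UNIV" for f :: "nat \<Rightarrow> real"
proof -
  interpret prob_space "bern p" by (rule prob_space_bern)
  have rv: "random_variable (measure_pmf p) (\<lambda>\<omega>. \<omega> i)" for i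
    unfolding bern_def by (rule measurable_component_singleton) simp
  have "indep_vars (\<lambda>_. measure_pmf p) (\<lambda>i \<omega>. \<omega> i) (UNIV :: nat set)"
  proof (subst indep_vars_iff_distr_eq_PiM)
    show "distr (bern p) (Pi\<^sub>M UNIV (\<lambda>_. measure_pmf p)) (\<lambda>x. \<lambda>i\<in>UNIV. x i) =
       Pi\<^sub>M UNIV (\<lambda>i. distr (bern p) (measure_pmf p) (\<lambda>\<omega>. \<omega> i))"
      unfolding distr_component_bern restrict_UNIV by (simp add: bern_def distr_id2)
  qed (use rv in auto)
  then show ?thesis by (rule indep_vars_compose2) simp
qed

text \<open>The strong law for bounded summands: Hoeffding's inequality makes the deviation
  probabilities summable.\<close>
lemma slln_bern:
  fixes p :: "nat pmf" and f :: "nat \<Rightarrow> real"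
  assumes fin: "finite (set_pmf p)" and mean: "(\<Sum>t\<in>set_pmf p. pmf p t * f t) = 0"
  shows "AE \<omega> in bern p. \<forall>\<epsilon>>0. \<forall>\<^sub>F n in sequentially. \<bar>\<Sum>i<n. f (\<omega> i)\<bar> \<le> \<epsilon> * real n"
proof -
  interpret prob_space "bern p" by (rule prob_space_bern)
  define B where "B = (\<Sum>t\<in>set_pmf p. \<bar>f t\<bar>) + 1"
  have fB: "f t \<in> {-B..B}" if "t \<in> set_pmf p" for t
    using member_le_sum[of t "set_pmf p" "\<lambda>t. \<bar>f t\<bar>"] fin that by (auto simp: B_def)
  have B: "B > 0" unfolding B_def by (intro add_nonneg_pos sum_nonneg) auto
  have ex: "expectation (\<lambda>\<omega>. f (\<omega> 0)) = 0"
  proof -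
    have "expectation (\<lambda>\<omega>. f (\<omega> 0)) = integral\<^sup>L (distr (bern p) (measure_pmf p) (\<lambda>\<omega>. \<omega> 0)) f"
      by (rule integral_distr[symmetric]) (simp_all add: bern_def)
    also have "\<dots> = (\<Sum>t\<in>set_pmf p. f t * pmf p t)"
      unfolding distr_component_bern by (rule integral_measure_pmf_real) (use fin in auto)
    finally show ?thesis using mean by (simp add: mult.commute)
  qed
  have dist: "prob {\<omega>. \<bar>\<Sum>i<n. f (\<omega> i)\<bar> \<ge> \<epsilon> * real n} \<le> 2 * exp (- (\<epsilon>\<^sup>2 / (2 * B\<^sup>2))) ^ n" if "\<epsilon> > 0" for \<epsilon> n
  proof (cases "n = 0")
    case True
    then have "1 \<le> 2 * exp (- (\<epsilon>\<^sup>2 / (2 * B\<^sup>2))) ^ n" by simp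
    then show ?thesis by (rule order_trans[OF prob_le_1])
  next
    case False
    interpret H: Hoeffding_ineq_iid "bern p" "{..<n}" "\<lambda>i \<omega>. f (\<omega> i)" "\<lambda>\<omega>. f (\<omega> 0)" "-B" B "0"
    proof unfold_locales
      show "indep_vars (\<lambda>_. borel) (\<lambda>i \<omega>. f (\<omega> i)) {..<n}"
        using indep_bern by (rule indep_vars_subset) simp
      have d: "distr (bern p) borel (\<lambda>\<omega>. f (\<omega> i)) = distr (measure_pmf p) borel f" for i
      proof -
        have "distr (measure_pmf p) borel f = distr (distr (bern p) (measure_pmf p) (\<lambda>\<omega>. \<omega> i)) borel f"
          by (simp only: distr_component_bern)
        also have "\<dots> = distr (bern p) borel (f \<circ> (\<lambda>\<omega>. \<omega> i))"
          by (rule distr_distr) (simp_all add: bern_def)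
        finally show ?thesis by (simp add: comp_def)
      qed
      show "distr (bern p) borel (\<lambda>\<omega>. f (\<omega> i)) = distr (bern p) borel (\<lambda>\<omega>. f (\<omega> 0))" for i
        unfolding d ..
      show "AE x in bern p. f (x 0) \<in> {- B..B}"
        using AE_bern_support by (rule AE_mp) (use fB in auto)
      show "0 \<equiv> expectation (\<lambda>\<omega>. f (\<omega> 0))" using ex by simp
    qed auto
    have "prob {x \<in> space (bern p). \<bar>(\<Sum>i<n. f (x i)) - real (card {..<n}) * 0\<bar> \<ge> \<epsilon> * real n} \<le>
        2 * exp (-2 * (\<epsilon> * real n)\<^sup>2 / (real (card {..<n}) * (B - - B)\<^sup>2))"
      by (rule H.Hoeffding_ineq_abs_ge) (use that B False in auto)
    moreover have "-2 * (\<epsilon> * real n)\<^sup>2 / (real (card {..<n}) * (B - - B)\<^sup>2) = real n * (- (\<epsilon>\<^sup>2 / (2 * B\<^sup>2)))"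
      using False B by (simp add: power2_eq_square field_simps)
    moreover have "exp (real n * (- (\<epsilon>\<^sup>2 / (2 * B\<^sup>2)))) = exp (- (\<epsilon>\<^sup>2 / (2 * B\<^sup>2))) ^ n" by (rule exp_of_nat_mult)
    ultimately show ?thesis by simp
  qed
  have eps: "AE \<omega> in bern p. \<forall>\<^sub>F n in sequentially. \<bar>\<Sum>i<n. f (\<omega> i)\<bar> \<le> \<epsilon> * real n" if "\<epsilon> > 0" for \<epsilon>
  proof -
    have "AE x in bern p. \<forall>\<^sub>F n in sequentially. x \<in> space (bern p) - {\<omega>. \<bar>\<Sum>i<n. f (\<omega> i)\<bar> \<ge> \<epsilon> * real n}"
    proof (rule borel_cantelli_AE1[where A = "\<lambda>n. {\<omega>. \<bar>\<Sum>i<n. f (\<omega> i)\<bar> \<ge> \<epsilon> * real n}"])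
      show "{\<omega>. \<epsilon> * real n \<le> \<bar>\<Sum>i<n. f (\<omega> i)\<bar>} \<in> events" for n
      proof -
        have "{\<omega> \<in> space (bern p). \<epsilon> * real n \<le> \<bar>\<Sum>i<n. f (\<omega> i)\<bar>} \<in> events" by measurable
        then show ?thesis by simp
      qed
      show "emeasure (bern p) {\<omega>. \<epsilon> * real n \<le> \<bar>\<Sum>i<n. f (\<omega> i)\<bar>} < \<infinity>" for n
        using emeasure_finite by (simp add: less_top[symmetric])
      show "summable (\<lambda>n. prob {\<omega>. \<epsilon> * real n \<le> \<bar>\<Sum>i<n. f (\<omega> i)\<bar>})"
      proof (rule summable_comparison_test')
        show "summable (\<lambda>n. 2 * exp (- (\<epsilon>\<^sup>2 / (2 * B\<^sup>2))) ^ n)"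
          using that B by (intro summable_mult summable_geometric) simp
        show "norm (prob {\<omega>. \<epsilon> * real n \<le> \<bar>\<Sum>i<n. f (\<omega> i)\<bar>}) \<le> 2 * exp (- (\<epsilon>\<^sup>2 / (2 * B\<^sup>2))) ^ n" if "n \<ge> 0" for n
          using dist[OF \<open>\<epsilon> > 0\<close>] by simp
      qed
    qed
    then show ?thesis by (rule AE_mp) (auto intro!: AE_I2 elim!: eventually_mono)
  qed
  have "AE \<omega> in bern p. \<forall>k::nat. \<forall>\<^sub>F n in sequentially. \<bar>\<Sum>i<n. f (\<omega> i)\<bar> \<le> 1 / real (Suc k) * real n"
    unfolding AE_all_countable by (intro allI eps) simp
  then show ?thesis
  proof (rule AE_mp, intro AE_I2 impI allI)
    fix \<omega> and \<epsilon> :: real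
    assume a: "\<forall>k::nat. \<forall>\<^sub>F n in sequentially. \<bar>\<Sum>i<n. f (\<omega> i)\<bar> \<le> 1 / real (Suc k) * real n" and "\<epsilon> > 0"
    then obtain k :: nat where k: "1 / Suc k < \<epsilon>" using nat_approx_posE by blast
    from a have "\<forall>\<^sub>F n in sequentially. \<bar>\<Sum>i<n. f (\<omega> i)\<bar> \<le> 1 / real (Suc k) * real n" by blast
    then show "\<forall>\<^sub>F n in sequentially. \<bar>\<Sum>i<n. f (\<omega> i)\<bar> \<le> \<epsilon> * real n"
    proof (rule eventually_mono)
      fix n assume "\<bar>\<Sum>i<n. f (\<omega> i)\<bar> \<le> 1 / real (Suc k) * real n"
      also have "\<dots> \<le> \<epsilon> * real n" using k by (intro mult_right_mono) auto
      finally show "\<bar>\<Sum>i<n. f (\<omega> i)\<bar> \<le> \<epsilon> * real n" .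
    qed
  qed
qed

context koch
begin

section \<open>Stopped cells and the mass distribution principle\<close>

lemma st_append: "st (u @ v) = foldl step (st u) v" by (simp add: st_def)

lemma step_itv: "len s > 0 \<Longrightarrow> t < 4 \<Longrightarrow> itv (step s t) \<subseteq> itv s"
  unfolding step_def by (rule itv_kid_subset) auto

lemma foldl_step:
  assumes "len s > 0" "set v \<subseteq> {..<4}"
  shows "len (foldl step s v) > 0 \<and> len (foldl step s v) \<le> len s \<and> itv (foldl step s v) \<subseteq> itv s"
  using assms(2)
proof (induction v rule: rev_induct)
  case Nil
  then show ?case using assms by simp
next
  case (snoc t v)
  then show ?case using step_itv[of "foldl step s v" t] by (auto simp: step_len)
qed

text \<open>Open cells, because adjacent closed cells share an end point.\<close>

definition oitv :: "state \<Rightarrow> real set" where "oitv s = {left s <..< left s + len s}"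

lemma oitv_mono: "len s > 0 \<Longrightarrow> itv s \<subseteq> itv t \<Longrightarrow> oitv s \<subseteq> oitv t"
  by (auto simp: oitv_def itv_def)

lemma step_disjoint:
  assumes "len s > 0" "t < 4" "t' < 4" "t \<noteq> t'"
  shows "oitv (step s t) \<inter> oitv (step s t') = {}"
proof -
  have "dig (slp s) t \<noteq> dig (slp s) t'" using assms(4) dig_dig by metis
  moreover have "oitv (kd s k) \<inter> oitv (kd s k') = {}" if "k < 4" "k' < 4" "k \<noteq> k'" for k k'
    using that assms(1) unfolding kid_cases
    by (elim disjE) (auto simp: oitv_def kid_left kid_len simp del: One_nat_def)
  ultimately show ?thesis using assms unfolding step_def by simp
qed

lemma st_disjoint:
  assumes "set u \<subseteq> {..<4}" "set v \<subseteq> {..<4}" "u \<parallel> v"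
  shows "oitv (st u) \<inter> oitv (st v) = {}"
proof -
  obtain as b bs c' cs where d: "b \<noteq> c'" "u = as @ b # bs" "v = as @ c' # cs"
    using parallel_decomp[OF assms(3)] by blast
  have l: "len (st as) > 0" using foldl_step[of root as] assms(1) unfolding d st_def by (simp add: root_def)
  have e: "st u = foldl step (step (st as) b) bs" "st v = foldl step (step (st as) c') cs"
    unfolding d st_append by simp_all
  have lb: "len (step (st as) b) > 0" "len (step (st as) c') > 0" using l by (auto simp: step_len)
  have bc: "set bs \<subseteq> {..<4}" "set cs \<subseteq> {..<4}" using assms(1,2) unfolding d by auto
  have "oitv (st u) \<subseteq> oitv (step (st as) b)" "oitv (st v) \<subseteq> oitv (step (st as) c')"
    unfolding e using foldl_step[OF lb(1) bc(1)] foldl_step[OF lb(2) bc(2)] oitv_mono by blast+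
  moreover have "oitv (step (st as) b) \<inter> oitv (step (st as) c') = {}"
    using step_disjoint[OF l _ _ d(1)] assms(1,2) unfolding d by simp
  ultimately show ?thesis by blast
qed

text \<open>The words at which the length first drops to \<open>d\<close> or below: a Moran cut set,
  pairwise incomparable and with lengths between \<open>d / 6\<close> and \<open>d\<close>.\<close>

definition stopping :: "real \<Rightarrow> nat list \<Rightarrow> bool" where
  "stopping d w \<longleftrightarrow> w \<noteq> [] \<and> set w \<subseteq> {..<4} \<and> len (st w) \<le> d \<and> d < len (st (butlast w))"

lemma stopping_parallel:
  assumes "stopping d u" "stopping d v" "u \<noteq> v"
  shows "u \<parallel> v"
proof -
  have np: "\<not> prefix a b" if ab: "stopping d a" "stopping d b" "a \<noteq> b" for a b
  proof
    assume "prefix a b"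
    then have "prefix a (butlast b)" using ab unfolding stopping_def
      by (metis append_butlast_last_id prefix_snoc)
    then obtain x where x: "butlast b = a @ x" by (auto elim: prefixE)
    have s: "set a \<subseteq> {..<4}" "set x \<subseteq> {..<4}"
      using ab x unfolding stopping_def by (metis, metis Un_subset_iff in_set_butlastD set_append subset_eq)
    have "len (st a) > 0" using foldl_step[of root a] s unfolding st_def by (simp add: root_def)
    then have "len (st (butlast b)) \<le> len (st a)" using foldl_step[of "st a" x] s unfolding x st_append by simp
    then show False using ab unfolding stopping_def by simp
  qed
  show ?thesis using np[OF assms] np[OF assms(2,1)] assms(3) by (auto intro!: parallelI)
qed

lemma stopping_len: "stopping d w \<Longrightarrow> d / 6 \<le> len (st w) \<and> len (st w) > 0"
proof -
  assume s: "stopping d w"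
  define t where "t = last w"
  define v where "v = butlast w"
  have w: "w = v @ [t]" using s unfolding stopping_def v_def t_def by simp
  have "set v \<subseteq> {..<4}" using s unfolding stopping_def w by simp
  then have "len (st v) > 0" using foldl_step[of root v] unfolding st_def by (simp add: root_def)
  moreover have "d < len (st v)" using s unfolding stopping_def w by simp
  moreover have "len (st w) \<ge> len (st v) / 6" using \<open>len (st v) > 0\<close> unfolding w st_simps by (simp add: step_len)
  ultimately show ?thesis by auto
qed

text \<open>The open cells are disjoint, have length at least \<open>d / 6\<close> and lie within
  \<open>2 * d\<close> of any point of \<open>U\<close>; comparing total length with
  \<open>4 * d\<close> leaves at most 24.\<close>

lemma stopping_count:
  assumes "d > 0" "\<And>x z. x \<in> U \<Longrightarrow> z \<in> U \<Longrightarrow> \<bar>x - z\<bar> \<le> d"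
  shows "finite {w. stopping d w \<and> itv (st w) \<inter> U \<noteq> {}} \<and> card {w. stopping d w \<and> itv (st w) \<inter> U \<noteq> {}} \<le> 24"
proof (rule finite_if_finite_subsets_card_bdd)
  fix W assume W: "W \<subseteq> {w. stopping d w \<and> itv (st w) \<inter> U \<noteq> {}}" "finite W"
  show "card W \<le> 24"
  proof (cases "W = {}")
    case False
    then obtain u where u: "u \<in> U" using W by fast
    have sub: "oitv (st w) \<subseteq> {u - 2*d .. u + 2*d}" if w: "w \<in> W" for w
    proof -
      obtain x where x: "x \<in> itv (st w)" "x \<in> U" using w W by blast
      have "\<bar>x - u\<bar> \<le> d" using assms(2) x u by blast
      moreover have "len (st w) \<le> d" using w W unfolding stopping_def by blast
      ultimately show ?thesis using x by (auto simp: oitv_def itv_def)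
    qed
    have "disjoint_family_on (\<lambda>w. oitv (st w)) W"
      unfolding disjoint_family_on_def
    proof (intro ballI impI)
      fix v w assume "v \<in> W" "w \<in> W" "v \<noteq> w"
      then have "stopping d v" "stopping d w" "v \<parallel> w" using W stopping_parallel by blast+
      then show "oitv (st v) \<inter> oitv (st w) = {}" by (intro st_disjoint) (auto simp: stopping_def)
    qed
    then have "(\<Sum>w\<in>W. emeasure lborel (oitv (st w))) = emeasure lborel (\<Union>w\<in>W. oitv (st w))"
      by (intro sum_emeasure) (auto simp: W oitv_def)
    also have "\<dots> \<le> emeasure lborel {u - 2*d .. u + 2*d}" using sub by (intro emeasure_mono) auto
    also have "\<dots> = ennreal (4 * d)" using assms(1) by simp
    finally have A: "(\<Sum>w\<in>W. emeasure lborel (oitv (st w))) \<le> ennreal (4 * d)" .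
    have "ennreal (\<Sum>w\<in>W. d / 6) = (\<Sum>w\<in>W. ennreal (d / 6))" using assms(1) by (intro sum_ennreal[symmetric]) simp
    also have "\<dots> \<le> (\<Sum>w\<in>W. emeasure lborel (oitv (st w)))"
      using W(1) stopping_len by (intro sum_mono) (auto simp: oitv_def subset_iff less_imp_le intro!: ennreal_leI)
    finally have "ennreal (\<Sum>w\<in>W. d / 6) \<le> ennreal (4 * d)" using A by (rule order_trans)
    then have "(\<Sum>w\<in>W. d / 6) \<le> 4 * d" using assms(1) by (simp add: ennreal_le_iff)
    then have "real (card W) * d \<le> 24 * d" by simp
    then show ?thesis using assms(1) by simp
  qed simp
qed

text \<open>The left ends increase along nested cells; their supremum is the common point of the
  closed cells.\<close>

definition pt :: "(nat \<Rightarrow> nat) \<Rightarrow> real" where "pt \<omega> = (SUP n. left (path \<omega> n))"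

lemma pt_itv:
  assumes "\<And>i. \<omega> i < 4"
  shows "pt \<omega> \<in> itv (path \<omega> n)"
proof -
  have mono: "itv (path \<omega> (n + k)) \<subseteq> itv (path \<omega> n)" for n k
  proof (induction k)
    case (Suc k)
    then show ?case using step_itv[OF path_len(1), of "\<omega> (n + k)" \<omega> "n + k"] assms by auto
  qed simp
  have in_: "left (path \<omega> n) \<in> itv (path \<omega> n)" "left (path \<omega> n) + len (path \<omega> n) \<in> itv (path \<omega> n)" for n
    using path_len(1)[of \<omega> n] by (auto simp: itv_def)
  have le: "left (path \<omega> m) \<le> left (path \<omega> n) + len (path \<omega> n)" for m n
  proof (cases "n \<le> m")
    case True
    then show ?thesis using mono[of n "m - n"] in_[of m] by (auto simp: itv_def)
  next
    case False
    then have "left (path \<omega> n) + len (path \<omega> n) \<in> itv (path \<omega> m)" using mono[of m "n - m"] in_(2)[of n] by auto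
    then show ?thesis by (auto simp: itv_def)
  qed
  have "left (path \<omega> n) \<le> pt \<omega>" unfolding pt_def
    by (rule cSUP_upper) (use le[of _ 0] in \<open>auto intro!: bdd_aboveI[of _ "left (path \<omega> 0) + len (path \<omega> 0)"]\<close>)
  moreover have "pt \<omega> \<le> left (path \<omega> n) + len (path \<omega> n)" unfolding pt_def
    by (rule cSUP_least) (use le in auto)
  ultimately show ?thesis by (simp add: itv_def)
qed

lemma pt_01: "(\<And>i. \<omega> i < 4) \<Longrightarrow> pt \<omega> \<in> {0..1}"
  using pt_itv[of \<omega> 0] by (simp add: itv_def root_def)

lemma path_stopping:
  assumes "\<And>i. \<omega> i < 4" "0 < d" "d < 1"
  obtains n where "stopping d (map \<omega> [0..<Suc n])"
proof -
  obtain N where "(1/3)^N < d" using real_arch_pow_inv[of d "1/3"] assms by auto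
  then have ex: "\<exists>n. len (path \<omega> n) \<le> d" using path_len(2)[of \<omega> N] by (intro exI[of _ N]) auto
  define m where "m = (LEAST n. len (path \<omega> n) \<le> d)"
  have m: "len (path \<omega> m) \<le> d" unfolding m_def using ex by (rule LeastI_ex)
  then have "m \<noteq> 0" using assms(3) by (intro notI) (simp add: root_def)
  then obtain n where n: "m = Suc n" by (cases m) auto
  have "\<not> len (path \<omega> n) \<le> d" using not_less_Least[of n "\<lambda>n. len (path \<omega> n) \<le> d"] n unfolding m_def by simp
  moreover have "butlast (map \<omega> [0..<Suc n]) = map \<omega> [0..<n]" by simp
  ultimately have "stopping d (map \<omega> [0..<Suc n])"
    using m assms(1) unfolding stopping_def path_st n by (auto simp del: upt_Suc)
  then show ?thesis by (rule that)
qed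

lemma path_len_ge: "len (path \<omega> n) \<ge> (1/6)^n"
proof (induction n)
  case (Suc n)
  then show ?case using path_len(4)[of \<omega> n] by simp
qed (simp add: root_def)

text \<open>The generation from which the mass bound holds depends on the address. The bound is made
  uniform on a set \<open>P N\<close> of positive probability, and a cheap cover of \<open>E\<close>
  would give this set too little mass.\<close>

lemma mass_distribution:
  assumes p: "set_pmf p \<subseteq> {..<4}" and s: "s > 0"
    and E: "AE \<omega> in bern p. pt \<omega> \<in> E"
    and mass: "AE \<omega> in bern p. \<exists>N. \<forall>n\<ge>N. (\<Prod>i<n. pmf p (\<omega> i)) \<le> len (path \<omega> n) powr s"
  shows "hausdorff_outer s E \<noteq> 0"
proof
  assume H0: "hausdorff_outer s E = 0"
  interpret prob_space "bern p" by (rule prob_space_bern)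
  define light where "light w \<longleftrightarrow> prod_list (map (pmf p) w) \<le> len (st w) powr s" for w
  have lp: "(\<Prod>i<n. pmf p (\<omega> i)) = prod_list (map (pmf p) (map \<omega> [0..<n]))" for \<omega> n
    by (induction n) simp_all
  define P where "P N = {\<omega>. \<forall>n\<ge>N. light (map \<omega> [0..<n])}" for N
  have P_eq: "P N = (\<Inter>n\<in>{N..}. {\<omega>. light (map \<omega> [0..<n])})" for N by (auto simp: P_def)
  have P_sets: "P N \<in> events" for N
    unfolding P_eq using sets_bern_cylinder[of light _ p] by (intro sets.countable_INT') auto
  have "\<exists>N. emeasure (bern p) (P N) \<noteq> 0"
  proof (rule ccontr)
    assume "\<not> ?thesis"
    then have "AE \<omega> in bern p. \<omega> \<notin> P N" for N
      by (intro AE_I[of _ _ "P N"]) (use P_sets in auto)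
    then have "AE \<omega> in bern p. \<forall>N. \<omega> \<notin> P N" by (simp add: AE_all_countable)
    with mass have "AE \<omega> in bern p. False"
      by (rule AE_mp[OF _ AE_mp]) (auto intro!: AE_I2 simp: P_def light_def lp path_st)
    then show False by simp
  qed
  then obtain N where N: "emeasure (bern p) (P N) \<noteq> 0" by blast
  define m0 where "m0 = prob (P N)"
  have m0: "m0 > 0" "emeasure (bern p) (P N) = ennreal m0"
    using N by (auto simp: m0_def emeasure_eq_measure zero_less_measure_iff)
  \<comment> \<open>The first bound contradicts the final estimate
    \<open>m0 \<le> 48 * \<eta>\<close>. The second makes all scales \<open>d i\<close> so small
    that stopping words are longer than \<open>N\<close>, where the mass bound is uniform.\<close>
  define \<eta> where "\<eta> = min (m0 / 96) (((1/6)^Suc N) powr s / 4)"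
  have \<eta>: "\<eta> > 0" "\<eta> \<le> m0 / 96" "\<eta> \<le> ((1/6)^Suc N) powr s / 4" using m0 by (auto simp: \<eta>_def)
  have "hausdorff_pre s 1 E \<le> hausdorff_outer s E" unfolding hausdorff_outer_def by (rule SUP_upper) simp
  then have "hausdorff_pre s 1 E < ennreal \<eta>" using H0 \<eta> by simp
  then obtain U where U: "\<And>i. bounded (U i)" "E \<subseteq> (\<Union>i. U i)" "(\<Sum>i. ennreal (diameter (U i) powr s)) < ennreal \<eta>"
    unfolding hausdorff_pre_def INF_less_iff by auto
  \<comment> \<open>The summable extra term gives a positive scale \<open>d i\<close> even to
    covering sets of diameter 0.\<close>
  define x where "x i = diameter (U i) powr s + \<eta> * (1/2)^Suc i" for i :: nat
  define d where "d i = x i powr (1/s)" for i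
  have x: "x i > 0" for i unfolding x_def using \<eta> by (intro add_nonneg_pos) auto
  have d: "d i > 0" "d i powr s = x i" "diameter (U i) \<le> d i" for i
  proof -
    show "d i > 0" unfolding d_def using x[of i] by simp
    show "d i powr s = x i" unfolding d_def using x[of i] s by (simp add: powr_powr)
    have "diameter (U i) = (diameter (U i) powr s) powr (1/s)"
      using s diameter_ge_0[OF U(1)] by (simp add: powr_powr)
    also have "\<dots> \<le> d i" unfolding d_def x_def using s \<eta> by (intro powr_mono2) auto
    finally show "diameter (U i) \<le> d i" .
  qed
  have sumx: "(\<Sum>i. ennreal (x i)) \<le> ennreal (2 * \<eta>)"
  proof -
    have "(\<Sum>i. ennreal (x i)) = (\<Sum>i. ennreal (diameter (U i) powr s) + ennreal (\<eta> * (1/2)^Suc i))"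
      unfolding x_def using \<eta> by (intro suminf_cong ennreal_plus) auto
    also have "\<dots> = (\<Sum>i. ennreal (diameter (U i) powr s)) + (\<Sum>i. ennreal (\<eta> * (1/2)^Suc i))"
      by (rule suminf_add[symmetric]) auto
    also have "(\<Sum>i. ennreal (\<eta> * (1/2)^Suc i)) = ennreal \<eta>"
    proof -
      have "(\<lambda>i. \<eta> * (1/2)^Suc i) sums (\<eta> * 1)" by (intro sums_mult power_half_series)
      then show ?thesis using \<eta> by (subst suminf_ennreal2) (auto simp: sums_iff)
    qed
    also have "(\<Sum>i. ennreal (diameter (U i) powr s)) + ennreal \<eta> \<le> ennreal \<eta> + ennreal \<eta>"
      using U(3) by (intro add_right_mono) auto
    finally show ?thesis using \<eta> by (simp add: ennreal_plus[symmetric] del: ennreal_plus)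
  qed
  have dsmall: "d i < (1/6)^Suc N" for i
  proof -
    have "ennreal (x i) \<le> (\<Sum>i. ennreal (x i))" using sum_le_suminf[of "\<lambda>i. ennreal (x i)" "{i}"] by simp
    then have "ennreal (x i) \<le> ennreal (2 * \<eta>)" using sumx by (rule order_trans)
    then have "x i \<le> 2 * \<eta>" using \<eta> by (simp add: ennreal_le_iff)
    also have "\<dots> < ((1/6)^Suc N) powr s"
    proof -
      have "0 < ((1/6::real)^Suc N) powr s" by simp
      then show ?thesis using \<eta>(3) by linarith
    qed
    finally have "x i powr (1/s) < (((1/6)^Suc N) powr s) powr (1/s)" using s x[of i] by (intro powr_less_mono2) auto
    then show ?thesis using s by (simp add: d_def powr_powr)
  qed
  define W where "W i = {w. stopping (d i) w \<and> light w \<and> itv (st w) \<inter> U i \<noteq> {}}" for i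
  have W: "finite (W i) \<and> card (W i) \<le> 24" for i
  proof -
    have dU: "\<bar>y - z\<bar> \<le> d i" if "y \<in> U i" "z \<in> U i" for y z
      using diameter_bounded_bound[OF U(1) that] d(3)[of i] by (simp add: dist_real_def)
    have sub: "W i \<subseteq> {w. stopping (d i) w \<and> itv (st w) \<inter> U i \<noteq> {}}" by (auto simp: W_def)
    have "finite {w. stopping (d i) w \<and> itv (st w) \<inter> U i \<noteq> {}} \<and> card {w. stopping (d i) w \<and> itv (st w) \<inter> U i \<noteq> {}} \<le> 24"
      using d(1) dU by (rule stopping_count)
    then show ?thesis using finite_subset[OF sub] card_mono[OF _ sub] by auto
  qed
  define cyl where "cyl w = {\<omega>. map \<omega> [0..<length w] = w}" for w :: "nat list"
  have cyl_sets: "cyl w \<in> events" for w unfolding cyl_def by (rule sets_bern_cylinder[of "\<lambda>v. v = w"])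
  have cyl_mass: "emeasure (bern p) (cyl w) = ennreal (prod_list (map (pmf p) w))" for w
  proof -
    have "map \<omega> [0..<length w] = w \<longleftrightarrow> (\<forall>i\<in>{..<length w}. \<omega> i = w ! i)" for \<omega>
      by (subst list_eq_iff_nth_eq) auto
    then have "cyl w = {\<omega>. \<forall>i\<in>{..<length w}. \<omega> i = w ! i}" unfolding cyl_def by simp
    then have "emeasure (bern p) (cyl w) = (\<Prod>i<length w. ennreal (pmf p (w ! i)))"
      by (simp add: emeasure_bern)
    also have "\<dots> = ennreal (\<Prod>i<length w. pmf p (w ! i))" by (rule prod_ennreal) simp
    also have "(\<Prod>i<length w. pmf p (w ! i)) = prod_list (map (pmf p) w)"
      by (simp add: prod.list_conv_set_nth atLeast0LessThan)
    finally show ?thesis .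
  qed
  define B where "B i = (\<Union>w\<in>W i. cyl w)" for i
  have B_sets: "B i \<in> events" for i unfolding B_def using W cyl_sets by (intro sets.finite_UN) auto
  have B_mass: "emeasure (bern p) (B i) \<le> ennreal (24 * x i)" for i
  proof -
    have "emeasure (bern p) (B i) \<le> (\<Sum>w\<in>W i. emeasure (bern p) (cyl w))"
      unfolding B_def using W cyl_sets by (intro emeasure_subadditive_finite) auto
    also have "\<dots> \<le> (\<Sum>w\<in>W i. ennreal (x i))"
    proof (rule sum_mono)
      fix w assume w: "w \<in> W i"
      have "prod_list (map (pmf p) w) \<le> len (st w) powr s" using w by (simp add: W_def light_def)
      also have "\<dots> \<le> d i powr s" using w s stopping_len[of "d i" w] by (intro powr_mono2) (auto simp: W_def stopping_def)
      finally show "emeasure (bern p) (cyl w) \<le> ennreal (x i)" unfolding cyl_mass d(2) by (rule ennreal_leI)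
    qed
    also have "\<dots> = ennreal (card (W i) * x i)" using x[of i] by (simp add: ennreal_mult'' ennreal_of_nat_eq_real_of_nat)
    also have "\<dots> \<le> ennreal (24 * x i)" using W[of i] x[of i] by (intro ennreal_leI mult_right_mono) auto
    finally show ?thesis .
  qed
  have "AE \<omega> in bern p. \<omega> \<in> P N \<longrightarrow> \<omega> \<in> (\<Union>i. B i)"
    using AE_conjI[OF E AE_bern_support]
  proof (rule AE_mp, intro AE_I2 impI)
    fix \<omega> assume a: "pt \<omega> \<in> E \<and> (\<forall>i. \<omega> i \<in> set_pmf p)" and P: "\<omega> \<in> P N"
    have w: "\<omega> i < 4" for i using a p by auto
    obtain i where i: "pt \<omega> \<in> U i" using a U(2) by blast
    have d1: "d i < 1" using dsmall[of i] power_le_one[of "1/6::real" "Suc N"] by simp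
    obtain n where n: "stopping (d i) (map \<omega> [0..<Suc n])" by (rule path_stopping[OF w d(1) d1])
    have "len (path \<omega> (Suc n)) \<le> d i" using n unfolding stopping_def path_st by blast
    then have "(1/6)^Suc n < (1/6::real)^Suc N" using path_len_ge[of "Suc n" \<omega>] dsmall[of i] by linarith
    then have "N < n" by (simp add: power_strict_decreasing_iff)
    then have "light (map \<omega> [0..<Suc n])" using P unfolding P_def by (simp del: upt_Suc)
    moreover have "pt \<omega> \<in> itv (st (map \<omega> [0..<Suc n]))" using pt_itv[OF w, where n = "Suc n"] unfolding path_st .
    ultimately have "map \<omega> [0..<Suc n] \<in> W i" using n i unfolding W_def by blast
    then show "\<omega> \<in> (\<Union>i. B i)" unfolding B_def cyl_def by (intro UN_I[of i] UN_I[of "map \<omega> [0..<Suc n]"]) auto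
  qed
  then have "ennreal m0 \<le> emeasure (bern p) (\<Union>i. B i)" unfolding m0(2)[symmetric]
    using B_sets by (intro emeasure_mono_AE) auto
  also have "\<dots> \<le> (\<Sum>i. emeasure (bern p) (B i))" using B_sets by (intro emeasure_subadditive_countably) auto
  also have "\<dots> \<le> (\<Sum>i. ennreal 24 * ennreal (x i))"
  proof (intro suminf_le summableI)
    have "ennreal (24 * x i) = ennreal 24 * ennreal (x i)" for i by (rule ennreal_mult) (use x[of i] in auto)
    then show "emeasure (bern p) (B i) \<le> ennreal 24 * ennreal (x i)" for i using B_mass[of i] by metis
  qed
  also have "\<dots> = ennreal 24 * (\<Sum>i. ennreal (x i))" by (rule ennreal_suminf_cmult)
  also have "\<dots> \<le> ennreal 24 * ennreal (2 * \<eta>)" using sumx by (intro mult_left_mono) auto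
  also have "\<dots> = ennreal (24 * (2 * \<eta>))" by (rule ennreal_mult[symmetric]) (use \<eta> in auto)
  finally have "m0 \<le> 24 * (2 * \<eta>)" using \<eta> by (simp add: ennreal_le_iff)
  then show False using \<eta>(2) m0(1) by simp
qed

end

section \<open>Slopes along typical addresses\<close>

definition lograt :: "nat \<Rightarrow> real" where "lograt t = (if t = 1 \<or> t = 2 then ln 6 else ln 3)"

lemma ln3_ge_1: "ln 3 \<ge> (1::real)"
  using exp_le by (simp add: ln_ge_iff)

lemma lograt_ge_1: "lograt t \<ge> 1"
proof -
  have "ln 3 \<le> ln (6::real)" by simp
  then have "1 \<le> ln (6::real)" using ln3_ge_1 by linarith
  then show ?thesis using ln3_ge_1 unfolding lograt_def by simp
qed

text \<open>Turns errors proportional to the number of steps into errors proportional to minus the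
  logarithm of the length.\<close>

lemma sum_lograt_ge: "(\<Sum>i<n. lograt (\<omega> i)) \<ge> real n"
proof -
  have "(\<Sum>i<n. 1) \<le> (\<Sum>i<n. lograt (\<omega> i))" by (intro sum_mono lograt_ge_1)
  then show ?thesis by simp
qed

context koch
begin

text \<open>The logarithm of the asymptotic slope factor of a type; it is 0 for types 0 and 3, which
  keep the slope. \<open>lograt\<close> is minus the logarithm of the ratio.\<close>

definition logmult :: "nat \<Rightarrow> real" where
  "logmult t = (if t = 1 then ln (c + 1) else if t = 2 then ln (c - 1) else 0)"

lemma path_len_exp: "len (path \<omega> n) = exp (- (\<Sum>i<n. lograt (\<omega> i)))"
  by (induction n) (auto simp: root_def step_len lograt_def exp_diff exp_minus field_simps)

text \<open>From \<open>sn m \<ge> \<bar>m\<bar>\<close>, a middle step multiplies a nonzero slope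
  by at least its nominal factor. Only the first middle step falls short: it leads from 0 to
  \<open>c\<close> instead of gaining \<open>c + 1\<close> or \<open>c - 1\<close>, and
  \<open>c / (c + 1)\<close> covers both cases.\<close>

lemma sn_ge_exp:
  assumes "\<And>i. \<omega> i < 4"
  shows "c / (c + 1) * exp (\<Sum>i<n. logmult (\<omega> i)) \<le> sn (slp (path \<omega> n))"
proof -
  let ?m = "\<lambda>n. slp (path \<omega> n)" and ?S = "\<lambda>n. \<Sum>i<n. logmult (\<omega> i)"
  \<comment> \<open>The first alternative holds as long as only types 0 and 3 have occurred.\<close>
  have "?m n = 0 \<and> ?S n = 0 \<or> c / (c + 1) * exp (?S n) \<le> \<bar>?m n\<bar>"
  proof (induction n)
    case 0 show ?case by (simp add: root_def)
  next
    case (Suc n)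
    have S: "exp (?S (Suc n)) = exp (logmult (\<omega> n)) * exp (?S n)" by (simp add: exp_add)
    consider "\<omega> n = 0 \<or> \<omega> n = 3" | "\<omega> n = 1" | "\<omega> n = 2" using assms[of n] by linarith
    then show ?case
    proof cases
      case 1
      then have "?m (Suc n) = ?m n" "logmult (\<omega> n) = 0"
        using step_slp03[of "\<omega> n" "path \<omega> n"] by (auto simp: logmult_def)
      then show ?thesis using Suc by simp
    next
      case 2
      then have e: "exp (logmult (\<omega> n)) = c + 1" using c_bounds by (simp add: logmult_def)
      have m: "\<bar>?m (Suc n)\<bar> = c * sn (?m n) + \<bar>?m n\<bar>" using 2 step_slp12(1) by simp
      have "c / (c + 1) * exp (?S (Suc n)) \<le> \<bar>?m (Suc n)\<bar>"
      proof (cases "?m n = 0 \<and> ?S n = 0")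
        case True
        then show ?thesis unfolding S e m using c_bounds by (simp add: sn_def)
      next
        case False
        then have "(c + 1) * (c / (c + 1) * exp (?S n)) \<le> (c + 1) * \<bar>?m n\<bar>"
          using Suc c_bounds by (intro mult_left_mono) auto
        also have "\<dots> \<le> c * sn (?m n) + \<bar>?m n\<bar>"
          using mult_left_mono[OF abs_le_sn[of "?m n"], of c] c_bounds by (simp add: algebra_simps)
        finally show ?thesis unfolding S e m by (simp add: mult_ac)
      qed
      then show ?thesis by blast
    next
      case 3
      then have e: "exp (logmult (\<omega> n)) = c - 1" using c_bounds by (simp add: logmult_def)
      have m: "\<bar>?m (Suc n)\<bar> = c * sn (?m n) - \<bar>?m n\<bar>" using 3 step_slp12(2) by simp
      have "c / (c + 1) * exp (?S (Suc n)) \<le> \<bar>?m (Suc n)\<bar>"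
      proof (cases "?m n = 0 \<and> ?S n = 0")
        case True
        then show ?thesis unfolding S e m using c_bounds by (simp add: sn_def field_simps)
      next
        case False
        then have "(c - 1) * (c / (c + 1) * exp (?S n)) \<le> (c - 1) * \<bar>?m n\<bar>"
          using Suc c_bounds by (intro mult_left_mono) auto
        also have "\<dots> \<le> c * sn (?m n) - \<bar>?m n\<bar>"
          using mult_left_mono[OF abs_le_sn[of "?m n"], of c] c_bounds by (simp add: algebra_simps)
        finally show ?thesis unfolding S e m by (simp add: mult_ac)
      qed
      then show ?thesis by blast
    qed
  qed
  then show ?thesis
  proof
    assume "?m n = 0 \<and> ?S n = 0"
    then show ?thesis using c_bounds by (simp add: sn_def)
  next
    assume "c / (c + 1) * exp (?S n) \<le> \<bar>?m n\<bar>"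
    then show ?thesis using abs_le_sn[of "?m n"] by linarith
  qed
qed

text \<open>The slopes behave like a multiplicative walk reflected at a bounded level: \<open>j\<close> is the last
  time at which the slope was below that level.\<close>
lemma ln_sn_le:
  assumes "\<eta> > 0"
  obtains L where "\<And>\<omega> n. (\<And>i. \<omega> i < 4) \<Longrightarrow> \<exists>j\<le>n. ln (sn (slp (path \<omega> n)))
     \<le> L + ((\<Sum>i<n. logmult (\<omega> i)) - (\<Sum>i<j. logmult (\<omega> i))) + \<eta> * (real n - real j)"
proof -
  \<comment> \<open>The additive error 2 of a type 2 step is at most
    \<open>(c - 1) * \<eta> * sn\<close> above this level.\<close>
  define M where "M = max 1 (2 / ((c - 1) * \<eta>))"
  define L where "L = ln ((c + 1) * M)"
  have M: "M \<ge> 1" by (simp add: M_def)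
  have "1 \<le> (c + 1) * M" using mult_mono[of 1 "c + 1" 1 M] M c_bounds by simp
  then have L: "L \<ge> 0" by (simp add: L_def)
  have "\<exists>j\<le>n. ln (sn (slp (path \<omega> n)))
     \<le> L + ((\<Sum>i<n. logmult (\<omega> i)) - (\<Sum>i<j. logmult (\<omega> i))) + \<eta> * (real n - real j)"
    if w: "\<And>i. \<omega> i < 4" for \<omega> n
  proof (induction n)
    case 0 show ?case using L by (intro exI[of _ 0]) (simp add: root_def sn_def)
  next
    case (Suc n)
    let ?s = "path \<omega> n"
    show ?case
    proof (cases "sn (slp ?s) < M")
      case True
      have "sn (slp (path \<omega> (Suc n))) \<le> (c + 1) * sn (slp ?s)" using step_sn[OF w[of n], of ?s] by simp
      also have "\<dots> \<le> (c + 1) * M" using True c_bounds by simp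
      finally have "ln (sn (slp (path \<omega> (Suc n)))) \<le> L" unfolding L_def by (subst ln_le_cancel_iff) (use M c_bounds in auto)
      \<comment> \<open>Below the level the clock \<open>j\<close> is reset: both differences vanish
        and only \<open>L\<close> remains.\<close>
      then show ?thesis by (intro exI[of _ "Suc n"]) simp
    next
      case False
      have "sn (slp (path \<omega> (Suc n))) \<le> exp (logmult (\<omega> n)) * ((1 + \<eta>) * sn (slp ?s))"
      proof -
        have grow: "1 * sn (slp ?s) \<le> (1 + \<eta>) * sn (slp ?s)" using assms by (intro mult_right_mono) auto
        consider "\<omega> n = 0 \<or> \<omega> n = 3" | "\<omega> n = 1" | "\<omega> n = 2" using w[of n] by linarith
        then show ?thesis
        proof cases
          case 1
          then have "slp (path \<omega> (Suc n)) = slp ?s" "logmult (\<omega> n) = 0"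
            using step_slp03[of "\<omega> n" ?s] by (auto simp: logmult_def)
          then show ?thesis using grow by simp
        next
          case 2
          then have "exp (logmult (\<omega> n)) = c + 1" using c_bounds by (simp add: logmult_def)
          moreover have "sn (slp (path \<omega> (Suc n))) \<le> (c + 1) * sn (slp ?s)" using step_sn[OF w[of n], of ?s] by simp
          moreover have "(c + 1) * sn (slp ?s) \<le> (c + 1) * ((1 + \<eta>) * sn (slp ?s))"
            using grow c_bounds by (intro mult_left_mono) auto
          ultimately show ?thesis by simp
        next
          case 3
          then have e: "exp (logmult (\<omega> n)) = c - 1" using c_bounds by (simp add: logmult_def)
          have a: "\<bar>slp (path \<omega> (Suc n))\<bar> = c * sn (slp ?s) - \<bar>slp ?s\<bar>" using 3 step_slp12(2) by simp
          have "sn (slp (path \<omega> (Suc n))) \<le> 1 + (c * sn (slp ?s) - \<bar>slp ?s\<bar>)" using sn_le[of "slp (path \<omega> (Suc n))"] a by simp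
          also have "\<dots> \<le> (c - 1) * sn (slp ?s) + 2" using sn_le[of "slp ?s"] by (simp add: algebra_simps)
          also have "2 \<le> (c - 1) * \<eta> * sn (slp ?s)"
          proof -
            have "2 / ((c - 1) * \<eta>) \<le> sn (slp ?s)" using False unfolding M_def by simp
            then show ?thesis using assms c_bounds by (simp add: pos_divide_le_eq mult.commute)
          qed
          finally show ?thesis unfolding e by (simp add: algebra_simps)
        qed
      qed
      then have "ln (sn (slp (path \<omega> (Suc n)))) \<le> ln (exp (logmult (\<omega> n)) * ((1 + \<eta>) * sn (slp ?s)))"
        by (subst ln_le_cancel_iff) (use assms in \<open>auto intro!: mult_pos_pos simp: add_pos_pos\<close>)
      also have "\<dots> = logmult (\<omega> n) + (ln (1 + \<eta>) + ln (sn (slp ?s)))"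
        using assms by (simp add: ln_mult less_imp_neq[symmetric])
      also have "ln (1 + \<eta>) \<le> \<eta>" using assms by (intro ln_add_one_self_le_self) simp
      finally have step: "ln (sn (slp (path \<omega> (Suc n)))) \<le> logmult (\<omega> n) + \<eta> + ln (sn (slp ?s))" by simp
      from Suc obtain j where j: "j \<le> n" "ln (sn (slp ?s))
        \<le> L + ((\<Sum>i<n. logmult (\<omega> i)) - (\<Sum>i<j. logmult (\<omega> i))) + \<eta> * (real n - real j)" by blast
      have "\<eta> * (real (Suc n) - real j) = \<eta> * (real n - real j) + \<eta>" by (simp add: algebra_simps)
      then show ?thesis using j step by (intro exI[of _ j]) (auto simp del: path.simps)
    qed
  qed
  then show ?thesis by (rule that)
qed

text \<open>The lower estimate is \<open>sn_ge_exp\<close>. In the upper one, looking back to the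
  reset time \<open>j\<close> leaves \<open>- \<kappa> * R j\<close>, which may be dropped because
  \<open>\<kappa> \<ge> 0\<close>; reflection at moderate slopes would break the law for a negative
  rate.\<close>

lemma ln_sn_asymp:
  assumes w: "\<And>i. \<omega> i < 4" and k: "\<kappa> \<ge> 0"
    and S: "\<forall>\<epsilon>>0. \<forall>\<^sub>F n in sequentially. \<bar>\<Sum>i<n. logmult (\<omega> i) - \<kappa> * lograt (\<omega> i)\<bar> \<le> \<epsilon> * real n"
    and e: "\<epsilon> > 0"
  shows "\<forall>\<^sub>F n in sequentially. \<bar>ln (sn (slp (path \<omega> n))) - \<kappa> * (\<Sum>i<n. lograt (\<omega> i))\<bar> \<le> \<epsilon> * (\<Sum>i<n. lograt (\<omega> i))"
proof -
  define T where "T n = (\<Sum>i<n. logmult (\<omega> i) - \<kappa> * lograt (\<omega> i))" for n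
  define R where "R n = (\<Sum>i<n. lograt (\<omega> i))" for n
  have T: "(\<Sum>i<n. logmult (\<omega> i)) = T n + \<kappa> * R n" for n
    unfolding T_def R_def by (simp add: sum_subtractf sum_distrib_left)
  have R: "R n \<ge> real n" for n unfolding R_def by (rule sum_lograt_ge)
  obtain L where L: "\<And>n. \<exists>j\<le>n. ln (sn (slp (path \<omega> n)))
     \<le> L + ((\<Sum>i<n. logmult (\<omega> i)) - (\<Sum>i<j. logmult (\<omega> i))) + \<epsilon> / 4 * (real n - real j)"
    using ln_sn_le[of "\<epsilon> / 4"] e w by (metis divide_pos_pos zero_less_numeral)
  have "\<forall>\<^sub>F n in sequentially. \<bar>T n\<bar> \<le> \<epsilon> / 4 * real n" unfolding T_def using S[rule_format, of "\<epsilon> / 4"] e by simp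
  then obtain N where N: "\<And>n. n \<ge> N \<Longrightarrow> \<bar>T n\<bar> \<le> \<epsilon> / 4 * real n" by (auto simp: eventually_sequentially)
  define K where "K = (\<Sum>n<N. \<bar>T n\<bar>)"
  have TK: "\<bar>T n\<bar> \<le> K + \<epsilon> / 4 * real n" for n
  proof (cases "n < N")
    case True
    then have "\<bar>T n\<bar> \<le> K" unfolding K_def by (intro member_le_sum[where f = "\<lambda>n. \<bar>T n\<bar>"]) auto
    then show ?thesis using mult_nonneg_nonneg[of "\<epsilon> / 4" "real n"] e by linarith
  next
    case False
    have "K \<ge> 0" unfolding K_def by (intro sum_nonneg) simp
    then show ?thesis using N[of n] False by simp
  qed
  \<comment> \<open>Beyond \<open>N'\<close> all constants fit into one quarter of
    \<open>\<epsilon> * n\<close>; \<open>T n\<close>, \<open>T j\<close> and the drift in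
    \<open>ln_sn_le\<close> use the other three.\<close>
  obtain N' :: nat where N': "(\<bar>L\<bar> + 2 * K + \<bar>ln (c / (c + 1))\<bar>) / (\<epsilon> / 4) \<le> real N'" using real_arch_simple by blast
  have up: "ln (sn (slp (path \<omega> n))) \<le> \<kappa> * R n + (\<bar>L\<bar> + 2 * K) + 3 * (\<epsilon> / 4) * real n" for n
  proof -
    obtain j where j: "j \<le> n" "ln (sn (slp (path \<omega> n)))
     \<le> L + ((\<Sum>i<n. logmult (\<omega> i)) - (\<Sum>i<j. logmult (\<omega> i))) + \<epsilon> / 4 * (real n - real j)" using L by blast
    have "R j \<ge> 0" using R[of j] by (meson of_nat_0_le_iff order_trans)
    then have "\<kappa> * R j \<ge> 0" using k by simp
    moreover have "\<epsilon> / 4 * (real n - real j) \<le> \<epsilon> / 4 * real n" using e by simp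
    moreover have "\<epsilon> / 4 * real j \<le> \<epsilon> / 4 * real n" using e j by simp
    ultimately show ?thesis using j(2) TK[of n] TK[of j] unfolding T by linarith
  qed
  have low: "ln (c / (c + 1)) + T n + \<kappa> * R n \<le> ln (sn (slp (path \<omega> n)))" for n
  proof -
    have "ln (c / (c + 1) * exp (\<Sum>i<n. logmult (\<omega> i))) \<le> ln (sn (slp (path \<omega> n)))"
      using sn_ge_exp[OF w, where n = n] c_bounds by (subst ln_le_cancel_iff) auto
    moreover have "ln (c / (c + 1) * exp (\<Sum>i<n. logmult (\<omega> i))) = ln (c / (c + 1)) + (\<Sum>i<n. logmult (\<omega> i))"
      using c_bounds by (subst ln_mult) auto
    ultimately show ?thesis unfolding T by simp
  qed
  have "\<bar>ln (sn (slp (path \<omega> n))) - \<kappa> * R n\<bar> \<le> \<epsilon> * R n" if "n \<ge> N'" for n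
  proof -
    have "(\<bar>L\<bar> + 2 * K + \<bar>ln (c / (c + 1))\<bar>) / (\<epsilon> / 4) \<le> real n" using N' that by (meson of_nat_mono order_trans)
    then have "\<bar>L\<bar> + 2 * K + \<bar>ln (c / (c + 1))\<bar> \<le> \<epsilon> / 4 * real n" using e by (simp add: pos_divide_le_eq mult.commute)
    moreover have "K \<ge> 0" unfolding K_def by (intro sum_nonneg) simp
    moreover have "\<epsilon> * real n \<le> \<epsilon> * R n" using R[of n] e by simp
    ultimately show ?thesis using up[of n] low[of n] TK[of n] unfolding abs_le_iff by linarith
  qed
  then show ?thesis unfolding R_def eventually_sequentially by blast
qed

text \<open>The asymptotics make \<open>wid\<close> equal to \<open>len powr (1 - \<kappa>)\<close>
  up to arbitrarily small powers of the length, and the two regularity criteria along the address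
  meet.\<close>

lemma hoelder_exp_pt:
  assumes w: "\<And>i. \<omega> i < 4" and k: "0 \<le> \<kappa>" "\<kappa> \<le> kmax"
    and S: "\<forall>\<epsilon>>0. \<forall>\<^sub>F n in sequentially. \<bar>\<Sum>i<n. logmult (\<omega> i) - \<kappa> * lograt (\<omega> i)\<bar> \<le> \<epsilon> * real n"
  shows "hoelder_exp (F lam) (pt \<omega>) = ereal (1 - \<kappa>)"
proof -
  define R where "R n = (\<Sum>i<n. lograt (\<omega> i))" for n
  have wd: "wid (path \<omega> n) = exp (ln (sn (slp (path \<omega> n))) - R n)" for n
    unfolding wid_def path_len_exp R_def by (simp add: exp_diff exp_minus field_simps)
  have lp: "len (path \<omega> n) powr b = exp (- b * R n)" for n b
    unfolding path_len_exp R_def by (simp add: powr_def)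
  have asy: "\<forall>\<^sub>F n in sequentially. \<bar>ln (sn (slp (path \<omega> n))) - \<kappa> * R n\<bar> \<le> \<epsilon> * R n" if "\<epsilon> > 0" for \<epsilon>
    unfolding R_def using ln_sn_asymp[OF w k(1) S that] .
  show ?thesis
  proof (rule antisym)
    show "hoelder_exp (F lam) (pt \<omega>) \<le> ereal (1 - \<kappa>)" unfolding hoelder_exp_def
    proof (rule Sup_least, safe)
      fix \<beta> assume b: "\<beta> \<ge> 0" "pointwise_Calpha (F lam) (pt \<omega>) \<beta>"
      show "ereal \<beta> \<le> ereal (1 - \<kappa>)"
      proof (rule ccontr)
        assume "\<not> ?thesis"
        then have "1 - \<kappa> < min \<beta> 2" using k by auto
        then obtain b' where b': "1 - \<kappa> < b'" "b' < min \<beta> 2" using dense by blast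
        obtain C where C: "C > 0" "\<And>n. wid (path \<omega> n) \<le> C * len (path \<omega> n) powr (min \<beta> 2)"
          using wid_le_of_Calpha[OF b(2,1) w pt_itv[OF w]] by blast
        have "\<forall>\<^sub>F n in sequentially. C * len (path \<omega> n) powr (min \<beta> 2) < len (path \<omega> n) powr b'
           \<and> \<bar>ln (sn (slp (path \<omega> n))) - \<kappa> * R n\<bar> \<le> (b' - (1 - \<kappa>)) * R n"
          by (intro eventually_conj len_powr_small asy) (use b' in auto)
        from eventually_happens'[OF sequentially_bot this]
        obtain n where n: "C * len (path \<omega> n) powr (min \<beta> 2) < len (path \<omega> n) powr b'"
           "\<bar>ln (sn (slp (path \<omega> n))) - \<kappa> * R n\<bar> \<le> (b' - (1 - \<kappa>)) * R n" by blast
        have "- b' * R n \<le> ln (sn (slp (path \<omega> n))) - R n" using n(2) unfolding left_diff_distrib by (simp add: abs_le_iff algebra_simps)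
        then have "len (path \<omega> n) powr b' \<le> wid (path \<omega> n)" unfolding wd lp by simp
        then show False using n(1) C(2)[of n] by linarith
      qed
    qed
    show "ereal (1 - \<kappa>) \<le> hoelder_exp (F lam) (pt \<omega>)"
    proof (rule ereal_le_epsilon2)
      fix e :: real assume "e > 0"
      \<comment> \<open>The cap keeps the exponent \<open>1 - \<kappa> - \<epsilon>\<close>
        nonnegative.\<close>
      define \<epsilon> where "\<epsilon> = min e (1 - \<kappa>)"
      have \<epsilon>: "\<epsilon> > 0" "\<epsilon> \<le> e" "\<epsilon> \<le> 1 - \<kappa>" using \<open>e > 0\<close> k kmax by (auto simp: \<epsilon>_def)
      obtain N where N: "\<And>n. n \<ge> N \<Longrightarrow> \<bar>ln (sn (slp (path \<omega> n))) - \<kappa> * R n\<bar> \<le> \<epsilon> * R n"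
        using asy[OF \<epsilon>(1)] by (auto simp: eventually_sequentially)
      have "pointwise_Calpha (F lam) (pt \<omega>) (1 - \<kappa> - \<epsilon>)"
      proof (rule Calpha_of_eventually_wid_le)
        show "wid (path \<omega> n) \<le> len (path \<omega> n) powr (1 - \<kappa> - \<epsilon>)" if "n \<ge> N" for n
          using N[OF that] unfolding wd lp by (simp add: abs_le_iff algebra_simps)
      qed (use \<epsilon> w pt_itv[OF w] in auto)
      then have "ereal (1 - \<kappa> - \<epsilon>) \<le> hoelder_exp (F lam) (pt \<omega>)" using \<epsilon> by (intro hoelder_upper) auto
      then have "ereal (1 - \<kappa> - \<epsilon>) + ereal \<epsilon> \<le> hoelder_exp (F lam) (pt \<omega>) + ereal \<epsilon>" by (rule add_right_mono)
      also have "\<dots> \<le> hoelder_exp (F lam) (pt \<omega>) + ereal e" using \<epsilon> by (intro add_left_mono) simp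
      finally show "ereal (1 - \<kappa>) \<le> hoelder_exp (F lam) (pt \<omega>) + ereal e" by simp
    qed
  qed
qed

text \<open>Lower bound by the Bernoulli measure with weights \<open>v\<close>: \<open>D\<close> is its entropy divided by its
  Lyapunov exponent.\<close>
lemma spectrum_ge:
  assumes v: "\<And>t. v t \<ge> 0" "(\<Sum>t<4. v t) = 1" and k: "0 \<le> \<kappa>" "\<kappa> \<le> kmax"
    and mean: "(\<Sum>t<4. v t * (logmult t - \<kappa> * lograt t)) = 0"
    and ent: "(\<Sum>t<4. v t * (- ln (v t) - D * lograt t)) = 0"
  shows "spectrum_F (F lam) (1 - \<kappa>) \<ge> ereal D" "{x \<in> {0..1}. hoelder_exp (F lam) x = ereal (1 - \<kappa>)} \<noteq> {}"
proof -
  \<comment> \<open>A mass function must be given on all natural numbers.\<close>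
  define u where "u t = (if t < 4 then v t else 0)" for t
  have "(\<integral>\<^sup>+ t. ennreal (u t) \<partial>count_space UNIV) = (\<Sum>t<4. ennreal (u t))"
    by (rule nn_integral_count_space') (auto simp: u_def)
  also have "\<dots> = ennreal (\<Sum>t<4. u t)" by (rule sum_ennreal) (use v in \<open>auto simp: u_def\<close>)
  also have "(\<Sum>t<4. u t) = 1" using v(2) by (simp add: u_def)
  finally have tot: "(\<integral>\<^sup>+ t. ennreal (u t) \<partial>count_space UNIV) = 1" by simp
  define p where "p = embed_pmf u"
  have p: "pmf p t = u t" for t unfolding p_def by (rule pmf_embed_pmf[OF _ tot]) (use v in \<open>auto simp: u_def\<close>)
  have sp: "set_pmf p \<subseteq> {..<4}" by (auto simp: set_pmf_eq p u_def split: if_splits)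
  then have fin: "finite (set_pmf p)" by (rule finite_subset) simp
  have sums: "(\<Sum>t\<in>set_pmf p. pmf p t * f t) = (\<Sum>t<4. v t * f t)" for f :: "nat \<Rightarrow> real"
  proof -
    have "(\<Sum>t\<in>set_pmf p. pmf p t * f t) = (\<Sum>t<4. pmf p t * f t)"
      using sp by (intro sum.mono_neutral_left) (auto simp: set_pmf_eq)
    then show ?thesis by (simp add: p u_def)
  qed
  interpret prob_space "bern p" by (rule prob_space_bern)
  let ?E = "{x \<in> {0..1}. hoelder_exp (F lam) x = ereal (1 - \<kappa>)}"
  have "AE \<omega> in bern p. \<forall>\<epsilon>>0. \<forall>\<^sub>F n in sequentially. \<bar>\<Sum>i<n. logmult (\<omega> i) - \<kappa> * lograt (\<omega> i)\<bar> \<le> \<epsilon> * real n"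
    by (rule slln_bern[OF fin]) (use mean sums in simp)
  then have E: "AE \<omega> in bern p. pt \<omega> \<in> ?E"
    using AE_bern_support
  proof (rule AE_mp[OF _ AE_mp], intro AE_I2 impI)
    fix \<omega> assume s: "\<forall>i. \<omega> i \<in> set_pmf p"
      and a: "\<forall>\<epsilon>>0. \<forall>\<^sub>F n in sequentially. \<bar>\<Sum>i<n. logmult (\<omega> i) - \<kappa> * lograt (\<omega> i)\<bar> \<le> \<epsilon> * real n"
    have w: "\<omega> i < 4" for i using s sp by auto
    show "pt \<omega> \<in> ?E" using hoelder_exp_pt[OF w k a] pt_01[of \<omega>] w by simp
  qed
  show ne: "?E \<noteq> {}"
  proof
    assume "?E = {}"
    then have "AE \<omega> in bern p. False" using E by (rule subst[where P = "\<lambda>E. AE \<omega> in bern p. pt \<omega> \<in> E", THEN AE_mp]) auto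
    then show False by simp
  qed
  have pos: "hausdorff_outer s ?E \<noteq> 0" if s: "0 < s" "s < D" for s
  proof (rule mass_distribution[OF sp s(1) E])
    \<comment> \<open>The strong law for minus the logarithm of the weights: cylinder masses behave
      like \<open>len powr D\<close>, and \<open>s < D\<close> leaves the room
      \<open>(D - s) * n\<close> for the error.\<close>
    have "AE \<omega> in bern p. \<forall>\<epsilon>>0. \<forall>\<^sub>F n in sequentially. \<bar>\<Sum>i<n. - ln (u (\<omega> i)) - D * lograt (\<omega> i)\<bar> \<le> \<epsilon> * real n"
    proof (rule slln_bern[OF fin])
      have "(\<Sum>t<4. v t * (- ln (u t) - D * lograt t)) = (\<Sum>t<4. v t * (- ln (v t) - D * lograt t))"
        by (intro sum.cong) (auto simp: u_def)
      then show "(\<Sum>t\<in>set_pmf p. pmf p t * (- ln (u t) - D * lograt t)) = 0" using ent unfolding sums by simp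
    qed
    then show "AE \<omega> in bern p. \<exists>N. \<forall>n\<ge>N. (\<Prod>i<n. pmf p (\<omega> i)) \<le> len (path \<omega> n) powr s"
      using AE_bern_support
    proof (rule AE_mp[OF _ AE_mp], intro AE_I2 impI)
      fix \<omega> assume sup: "\<forall>i. \<omega> i \<in> set_pmf p"
        and a: "\<forall>\<epsilon>>0. \<forall>\<^sub>F n in sequentially. \<bar>\<Sum>i<n. - ln (u (\<omega> i)) - D * lograt (\<omega> i)\<bar> \<le> \<epsilon> * real n"
      have up: "u (\<omega> i) > 0" for i using sup by (metis p pmf_positive)
      have "\<forall>\<^sub>F n in sequentially. \<bar>\<Sum>i<n. - ln (u (\<omega> i)) - D * lograt (\<omega> i)\<bar> \<le> (D - s) * real n" using a s by simp
      then obtain N where N: "\<And>n. n \<ge> N \<Longrightarrow> \<bar>\<Sum>i<n. - ln (u (\<omega> i)) - D * lograt (\<omega> i)\<bar> \<le> (D - s) * real n"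
        by (auto simp: eventually_sequentially)
      have "(\<Prod>i<n. pmf p (\<omega> i)) \<le> len (path \<omega> n) powr s" if "n \<ge> N" for n
      proof -
        have "(\<Prod>i<n. pmf p (\<omega> i)) = exp (\<Sum>i<n. ln (u (\<omega> i)))" using up by (simp add: exp_sum p)
        moreover have "(\<Sum>i<n. - ln (u (\<omega> i)) - D * lograt (\<omega> i)) = - (\<Sum>i<n. ln (u (\<omega> i))) - D * (\<Sum>i<n. lograt (\<omega> i))"
          by (simp add: sum_subtractf sum_negf sum_distrib_left)
        moreover have "(D - s) * real n \<le> (D - s) * (\<Sum>i<n. lograt (\<omega> i))" using s by (intro mult_left_mono sum_lograt_ge) auto
        ultimately have "(\<Sum>i<n. ln (u (\<omega> i))) \<le> - s * (\<Sum>i<n. lograt (\<omega> i))"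
          using N[OF that] by (simp add: abs_le_iff left_diff_distrib)
        then show ?thesis using \<open>(\<Prod>i<n. pmf p (\<omega> i)) = _\<close> unfolding path_len_exp by (simp add: powr_def)
      qed
      then show "\<exists>N. \<forall>n\<ge>N. (\<Prod>i<n. pmf p (\<omega> i)) \<le> len (path \<omega> n) powr s" by blast
    qed
  qed
  show "spectrum_F (F lam) (1 - \<kappa>) \<ge> ereal D"
  proof -
    have "ereal D \<le> Inf (ereal ` {s. s > 0 \<and> hausdorff_outer s ?E = 0})"
    proof (rule Inf_greatest, elim imageE CollectE conjE)
      fix z s assume "z = ereal s" "0 < s" "hausdorff_outer s ?E = 0"
      then show "ereal D \<le> z" using pos[of s] by (cases "s < D") auto
    qed
    then show ?thesis unfolding spectrum_F_def hdim_def if_not_P[OF ne] .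
  qed
qed

end

section \<open>The Legendre transform\<close>

text \<open>With the inequality as constraint, raising \<open>e\<close> keeps a pair feasible, so
  near-minimisers can be perturbed without solving for a root of \<open>pres\<close>.\<close>

definition Dsp :: "real \<Rightarrow> real \<Rightarrow> real" where
  "Dsp lam \<kappa> = Inf {e - \<kappa> * q |q e. pres lam q e \<le> 1}"

text \<open>\<open>kmax\<close> as a function of the parameter, stated outside the locale so that
  different parameters can be compared.\<close>

definition kmx :: "real \<Rightarrow> real" where "kmx lam = ln (6 * lam + 1) / ln 6"

lemma pres_0_1: "pres lam 0 1 \<le> 1" if "lam > 1/6"
  using that by (simp add: pres_def powr_minus_divide)

lemma tendsto_less_ex:
  fixes f :: "real \<Rightarrow> real"
  assumes "(f \<longlongrightarrow> l) at_top" "l < a"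
  shows "\<exists>x. f x < a"
  using eventually_happens'[OF trivial_limit_at_top_linorder order_tendstoD(2)[OF assms]] .

lemma powr_tendsto_at_top_0: "0 < a \<Longrightarrow> a < 1 \<Longrightarrow> ((\<lambda>x. a powr x) \<longlongrightarrow> 0) at_top" for a :: real
proof -
  assume a: "0 < a" "a < 1"
  have "filterlim (\<lambda>x. ln a * x) at_bot at_top"
    by (rule filterlim_tendsto_neg_mult_at_bot[OF tendsto_const _ filterlim_ident]) (use a in simp)
  then have "((\<lambda>x. exp (ln a * x)) \<longlongrightarrow> 0) at_top" by (rule filterlim_compose[OF exp_at_bot])
  then show ?thesis using a by (simp add: powr_def mult.commute)
qed

context koch
begin

lemma kmx: "kmx lam = kmax" by (simp add: kmx_def kmax_def c_def)

lemma lam_gt_sixth: "lam > 1/6" using c_bounds unfolding c_def by simp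

lemma pres_sum: "pres lam q e = (\<Sum>t<4. exp (q * logmult t - e * lograt t))"
proof -
  have "(c + 1) powr q * 6 powr (-e) = exp (q * ln (c + 1) - e * ln 6)"
    "(c - 1) powr q * 6 powr (-e) = exp (q * ln (c - 1) - e * ln 6)" "3 powr (-e) = exp (- e * ln 3)"
    using c_bounds by (simp_all add: powr_def exp_add[symmetric])
  then show ?thesis unfolding pres_c sum_less_4 by (simp add: logmult_def lograt_def distrib_right)
qed

lemma pres_strict: "e < e' \<Longrightarrow> pres lam q e' < pres lam q e"
  unfolding pres_c using c_bounds
  by (intro add_strict_mono mult_strict_left_mono powr_less_mono add_pos_pos) auto

lemma pres_pos: "pres lam q e > 0"
  unfolding pres_c using c_bounds by (intro add_pos_pos mult_pos_pos) auto

text \<open>Lowering \<open>e\<close> by \<open>\<delta>\<close> multiplies each summand by at most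
  \<open>6 powr \<delta>\<close>, which is chosen as the reciprocal of the pressure.\<close>

lemma pres_slack:
  assumes "pres lam q e < 1"
  obtains \<delta> where "\<delta> > 0" "pres lam q (e - \<delta>) \<le> 1"
proof -
  define \<delta> where "\<delta> = - ln (pres lam q e) / ln 6"
  have d: "\<delta> > 0" using assms pres_pos unfolding \<delta>_def by (simp add: divide_neg_pos)
  have e6: "6 powr \<delta> = 1 / pres lam q e" using pres_pos[of q e] by (simp add: \<delta>_def powr_def exp_minus field_simps)
  have "3 powr (-(e - \<delta>)) = 3 powr (-e) * 3 powr \<delta>" by (simp add: powr_add[symmetric])
  also have "\<dots> \<le> 3 powr (-e) * 6 powr \<delta>" using d by (intro mult_left_mono powr_mono2) auto
  finally have 1: "3 powr (-(e - \<delta>)) \<le> 3 powr (-e) * 6 powr \<delta>" .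
  have 2: "6 powr (-(e - \<delta>)) = 6 powr (-e) * 6 powr \<delta>" by (simp add: powr_add[symmetric])
  have "pres lam q (e - \<delta>) \<le> 2 * (3 powr (-e) * 6 powr \<delta>) + ((c + 1) powr q + (c - 1) powr q) * (6 powr (-e) * 6 powr \<delta>)"
    unfolding pres_c 2 using 1 by simp
  also have "\<dots> = pres lam q e * 6 powr \<delta>" by (simp add: pres_c algebra_simps)
  also have "\<dots> = 1" using e6 pres_pos[of q e] by simp
  finally show ?thesis using d that by blast
qed

text \<open>Each part of the sum is at most 1. The bounds confine feasible pairs: \<open>e\<close>
  from below by the outer children, \<open>q\<close> from above by type 1 when
  \<open>\<kappa> < kmax\<close>, and \<open>q\<close> from below by type 2 when
  \<open>c < 2\<close>.\<close>

lemma feasible_bounds: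
  assumes "pres lam q e \<le> 1"
  shows "ln 2 / ln 3 \<le> e" "kmax * q \<le> e" "q * ln (c - 1) \<le> e * ln 6"
proof -
  have p: "0 < (c + 1) powr q * 6 powr (-e)" "0 < (c - 1) powr q * 6 powr (-e)" "0 < 3 powr (-e)"
    using c_bounds by auto
  have le: "2 * 3 powr (-e) \<le> 1" "(c + 1) powr q * 6 powr (-e) \<le> 1" "(c - 1) powr q * 6 powr (-e) \<le> 1"
    using assms p unfolding pres_c distrib_right by linarith+
  have "ln (2 * 3 powr (-e)) \<le> 0" using le(1) by simp
  then have "ln 2 \<le> e * ln 3" by (simp add: ln_mult ln_powr)
  then show "ln 2 / ln 3 \<le> e" by (simp add: pos_divide_le_eq)
  have "ln ((c + 1) powr q * 6 powr (-e)) \<le> 0" using le(2) c_bounds by simp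
  then have "q * ln (c + 1) \<le> e * ln 6" using c_bounds by (simp add: ln_mult ln_powr)
  then show "kmax * q \<le> e" by (simp add: kmax_def pos_divide_le_eq mult.commute)
  have "ln ((c - 1) powr q * 6 powr (-e)) \<le> 0" using le(3) c_bounds by simp
  then show "q * ln (c - 1) \<le> e * ln 6" using c_bounds by (simp add: ln_mult ln_powr)
qed

lemma feasible_nonneg:
  assumes "pres lam q e \<le> 1" "0 \<le> \<kappa>" "\<kappa> \<le> kmax"
  shows "0 \<le> e - \<kappa> * q"
proof (cases "q \<ge> 0")
  case True
  then have "\<kappa> * q \<le> kmax * q" using assms by (intro mult_right_mono) auto
  then show ?thesis using feasible_bounds(2)[OF assms(1)] by simp
next
  case False
  have "0 < ln 2 / ln (3::real)" by simp
  then have "e \<ge> 0" using feasible_bounds(1)[OF assms(1)] by linarith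
  moreover have "\<kappa> * q \<le> 0" using False assms by (intro mult_nonneg_nonpos) auto
  ultimately show ?thesis by simp
qed

lemma feasible_bdd: "0 \<le> \<kappa> \<Longrightarrow> \<kappa> \<le> kmax \<Longrightarrow> bdd_below {e - \<kappa> * q |q e. pres lam q e \<le> 1}"
  by (rule bdd_belowI[of _ 0]) (auto intro: feasible_nonneg)

lemma feasible_ne: "{e - \<kappa> * q |q e. pres lam q e \<le> 1} \<noteq> {}"
  using pres_0_1[OF lam_gt_sixth] by blast

lemma Dsp_le: "pres lam q e \<le> 1 \<Longrightarrow> 0 \<le> \<kappa> \<Longrightarrow> \<kappa> \<le> kmax \<Longrightarrow> Dsp lam \<kappa> \<le> e - \<kappa> * q"
  unfolding Dsp_def by (rule cInf_lower) (auto intro: feasible_bdd)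

lemma Dsp_ge: "(\<And>q e. pres lam q e \<le> 1 \<Longrightarrow> x \<le> e - \<kappa> * q) \<Longrightarrow> x \<le> Dsp lam \<kappa>"
  unfolding Dsp_def by (rule cInf_greatest[OF feasible_ne]) blast

lemma Dsp_approx:
  assumes "0 \<le> \<kappa>" "\<kappa> \<le> kmax" "Dsp lam \<kappa> < x"
  obtains q e where "pres lam q e \<le> 1" "e - \<kappa> * q < x"
  using assms(3) Dsp_ge[of x \<kappa>] by force

lemma Dsp_range: "0 \<le> \<kappa> \<Longrightarrow> \<kappa> \<le> kmax \<Longrightarrow> 0 \<le> Dsp lam \<kappa> \<and> Dsp lam \<kappa> \<le> 1"
  using Dsp_le[OF pres_0_1[OF lam_gt_sixth], of \<kappa>] Dsp_ge[of 0 \<kappa>] feasible_nonneg by auto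

lemma spectrum_le_Dsp:
  assumes "0 \<le> \<kappa>" "\<kappa> \<le> kmax"
  shows "spectrum_F (F lam) (1 - \<kappa>) \<le> ereal (Dsp lam \<kappa>)"
proof (rule ereal_le_epsilon2)
  fix \<epsilon> :: real assume e: "0 < \<epsilon>"
  have "Dsp lam \<kappa> < Dsp lam \<kappa> + \<epsilon> / 2" using e by simp
  then obtain q e where qe: "pres lam q e \<le> 1" "e - \<kappa> * q < Dsp lam \<kappa> + \<epsilon> / 2"
    using Dsp_approx[OF assms] by blast
  have "pres lam q (e + \<epsilon> / 2) < 1" using pres_strict[of e "e + \<epsilon> / 2" q] qe e by simp
  then have "spectrum_F (F lam) (1 - \<kappa>) \<le> ereal (Dsp lam \<kappa> + \<epsilon>)"
    using qe e Dsp_range[OF assms] by (intro spectrum_le) auto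
  then show "spectrum_F (F lam) (1 - \<kappa>) \<le> ereal (Dsp lam \<kappa>) + ereal \<epsilon>" by simp
qed

text \<open>The Lagrange condition at a minimiser says that the weights \<open>exp (q * logmult t - e * lograt t)\<close>
  have the required mean.\<close>
lemma minimiser_stationary:
  assumes k: "0 \<le> \<kappa>" "\<kappa> \<le> kmax" and m: "pres lam q e \<le> 1" "e - \<kappa> * q = Dsp lam \<kappa>"
  shows "pres lam q e = 1" "(\<Sum>t<4. exp (q * logmult t - e * lograt t) * (logmult t - \<kappa> * lograt t)) = 0"
proof -
  \<comment> \<open>Along this line \<open>e - \<kappa> * q\<close> is constant. A pressure below 1
    on it would leave slack to lower \<open>e\<close>, so \<open>f\<close> has its minimum at
    0.\<close>
  define f where "f x = pres lam (q + x) (e + \<kappa> * x)" for x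
  have f1: "f x \<ge> 1" for x
  proof (rule ccontr)
    assume "\<not> f x \<ge> 1"
    then have "pres lam (q + x) (e + \<kappa> * x) < 1" by (simp add: f_def)
    then obtain \<delta> where d: "\<delta> > 0" "pres lam (q + x) (e + \<kappa> * x - \<delta>) \<le> 1" by (rule pres_slack)
    have "Dsp lam \<kappa> \<le> e + \<kappa> * x - \<delta> - \<kappa> * (q + x)" by (rule Dsp_le[OF d(2) k])
    then show False using d(1) m(2) by (simp add: algebra_simps)
  qed
  show one: "pres lam q e = 1" using f1[of 0] m(1) by (simp add: f_def)
  have f_eq: "f = (\<lambda>x. \<Sum>t<4. exp ((q * logmult t - e * lograt t) + (logmult t - \<kappa> * lograt t) * x))"
    unfolding f_def pres_sum by (intro ext sum.cong refl) (simp add: algebra_simps)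
  have "(f has_field_derivative (\<Sum>t<4. exp (q * logmult t - e * lograt t) * (logmult t - \<kappa> * lograt t))) (at 0)"
    unfolding f_eq by (rule DERIV_sum) (auto intro!: derivative_eq_intros)
  then show "(\<Sum>t<4. exp (q * logmult t - e * lograt t) * (logmult t - \<kappa> * lograt t)) = 0"
    by (rule DERIV_local_min[of _ _ _ 1]) (use f1 one in \<open>auto simp: f_def\<close>)
qed

text \<open>For these weights minus the logarithm is \<open>e * lograt t - q * logmult t\<close>;
  subtracting \<open>(e - \<kappa> * q) * lograt t\<close> leaves \<open>-q\<close> times the mean
  condition, so the entropy condition comes for free.\<close>

lemma spectrum_ge_minimiser:
  assumes k: "0 \<le> \<kappa>" "\<kappa> \<le> kmax" and m: "pres lam q e \<le> 1" "e - \<kappa> * q = Dsp lam \<kappa>"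
  shows "ereal (Dsp lam \<kappa>) \<le> spectrum_F (F lam) (1 - \<kappa>)"
    "{x \<in> {0..1}. hoelder_exp (F lam) x = ereal (1 - \<kappa>)} \<noteq> {}"
proof -
  note st = minimiser_stationary[OF k m]
  have "(\<Sum>t<4. exp (q * logmult t - e * lograt t) * (- ln (exp (q * logmult t - e * lograt t)) - Dsp lam \<kappa> * lograt t))
     = (\<Sum>t<4. - q * (exp (q * logmult t - e * lograt t) * (logmult t - \<kappa> * lograt t)))"
    unfolding m(2)[symmetric] by (intro sum.cong refl) (simp add: algebra_simps)
  also have "\<dots> = - q * (\<Sum>t<4. exp (q * logmult t - e * lograt t) * (logmult t - \<kappa> * lograt t))"
    by (simp only: sum_distrib_left)
  finally have ent: "(\<Sum>t<4. exp (q * logmult t - e * lograt t) * (- ln (exp (q * logmult t - e * lograt t)) - Dsp lam \<kappa> * lograt t)) = 0"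
    using st(2) by simp
  show "ereal (Dsp lam \<kappa>) \<le> spectrum_F (F lam) (1 - \<kappa>)"
    "{x \<in> {0..1}. hoelder_exp (F lam) x = ereal (1 - \<kappa>)} \<noteq> {}"
    using spectrum_ge[OF _ _ k st(2) ent] st(1) unfolding pres_sum by auto
qed

text \<open>The feasible pairs of value at most 1, a nonempty set through \<open>(0, 1)\<close>, are
  compact. Boundedness of \<open>q\<close> from below comes from \<open>e > 0\<close> when
  \<open>\<kappa> > 0\<close>, and from \<open>ln (c - 1) < 0\<close> when
  \<open>\<kappa> = 0\<close>.\<close>

lemma minimiser_exists:
  assumes k: "0 \<le> \<kappa>" "\<kappa> < kmax" and nd: "0 < \<kappa> \<or> c < 2"
  obtains q e where "pres lam q e \<le> 1" "e - \<kappa> * q = Dsp lam \<kappa>"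
proof -
  define S where "S = {z :: real \<times> real. pres lam (fst z) (snd z) \<le> 1 \<and> snd z - \<kappa> * fst z \<le> 1}"
  have cl: "closed S" unfolding S_def pres_sum
    by (intro closed_Collect_conj closed_Collect_le continuous_intros)
  obtain Q where Q: "\<And>q e. pres lam q e \<le> 1 \<Longrightarrow> e - \<kappa> * q \<le> 1 \<Longrightarrow> - Q \<le> q"
  proof (cases "\<kappa> > 0")
    case True
    have "- (1 / \<kappa>) \<le> q" if f: "pres lam q e \<le> 1" "e - \<kappa> * q \<le> 1" for q e
    proof -
      have "0 < ln 2 / ln (3::real)" by simp
      then have "e > 0" using feasible_bounds(1)[OF f(1)] by linarith
      then have "- 1 \<le> \<kappa> * q" using f(2) by simp
      then show ?thesis using True by (simp add: field_simps)
    qed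
    then show ?thesis using that by blast
  next
    case False
    then have k0: "\<kappa> = 0" and c2: "c < 2" using k nd by auto
    then have neg: "ln (c - 1) < 0" using c_bounds by simp
    have "- (ln 6 / - ln (c - 1)) \<le> q" if f: "pres lam q e \<le> 1" "e - \<kappa> * q \<le> 1" for q e
    proof -
      have "e \<le> 1" using f(2) k0 by simp
      then have "e * ln 6 \<le> 1 * ln 6" by (intro mult_right_mono) auto
      then have "q * ln (c - 1) \<le> ln 6" using feasible_bounds(3)[OF f(1)] by linarith
      then show ?thesis using neg by (simp add: field_simps)
    qed
    then show ?thesis using that by blast
  qed
  define T where "T = 1 / (kmax - \<kappa>)"
  have T: "q \<le> T" if f: "pres lam q e \<le> 1" "e - \<kappa> * q \<le> 1" for q e
  proof -
    have "(kmax - \<kappa>) * q \<le> 1" using feasible_bounds(2)[OF f(1)] f(2) by (simp add: algebra_simps)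
    then show ?thesis unfolding T_def using k by (simp add: field_simps)
  qed
  have sub: "S \<subseteq> {-Q..T} \<times> {0..1 + \<kappa> * T}"
  proof
    fix z assume z: "z \<in> S"
    obtain q e where qe: "z = (q, e)" by (cases z)
    have f: "pres lam q e \<le> 1" "e - \<kappa> * q \<le> 1" using z unfolding S_def qe by auto
    have "0 < ln 2 / ln (3::real)" by simp
    then have "e \<ge> 0" using feasible_bounds(1)[OF f(1)] by linarith
    moreover have "\<kappa> * q \<le> \<kappa> * T" using T[OF f] k by (intro mult_left_mono) auto
    ultimately show "z \<in> {-Q..T} \<times> {0..1 + \<kappa> * T}" using Q[OF f] T[OF f] f(2) unfolding qe by auto
  qed
  have "compact ({-Q..T} \<times> {0..1 + \<kappa> * T})" by (intro compact_Times) auto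
  then have comp: "compact S" using cl sub by (metis compact_Int_closed inf.absorb_iff2)
  have in01: "(0, 1) \<in> S" using pres_0_1[OF lam_gt_sixth] by (simp add: S_def)
  have "\<exists>z\<in>S. \<forall>w\<in>S. snd z - \<kappa> * fst z \<le> snd w - \<kappa> * fst w"
    by (rule continuous_attains_inf[OF comp]) (use in01 in \<open>auto intro!: continuous_intros\<close>)
  then obtain q e where z: "(q, e) \<in> S" "\<And>q' e'. (q', e') \<in> S \<Longrightarrow> e - \<kappa> * q \<le> e' - \<kappa> * q'" by fastforce
  have f: "pres lam q e \<le> 1" using z(1) by (simp add: S_def)
  have "e - \<kappa> * q \<le> e' - \<kappa> * q'" if f': "pres lam q' e' \<le> 1" for q' e'
  proof (cases "e' - \<kappa> * q' \<le> 1")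
    case True
    then show ?thesis using z(2) f' by (simp add: S_def)
  next
    case False
    then show ?thesis using z(1) by (simp add: S_def)
  qed
  then have "e - \<kappa> * q \<le> Dsp lam \<kappa>" by (rule Dsp_ge)
  moreover have "Dsp lam \<kappa> \<le> e - \<kappa> * q" using k by (intro Dsp_le f) auto
  ultimately show ?thesis using that f by simp
qed

text \<open>On \<open>e = kmax * q + \<epsilon>\<close> type 1 contributes exactly
  \<open>6 powr (-\<epsilon>)\<close> and the other types vanish as \<open>q\<close> tends to
  infinity. The infimum is a limit and not a minimum.\<close>

lemma Dsp_kmax: "Dsp lam kmax = 0"
proof (rule antisym)
  show "0 \<le> Dsp lam kmax" using Dsp_range kmax by auto
  show "Dsp lam kmax \<le> 0"
  proof (rule field_le_epsilon)
    fix \<epsilon> :: real assume e: "\<epsilon> > 0"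
    define a where "a = 3 powr (- kmax)"
    define b where "b = (c - 1) / (c + 1)"
    have a: "0 < a" "a < 1" using kmax by (auto simp: a_def powr_less_one)
    have b: "0 < b" "b < 1" using c_bounds by (auto simp: b_def)
    have eq: "pres lam q (kmax * q + \<epsilon>) = 2 * (a powr q * 3 powr (-\<epsilon>)) + (1 + b powr q) * 6 powr (-\<epsilon>)" for q
    proof -
      have A: "3 powr (- (kmax * q + \<epsilon>)) = a powr q * 3 powr (-\<epsilon>)" by (simp add: a_def powr_powr powr_add[symmetric])
      have B: "6 powr (- (kmax * q + \<epsilon>)) = 6 powr (-\<epsilon>) / (6 powr kmax) powr q"
        by (simp add: powr_powr powr_diff[symmetric] algebra_simps)
      have C: "((c + 1) powr q + (c - 1) powr q) / (c + 1) powr q = 1 + b powr q"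
        using c_bounds by (simp add: b_def powr_divide field_simps)
      show ?thesis unfolding pres_c A B kmax(3) C[symmetric] by simp
    qed
    have "((\<lambda>q. 2 * (a powr q * 3 powr (-\<epsilon>)) + (1 + b powr q) * 6 powr (-\<epsilon>)) \<longlongrightarrow> 2 * (0 * 3 powr (-\<epsilon>)) + (1 + 0) * 6 powr (-\<epsilon>)) at_top"
      by (intro tendsto_add tendsto_mult tendsto_const powr_tendsto_at_top_0 a b)
    moreover have "2 * (0 * 3 powr (-\<epsilon>)) + (1 + 0) * 6 powr (-\<epsilon>) < (1::real)" using e by (simp add: powr_less_one)
    ultimately obtain q where "pres lam q (kmax * q + \<epsilon>) < 1" using tendsto_less_ex unfolding eq by fastforce
    then have "Dsp lam kmax \<le> (kmax * q + \<epsilon>) - kmax * q" using kmax by (intro Dsp_le) auto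
    then show "Dsp lam kmax \<le> 0 + \<epsilon>" by simp
  qed
qed

text \<open>As \<open>q\<close> tends to minus infinity, types 1 and 2 disappear from the pressure,
  except that type 2 has factor \<open>c - 1 = 1\<close> and survives when
  \<open>c = 2\<close>.\<close>

lemma Dsp_0_le:
  assumes "c \<ge> 2" and s: "2 * 3 powr (-s) + (if c = 2 then 6 powr (-s) else 0) \<le> 1"
  shows "Dsp lam 0 \<le> s"
proof (rule field_le_epsilon)
  fix \<epsilon> :: real assume e: "\<epsilon> > 0"
  let ?l = "2 * 3 powr (-(s + \<epsilon>)) + (if c = 2 then 6 powr (-(s + \<epsilon>)) else 0)"
  have l: "?l < 1"
  proof -
    have "3 powr (-(s + \<epsilon>)) < 3 powr (-s)" "6 powr (-(s + \<epsilon>)) < 6 powr (-s)"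
      by (rule powr_less_mono; use e in simp)+
    then have "?l < 2 * 3 powr (-s) + (if c = 2 then 6 powr (-s) else 0)" 
      by (cases "c = 2"; simp only: if_True if_False simp_thms; linarith)
    then show ?thesis using s by linarith
  qed
  have lim: "((\<lambda>q. (c - 1) powr (-q)) \<longlongrightarrow> (if c = 2 then 1 else 0)) at_top"
  proof (cases "c = 2")
    case False
    then have "0 < 1 / (c - 1)" "1 / (c - 1) < 1" using assms by auto
    from powr_tendsto_at_top_0[OF this] show ?thesis using False assms by (simp add: powr_divide powr_minus_divide)
  qed simp
  have "0 < 1 / (c + 1)" "1 / (c + 1) < 1" using c_bounds by auto
  from powr_tendsto_at_top_0[OF this] have "((\<lambda>q. (c + 1) powr (-q)) \<longlongrightarrow> 0) at_top"
    using c_bounds by (simp add: powr_divide powr_minus_divide)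
  then have "((\<lambda>q. pres lam (-q) (s + \<epsilon>)) \<longlongrightarrow> 2 * 3 powr (-(s + \<epsilon>)) + (0 + (if c = 2 then 1 else 0)) * 6 powr (-(s + \<epsilon>))) at_top"
    unfolding pres_c by (intro tendsto_add tendsto_mult tendsto_const lim)
  moreover have "2 * 3 powr (-(s + \<epsilon>)) + (0 + (if c = 2 then 1 else 0)) * 6 powr (-(s + \<epsilon>)) < 1"
    using l by (cases "c = 2") simp_all
  ultimately obtain q where "pres lam (-q) (s + \<epsilon>) < 1" using tendsto_less_ex by fastforce
  then have "Dsp lam 0 \<le> (s + \<epsilon>) - 0 * (-q)" using kmax by (intro Dsp_le) auto
  then show "Dsp lam 0 \<le> s + \<epsilon>" by simp
qed

text \<open>The weights \<open>r powr s\<close> on the surviving types keep the slope at rate 0 and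
  have entropy over Lyapunov exponent \<open>s\<close>. The lower bound of the spectrum then closes
  the circle of inequalities.\<close>

lemma spectrum_eq_Dsp_0:
  assumes c2: "c \<ge> 2" and s: "2 * 3 powr (-s) + (if c = 2 then 6 powr (-s) else 0) = 1"
  shows "Dsp lam 0 = s" "spectrum_F (F lam) 1 = ereal (Dsp lam 0)"
    "{x \<in> {0..1}. hoelder_exp (F lam) x = ereal 1} \<noteq> {}"
proof -
  define v where "v t = (if t = 0 \<or> t = 3 then 3 powr (-s) else if t = 2 \<and> c = 2 then 6 powr (-s) else 0)" for t :: nat
  have 1: "(\<Sum>t<4. v t) = 1" using s unfolding sum_less_4 v_def by (auto split: if_splits)
  have 2: "(\<Sum>t<4. v t * (logmult t - 0 * lograt t)) = 0" unfolding sum_less_4 v_def logmult_def by simp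
  have 3: "(\<Sum>t<4. v t * (- ln (v t) - s * lograt t)) = 0" unfolding sum_less_4 v_def lograt_def by (simp add: ln_powr)
  have k: "0 \<le> (0::real)" "0 \<le> kmax" using kmax by auto
  have ge: "ereal s \<le> spectrum_F (F lam) 1" "{x \<in> {0..1}. hoelder_exp (F lam) x = ereal 1} \<noteq> {}"
    using spectrum_ge[OF _ 1 k 2 3] by (auto simp: v_def)
  have le: "spectrum_F (F lam) 1 \<le> ereal (Dsp lam 0)" using spectrum_le_Dsp[OF k] by simp
  have "Dsp lam 0 \<le> s" using c2 s by (intro Dsp_0_le) auto
  moreover have "s \<le> Dsp lam 0" using order_trans[OF ge(1) le] by simp
  ultimately show "Dsp lam 0 = s" by simp
  then show "spectrum_F (F lam) 1 = ereal (Dsp lam 0)" using ge(1) le by (intro antisym) auto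
  show "{x \<in> {0..1}. hoelder_exp (F lam) x = ereal 1} \<noteq> {}" by (rule ge)
qed

text \<open>The similarity dimension for ratios 1/3, 1/3, 1/6 exceeds that of the middle-third
  Cantor set; this gap becomes the discontinuity.\<close>

lemma moran_exponents:
  obtains s where "2 * 3 powr (-s) + 6 powr (-s) = (1::real)" "ln 2 / ln 3 < s"
proof -
  have two: "2 * 3 powr (- (ln 2 / ln 3)) = (1::real)" by (simp add: powr_def exp_minus)
  have "\<exists>s\<ge>ln 2 / ln 3. s \<le> 1 \<and> 2 * 3 powr (-s) + 6 powr (-s) = (1::real)"
  proof (rule IVT2')
    show "2 * 3 powr (- 1) + 6 powr (- 1) \<le> (1::real)" by (simp add: powr_minus_divide)
    show "1 \<le> 2 * 3 powr (- (ln 2 / ln 3)) + 6 powr (- (ln 2 / ln (3::real)))" unfolding two by simp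
    show "ln 2 / ln 3 \<le> (1::real)" by simp
  qed (intro continuous_intros; simp)
  then obtain s where s: "ln 2 / ln 3 \<le> s" "2 * 3 powr (-s) + 6 powr (-s) = (1::real)" by blast
  have "s \<noteq> ln 2 / ln 3"
  proof
    assume "s = ln 2 / ln 3"
    then have "6 powr (-s) = 0" using s(2) two by simp
    then show False by simp
  qed
  then show ?thesis using that s by force
qed

lemma Dsp_0:
  "c > 2 \<Longrightarrow> Dsp lam 0 = ln 2 / ln 3" "c = 2 \<Longrightarrow> Dsp lam 0 > ln 2 / ln 3"
  "c \<ge> 2 \<Longrightarrow> spectrum_F (F lam) 1 = ereal (Dsp lam 0)"
  "c \<ge> 2 \<Longrightarrow> {x \<in> {0..1}. hoelder_exp (F lam) x = ereal 1} \<noteq> {}"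
proof -
  have two: "2 * 3 powr (- (ln 2 / ln 3)) = (1::real)" by (simp add: powr_def exp_minus)
  obtain s where s: "2 * 3 powr (-s) + 6 powr (-s) = (1::real)" "ln 2 / ln 3 < s" by (rule moran_exponents)
  show "c > 2 \<Longrightarrow> Dsp lam 0 = ln 2 / ln 3" using spectrum_eq_Dsp_0(1)[of "ln 2 / ln 3"] two by simp
  show "c = 2 \<Longrightarrow> Dsp lam 0 > ln 2 / ln 3" using spectrum_eq_Dsp_0(1)[of s] s by simp
  have "\<exists>s. 2 * 3 powr (-s) + (if c = 2 then 6 powr (-s) else 0) = (1::real)"
    using s(1) two by (cases "c = 2") auto
  then show "c \<ge> 2 \<Longrightarrow> spectrum_F (F lam) 1 = ereal (Dsp lam 0)"
    "c \<ge> 2 \<Longrightarrow> {x \<in> {0..1}. hoelder_exp (F lam) x = ereal 1} \<noteq> {}"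
    using spectrum_eq_Dsp_0 by blast+
qed

text \<open>A point mass on the constant address of type 1 has entropy 0 and slope rate
  \<open>kmax\<close>.\<close>

lemma spectrum_kmax:
  "ereal 0 \<le> spectrum_F (F lam) (1 - kmax)" "{x \<in> {0..1}. hoelder_exp (F lam) x = ereal (1 - kmax)} \<noteq> {}"
proof -
  define v where "v t = (if t = 1 then 1 else 0 :: real)" for t :: nat
  have 1: "(\<Sum>t<4. v t) = 1" unfolding sum_less_4 v_def by simp
  have 2: "(\<Sum>t<4. v t * (logmult t - kmax * lograt t)) = 0"
    unfolding sum_less_4 v_def by (simp add: logmult_def lograt_def kmax_def)
  have 3: "(\<Sum>t<4. v t * (- ln (v t) - 0 * lograt t)) = 0" unfolding sum_less_4 v_def by simp
  have k: "0 \<le> kmax" "kmax \<le> kmax" using kmax by auto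
  show "ereal 0 \<le> spectrum_F (F lam) (1 - kmax)" "{x \<in> {0..1}. hoelder_exp (F lam) x = ereal (1 - kmax)} \<noteq> {}"
    using spectrum_ge[OF _ 1 k 2 3] by (auto simp: v_def)
qed

lemma spectrum_Dsp:
  assumes k: "0 \<le> \<kappa>" "\<kappa> \<le> kmax"
  shows "spectrum_F (F lam) (1 - \<kappa>) = ereal (Dsp lam \<kappa>)" "{x \<in> {0..1}. hoelder_exp (F lam) x = ereal (1 - \<kappa>)} \<noteq> {}"
proof -
  have "ereal (Dsp lam \<kappa>) \<le> spectrum_F (F lam) (1 - \<kappa>) \<and> {x \<in> {0..1}. hoelder_exp (F lam) x = ereal (1 - \<kappa>)} \<noteq> {}"
  proof -
    consider "\<kappa> = kmax" | "\<kappa> < kmax" "0 < \<kappa> \<or> c < 2" | "\<kappa> = 0" "c \<ge> 2" using k by linarith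
    then show ?thesis
    proof cases
      case 1
      then show ?thesis using spectrum_kmax Dsp_kmax by simp
    next
      case 2
      obtain q e where "pres lam q e \<le> 1" "e - \<kappa> * q = Dsp lam \<kappa>" by (rule minimiser_exists[OF k(1) 2])
      then show ?thesis using spectrum_ge_minimiser[OF k] by blast
    next
      case 3
      then show ?thesis using Dsp_0(3,4) by simp
    qed
  qed
  then show "spectrum_F (F lam) (1 - \<kappa>) = ereal (Dsp lam \<kappa>)" "{x \<in> {0..1}. hoelder_exp (F lam) x = ereal (1 - \<kappa>)} \<noteq> {}"
    using spectrum_le_Dsp[OF k] by (auto intro: antisym)
qed

text \<open>An infimum of affine functions is concave. Equality would make the minimiser at the
  interior point minimal at \<open>x\<close> and \<open>y\<close> too; subtracting the two
  stationarity conditions gives \<open>(y - x)\<close> times a positive mean of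
  \<open>lograt\<close> equal to 0.\<close>

lemma Dsp_strict_concave:
  assumes x: "0 \<le> x" "x \<le> kmax" and y: "0 \<le> y" "y \<le> kmax" and "x \<noteq> y" "0 < t" "t < 1"
  shows "t * Dsp lam x + (1 - t) * Dsp lam y < Dsp lam (t * x + (1 - t) * y)"
proof -
  let ?k = "t * x + (1 - t) * y"
  have k: "0 < ?k" "?k < kmax"
  proof -
    show "0 < ?k"
    proof (cases "x = 0")
      case True
      then show ?thesis using assms by simp
    next
      case False
      then show ?thesis using assms by (intro add_pos_nonneg mult_pos_pos mult_nonneg_nonneg) auto
    qed
    have "0 < t * (kmax - x) + (1 - t) * (kmax - y)"
    proof (cases "x = kmax")
      case True
      then show ?thesis using assms by simp
    next
      case False
      then show ?thesis using assms by (intro add_pos_nonneg mult_pos_pos mult_nonneg_nonneg) auto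
    qed
    then show "?k < kmax" by (simp add: algebra_simps)
  qed
  obtain q e where m: "pres lam q e \<le> 1" "e - ?k * q = Dsp lam ?k"
    by (rule minimiser_exists[OF less_imp_le[OF k(1)] k(2) disjI1[OF k(1)]])
  have dx: "Dsp lam x \<le> e - x * q" by (rule Dsp_le[OF m(1) x])
  have dy: "Dsp lam y \<le> e - y * q" by (rule Dsp_le[OF m(1) y])
  have D: "Dsp lam ?k = t * (e - x * q) + (1 - t) * (e - y * q)" unfolding m(2)[symmetric] by (simp add: algebra_simps)
  have ex: "\<not> (e - x * q = Dsp lam x \<and> e - y * q = Dsp lam y)"
  proof
    assume a: "e - x * q = Dsp lam x \<and> e - y * q = Dsp lam y"
    let ?v = "\<lambda>t. exp (q * logmult t - e * lograt t)"
    have "(\<Sum>t<4. ?v t * (logmult t - x * lograt t)) = 0" "(\<Sum>t<4. ?v t * (logmult t - y * lograt t)) = 0"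
      using minimiser_stationary(2)[OF x m(1)] minimiser_stationary(2)[OF y m(1)] a by auto
    then have "(\<Sum>t<4. ?v t * (logmult t - x * lograt t)) - (\<Sum>t<4. ?v t * (logmult t - y * lograt t)) = 0" by simp
    then have "(\<Sum>t<4. (y - x) * (?v t * lograt t)) = 0"
      unfolding sum_subtractf[symmetric] by (simp add: algebra_simps)
    then have "(y - x) * (\<Sum>t<4. ?v t * lograt t) = 0" by (simp only: sum_distrib_left)
    moreover have "(\<Sum>t<4. ?v t * lograt t) > 0"
      unfolding sum_less_4 by (intro add_pos_pos mult_pos_pos exp_gt_zero less_le_trans[OF zero_less_one lograt_ge_1])
    ultimately show False using assms(5) by simp
  qed
  have "t * Dsp lam x \<le> t * (e - x * q)" "(1 - t) * Dsp lam y \<le> (1 - t) * (e - y * q)"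
    using dx dy assms by (auto intro: mult_left_mono)
  moreover have "t * Dsp lam x < t * (e - x * q) \<or> (1 - t) * Dsp lam y < (1 - t) * (e - y * q)"
    using dx dy ex assms by (auto simp: less_le)
  ultimately show ?thesis unfolding D by linarith
qed

text \<open>\<open>\<kappa>\<close> is the mean of \<open>logmult\<close> divided by the mean of
  \<open>lograt\<close> under the weights 1/3, 1/6, 1/6, 1/3 of Lebesgue measure; it is nonnegative
  since \<open>c\<^sup>2 - 1 > 1\<close>. The tangent bound \<open>exp x \<ge> 1 + x\<close> gives
  pressure at least 1 on the line \<open>e = 1 + \<kappa> * q\<close>.\<close>

lemma Dsp_max:
  defines "\<kappa> \<equiv> ln (c\<^sup>2 - 1) / (4 * ln 3 + 2 * ln 6)"
  shows "0 \<le> \<kappa>" "\<kappa> \<le> kmax" "Dsp lam \<kappa> = 1"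
proof -
  have pos: "4 * ln 3 + 2 * ln 6 > (0::real)" by (intro add_pos_pos) auto
  have ln2: "ln (c\<^sup>2 - 1) = ln (c + 1) + ln (c - 1)"
  proof -
    have "c\<^sup>2 - 1 = (c + 1) * (c - 1)" by (simp add: power2_eq_square algebra_simps)
    then show ?thesis using c_bounds by (simp add: ln_mult)
  qed
  show k0: "0 \<le> \<kappa>" unfolding \<kappa>_def using pos c_bounds by (intro divide_nonneg_pos) auto
  show k1: "\<kappa> \<le> kmax"
  proof -
    have "ln (c\<^sup>2 - 1) \<le> 2 * ln (c + 1)" using c_bounds unfolding ln2 by simp
    then have "\<kappa> \<le> 2 * ln (c + 1) / (4 * ln 3 + 2 * ln 6)" unfolding \<kappa>_def using pos by (intro divide_right_mono) auto
    also have "\<dots> \<le> 2 * ln (c + 1) / (2 * ln 6)" using c_bounds pos by (intro divide_left_mono) (auto intro: mult_pos_pos)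
    finally show ?thesis by (simp add: kmax_def)
  qed
  have mean: "(\<Sum>t<4. exp (- lograt t) * (logmult t - \<kappa> * lograt t)) = 0"
  proof -
    have e: "exp (- ln 3) = (1/3::real)" "exp (- ln 6) = (1/6::real)" by (simp_all add: exp_minus)
    have "\<kappa> * (4 * ln 3 + 2 * ln 6) = ln (c + 1) + ln (c - 1)" unfolding \<kappa>_def using pos ln2 by simp
    then show ?thesis unfolding sum_less_4 by (simp add: lograt_def logmult_def e field_simps)
  qed
  have "1 \<le> e - \<kappa> * q" if f: "pres lam q e \<le> 1" for q e
  proof (rule ccontr)
    assume "\<not> ?thesis"
    then have "e < 1 + \<kappa> * q" by simp
    then have "pres lam q (1 + \<kappa> * q) < 1" using pres_strict[of e "1 + \<kappa> * q" q] f by simp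
    moreover have "1 \<le> pres lam q (1 + \<kappa> * q)"
    proof -
      have "(\<Sum>t<4. exp (- lograt t)) = 1" unfolding sum_less_4 by (simp add: lograt_def exp_minus)
      then have "1 = (\<Sum>t<4. exp (- lograt t)) + q * (\<Sum>t<4. exp (- lograt t) * (logmult t - \<kappa> * lograt t))"
        using mean by simp
      also have "\<dots> = (\<Sum>t<4. exp (- lograt t) * (1 + q * (logmult t - \<kappa> * lograt t)))"
        unfolding sum_distrib_left sum.distrib[symmetric] by (intro sum.cong refl) (simp add: algebra_simps)
      also have "\<dots> \<le> (\<Sum>t<4. exp (- lograt t) * exp (q * (logmult t - \<kappa> * lograt t)))"
        by (intro sum_mono mult_left_mono exp_ge_add_one_self) simp
      also have "\<dots> = pres lam q (1 + \<kappa> * q)"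
        unfolding pres_sum exp_add[symmetric] by (intro sum.cong refl) (simp add: algebra_simps)
      finally show ?thesis .
    qed
    ultimately show False by simp
  qed
  then have "1 \<le> Dsp lam \<kappa>" by (rule Dsp_ge)
  then show "Dsp lam \<kappa> = 1" using Dsp_range[OF k0 k1] by simp
qed

lemma pres_root: "\<exists>e. pres lam q e = 1"
proof -
  \<comment> \<open>The pressure with all ratios replaced by 1/3 would be
    \<open>X * 3 powr (-e)\<close>, which gives an explicit \<open>e1\<close> with pressure at most
    1.\<close>
  define X where "X = 2 + ((c + 1) powr q + (c - 1) powr q)"
  have X: "X \<ge> 2" by (simp add: X_def)
  define e1 where "e1 = ln X / ln 3"
  have e1: "e1 \<ge> 0" "3 powr (- e1) = 1 / X" using X by (auto simp: e1_def powr_def exp_minus inverse_eq_divide)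
  have "6 powr (- e1) \<le> 3 powr (- e1)" using e1 by (intro powr_mono2') auto
  then have "pres lam q e1 \<le> 2 * 3 powr (- e1) + ((c + 1) powr q + (c - 1) powr q) * 3 powr (- e1)"
    unfolding pres_c by (intro add_left_mono mult_left_mono) auto
  also have "\<dots> = X * 3 powr (- e1)" by (simp add: X_def algebra_simps)
  also have "\<dots> = 1" using e1 X by simp
  finally have a: "pres lam q e1 \<le> 1" .
  have b: "1 \<le> pres lam q 0" by (simp add: pres_c)
  have "continuous_on {0..e1} (pres lam q)" unfolding pres_sum by (intro continuous_intros)
  then show ?thesis using IVT2'[OF a b e1(1)] by blast
qed

lemma tau_sum: "(\<Sum>i<4. pw lam i powr q * rt i powr (- t)) = pres lam q (gam lam * q - t)"
proof -
  let ?g = "gam lam"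
  have r: "(1/3) powr (- t) = 3 powr t" "(1/6) powr (- t) = (6::real) powr t"
    by (simp_all add: powr_minus powr_divide)
  have a: "((c + 1) * 6 powr (- ?g)) powr q * 6 powr t = (c + 1) powr q * 6 powr (- (?g * q - t))"
    "((c - 1) * 6 powr (- ?g)) powr q * 6 powr t = (c - 1) powr q * 6 powr (- (?g * q - t))"
    "(3 powr (- ?g)) powr q * 3 powr t = 3 powr (- (?g * q - t))"
    using c_bounds by (simp_all add: powr_mult powr_powr powr_add[symmetric] mult.assoc)
  show ?thesis unfolding sum_less_4 pres_c using a
    by (simp add: pw_def rt_def r c_def distrib_right)
qed

lemma tau_eq: "pres lam q (gam lam * q - tau lam q) = 1"
proof -
  obtain e where e: "pres lam q e = 1" using pres_root by blast
  have "\<exists>!t. pres lam q (gam lam * q - t) = 1"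
  proof (rule ex1I[of _ "gam lam * q - e"])
    fix t assume t: "pres lam q (gam lam * q - t) = 1"
    show "t = gam lam * q - e"
      using pres_strict[of e "gam lam * q - t" q] pres_strict[of "gam lam * q - t" e q] e t
      by (cases "gam lam * q - t" e rule: linorder_cases) auto
  qed (use e in simp)
  then show ?thesis unfolding tau_def tau_sum by (rule theI')
qed

text \<open>For each \<open>q\<close>, \<open>gam lam * q - tau lam q\<close> is the smallest
  feasible \<open>e\<close>, so passing from roots to feasible pairs does not change the
  infimum.\<close>

lemma tau_star_Dsp:
  assumes k: "0 \<le> \<kappa>" "\<kappa> \<le> kmax"
  shows "tau_star lam (1 - \<kappa> + gam lam - 1) = ereal (Dsp lam \<kappa>)"
  unfolding tau_star_def
proof (rule antisym)
  have f: "(1 - \<kappa> + gam lam - 1) * q - tau lam q = (gam lam * q - tau lam q) - \<kappa> * q" for q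
    by (simp add: algebra_simps)
  show "ereal (Dsp lam \<kappa>) \<le> (INF q. ereal ((1 - \<kappa> + gam lam - 1) * q - tau lam q))"
  proof (rule INF_greatest)
    fix q show "ereal (Dsp lam \<kappa>) \<le> ereal ((1 - \<kappa> + gam lam - 1) * q - tau lam q)"
      using Dsp_le[OF _ k, of q "gam lam * q - tau lam q"] tau_eq unfolding f by simp
  qed
  show "(INF q. ereal ((1 - \<kappa> + gam lam - 1) * q - tau lam q)) \<le> ereal (Dsp lam \<kappa>)"
  proof (rule ereal_le_epsilon2)
    fix \<epsilon> :: real assume "0 < \<epsilon>"
    then have "Dsp lam \<kappa> < Dsp lam \<kappa> + \<epsilon>" by simp
    then obtain q e where qe: "pres lam q e \<le> 1" "e - \<kappa> * q < Dsp lam \<kappa> + \<epsilon>" by (rule Dsp_approx[OF k])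
    have "gam lam * q - tau lam q \<le> e"
    proof (rule ccontr)
      assume "\<not> ?thesis"
      then have "pres lam q (gam lam * q - tau lam q) < pres lam q e" by (intro pres_strict) simp
      then show False using tau_eq[of q] qe(1) by simp
    qed
    then have "ereal ((1 - \<kappa> + gam lam - 1) * q - tau lam q) \<le> ereal (Dsp lam \<kappa> + \<epsilon>)" using qe(2) unfolding f by simp
    then show "(INF q. ereal ((1 - \<kappa> + gam lam - 1) * q - tau lam q)) \<le> ereal (Dsp lam \<kappa>) + ereal \<epsilon>"
      by (intro INF_lower2[of q]) auto
  qed
qed

end

section \<open>Dependence on the parameter\<close>

lemma kmx_bounds:
  assumes "koch lam"
  shows "0 < kmx lam" "kmx lam < 1" "alpha_min lam = 1 - kmx lam"
  using koch.kmax[OF assms] koch.kmx[OF assms] by simp_all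

lemma koch_pos: "koch lam \<Longrightarrow> 0 < 6 * lam - 1"
  using koch.lam_gt_sixth[of lam] by simp

text \<open>Moving the logarithms of the slope factors by \<open>\<eta>\<close> costs a factor
  \<open>exp (\<bar>q\<bar> * \<eta>)\<close>. Raising \<open>e\<close> by
  \<open>\<bar>q\<bar> * \<eta> / ln 3\<close> gains that factor at ratio 1/3, and more at ratio
  1/6.\<close>

lemma pres_perturb:
  assumes k: "koch lam" "koch lam'"
    and \<eta>: "\<bar>ln (6 * lam' + 1) - ln (6 * lam + 1)\<bar> \<le> \<eta>" "\<bar>ln (6 * lam' - 1) - ln (6 * lam - 1)\<bar> \<le> \<eta>"
    and f: "pres lam q e \<le> 1"
  shows "pres lam' q (e + \<bar>q\<bar> * \<eta> / ln 3) \<le> 1"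
proof -
  define \<delta> where "\<delta> = \<bar>q\<bar> * \<eta> / ln 3"
  define E where "E = exp (\<bar>q\<bar> * \<eta>)"
  have "\<eta> \<ge> 0" using \<eta>(1) by linarith
  then have d: "\<delta> \<ge> 0" by (simp add: \<delta>_def)
  have c1: "b powr q \<le> a powr q * E" if "0 < a" "0 < b" "\<bar>ln b - ln a\<bar> \<le> \<eta>" for a b
  proof -
    have "q * (ln b - ln a) \<le> \<bar>q\<bar> * \<eta>"
      using mult_left_mono[OF that(3), of "\<bar>q\<bar>"] abs_ge_self[of "q * (ln b - ln a)"] by (simp add: abs_mult)
    then show ?thesis using that by (simp add: powr_def E_def exp_add[symmetric] algebra_simps)
  qed
  have p: "0 < 6 * lam - 1" "0 < 6 * lam' - 1" using koch_pos k by auto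
  have S: "(6 * lam' + 1) powr q + (6 * lam' - 1) powr q \<le> ((6 * lam + 1) powr q + (6 * lam - 1) powr q) * E"
    using c1[OF _ _ \<eta>(1)] c1[OF _ _ \<eta>(2)] p unfolding distrib_right by (intro add_mono) auto
  have "3 powr (- \<delta>) = exp (- (\<bar>q\<bar> * \<eta>))" by (simp add: powr_def \<delta>_def)
  then have t3: "3 powr (- \<delta>) = 1 / E" by (simp add: E_def exp_minus inverse_eq_divide)
  have "6 powr (- \<delta>) \<le> 3 powr (- \<delta>)" using d by (intro powr_mono2') auto
  then have t6: "6 powr (- \<delta>) * E \<le> 1" using t3 by (simp add: E_def pos_le_divide_eq)
  have t31: "3 powr (- \<delta>) \<le> 1" using powr_mono[of "-\<delta>" 0 3] d by simp
  have "pres lam' q (e + \<delta>) = 2 * (3 powr (-e) * 3 powr (- \<delta>)) + ((6 * lam' + 1) powr q + (6 * lam' - 1) powr q) * (6 powr (-e) * 6 powr (- \<delta>))"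
    by (simp add: pres_def powr_add[symmetric])
  also have "\<dots> \<le> 2 * (3 powr (-e) * 1) + (((6 * lam + 1) powr q + (6 * lam - 1) powr q) * E) * (6 powr (-e) * 6 powr (- \<delta>))"
    using S t31 by (intro add_mono mult_left_mono mult_right_mono) auto
  also have "\<dots> = 2 * 3 powr (-e) + ((6 * lam + 1) powr q + (6 * lam - 1) powr q) * 6 powr (-e) * (6 powr (- \<delta>) * E)"
    by simp
  also have "\<dots> \<le> 2 * 3 powr (-e) + ((6 * lam + 1) powr q + (6 * lam - 1) powr q) * 6 powr (-e) * 1"
    using t6 by (intro add_left_mono mult_left_mono) auto
  also have "\<dots> \<le> 1" using f by (simp add: pres_def)
  finally show ?thesis unfolding \<delta>_def .
qed

text \<open>The chord from the value at 0 to the value 0 at \<open>kmx lam\<close>; it controls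
  small \<open>\<kappa>\<close> where minimisers escape to infinity.\<close>

lemma Dsp_concave_0:
  assumes "koch lam" "0 \<le> \<kappa>" "\<kappa> \<le> kmx lam"
  shows "(1 - \<kappa> / kmx lam) * Dsp lam 0 \<le> Dsp lam \<kappa>"
proof -
  interpret koch lam by fact
  have km: "0 < kmx lam" using kmx_bounds[OF assms(1)] by simp
  consider "\<kappa> = 0" | "\<kappa> = kmx lam" | "0 < \<kappa>" "\<kappa> < kmx lam" using assms by linarith
  then show ?thesis
  proof cases
    case 2
    then show ?thesis using km Dsp_kmax kmx by simp
  next
    case 3
    define t where "t = 1 - \<kappa> / kmx lam"
    have t: "0 < t" "t < 1" "(1 - t) * kmx lam = \<kappa>" using 3 km by (auto simp: t_def)
    have "t * Dsp lam 0 + (1 - t) * Dsp lam kmax < Dsp lam (t * 0 + (1 - t) * kmax)"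
      using t kmax by (intro Dsp_strict_concave) auto
    then show ?thesis using t Dsp_kmax kmx by (simp add: t_def)
  qed simp
qed

text \<open>One setting for two uses: joint convergence of parameter and \<open>\<kappa>\<close>,
  and, with a constant \<open>L\<close>, continuity of a single spectrum.\<close>

locale koch_sequence =
  fixes L k :: "nat \<Rightarrow> real" and l \<kappa> :: real
  assumes kL: "\<And>n. koch (L n)" and kl: "koch l" and L: "L \<longlonglongrightarrow> l" and k: "k \<longlonglongrightarrow> \<kappa>"
    and kr: "\<And>n. 0 \<le> k n" "\<And>n. k n \<le> kmx (L n)"
begin

lemma kmx_lim: "(\<lambda>n. kmx (L n)) \<longlonglongrightarrow> kmx l"
  unfolding kmx_def using koch_pos[OF kl] by (intro tendsto_intros L) auto

lemma kappa_range: "0 \<le> \<kappa>" "\<kappa> \<le> kmx l"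
  using LIMSEQ_le_const[OF k] LIMSEQ_le[OF k kmx_lim] kr by auto

definition \<eta> :: "nat \<Rightarrow> real" where
  "\<eta> n = max \<bar>ln (6 * L n + 1) - ln (6 * l + 1)\<bar> \<bar>ln (6 * L n - 1) - ln (6 * l - 1)\<bar>"

lemma eta_lim: "\<eta> \<longlonglongrightarrow> 0"
proof -
  have "\<eta> \<longlonglongrightarrow> max \<bar>ln (6 * l + 1) - ln (6 * l + 1)\<bar> \<bar>ln (6 * l - 1) - ln (6 * l - 1)\<bar>"
    unfolding \<eta>_def[abs_def] using koch_pos[OF kl] by (intro tendsto_intros L) auto
  then show ?thesis by simp
qed

lemma perturb_to: "pres l q e \<le> 1 \<Longrightarrow> pres (L n) q (e + \<bar>q\<bar> * \<eta> n / ln 3) \<le> 1"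
  by (rule pres_perturb[OF kl kL]) (auto simp: \<eta>_def)

lemma perturb_from: "pres (L n) q e \<le> 1 \<Longrightarrow> pres l q (e + \<bar>q\<bar> * \<eta> n / ln 3) \<le> 1"
  by (rule pres_perturb[OF kL kl]) (auto simp: \<eta>_def abs_minus_commute)

lemma range_kmax: "0 \<le> k n" "k n \<le> koch.kmax (L n)" "0 \<le> \<kappa>" "\<kappa> \<le> koch.kmax l"
  using kr kappa_range koch.kmx[OF kL] koch.kmx[OF kl] by auto

text \<open>One near-minimiser for the limit is perturbed into feasible pairs for
  \<open>L n\<close>; as \<open>q\<close> is fixed, the cost tends to 0, also at 1/3.\<close>

lemma Dsp_upper:
  assumes "Dsp l \<kappa> < x"
  shows "\<forall>\<^sub>F n in sequentially. Dsp (L n) (k n) < x"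
proof -
  obtain q e where qe: "pres l q e \<le> 1" "e - \<kappa> * q < x"
    by (rule koch.Dsp_approx[OF kl range_kmax(3,4) assms])
  have "(\<lambda>n. e + \<bar>q\<bar> * \<eta> n / ln 3 - k n * q) \<longlonglongrightarrow> e + \<bar>q\<bar> * 0 / ln 3 - \<kappa> * q"
    by (intro tendsto_intros eta_lim k) simp
  then have "\<forall>\<^sub>F n in sequentially. e + \<bar>q\<bar> * \<eta> n / ln 3 - k n * q < x"
    by (rule order_tendstoD(2)) (use qe in simp)
  then show ?thesis
  proof (rule eventually_mono)
    fix n assume "e + \<bar>q\<bar> * \<eta> n / ln 3 - k n * q < x"
    then show "Dsp (L n) (k n) < x"
      using koch.Dsp_le[OF kL perturb_to[OF qe(1)] range_kmax(1,2), of n] by linarith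
  qed
qed

text \<open>Here the pairs vary with \<open>n\<close>, and the perturbation cost is proportional to
  \<open>\<bar>q\<bar>\<close>, so a common bound is needed. Pairs of value above 1 are harmless
  because \<open>Dsp l \<kappa> \<le> 1\<close>.\<close>

lemma Dsp_lower_bounded:
  assumes Q: "\<forall>\<^sub>F n in sequentially. \<forall>q e. pres (L n) q e \<le> 1 \<longrightarrow> e - k n * q \<le> 1 \<longrightarrow> \<bar>q\<bar> \<le> Q"
    and x: "x < Dsp l \<kappa>"
  shows "\<forall>\<^sub>F n in sequentially. x < Dsp (L n) (k n)"
proof -
  define z where "z n = Q * \<eta> n / ln 3 + \<bar>k n - \<kappa>\<bar> * Q" for n
  have "z \<longlonglongrightarrow> Q * 0 / ln 3 + \<bar>\<kappa> - \<kappa>\<bar> * Q" unfolding z_def[abs_def]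
    by (intro tendsto_intros eta_lim k) simp
  then have "\<forall>\<^sub>F n in sequentially. z n < Dsp l \<kappa> - x" by (rule order_tendstoD(2)) (use x in simp)
  with Q show ?thesis
  proof (rule eventually_elim2)
    fix n assume a: "\<forall>q e. pres (L n) q e \<le> 1 \<longrightarrow> e - k n * q \<le> 1 \<longrightarrow> \<bar>q\<bar> \<le> Q" and b: "z n < Dsp l \<kappa> - x"
    have eta0: "\<eta> n \<ge> 0" by (simp add: \<eta>_def le_max_iff_disj)
    have "Q \<ge> 0" using a pres_0_1[OF koch.lam_gt_sixth[OF kL]] by force
    then have z0: "z n \<ge> 0" using eta0 by (simp add: z_def)
    have D1: "Dsp l \<kappa> \<le> 1" using koch.Dsp_range[OF kl range_kmax(3,4)] by simp
    have "Dsp l \<kappa> - z n \<le> Dsp (L n) (k n)"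
    proof (rule koch.Dsp_ge[OF kL])
      fix q e assume f: "pres (L n) q e \<le> 1"
      show "Dsp l \<kappa> - z n \<le> e - k n * q"
      proof (cases "e - k n * q \<le> 1")
        case True
        then have q: "\<bar>q\<bar> \<le> Q" using a f by blast
        have "Dsp l \<kappa> \<le> e + \<bar>q\<bar> * \<eta> n / ln 3 - \<kappa> * q"
          by (rule koch.Dsp_le[OF kl perturb_from[OF f] range_kmax(3,4)])
        also have "\<dots> = e - k n * q + (\<bar>q\<bar> * \<eta> n / ln 3 + (k n - \<kappa>) * q)" by (simp add: algebra_simps)
        also have "\<bar>q\<bar> * \<eta> n / ln 3 \<le> Q * \<eta> n / ln 3" using q eta0 by (intro divide_right_mono mult_right_mono) auto
        also have "(k n - \<kappa>) * q \<le> \<bar>k n - \<kappa>\<bar> * \<bar>q\<bar>" by (metis abs_ge_self abs_mult)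
        also have "\<bar>k n - \<kappa>\<bar> * \<bar>q\<bar> \<le> \<bar>k n - \<kappa>\<bar> * Q" using q by (intro mult_left_mono) auto
        finally show ?thesis by (simp add: z_def)
      next
        case False
        then show ?thesis using z0 D1 by linarith
      qed
    qed
    then show "x < Dsp (L n) (k n)" using b by linarith
  qed
qed

lemma q_upper:
  assumes "\<kappa> < kmx l"
  shows "\<forall>\<^sub>F n in sequentially. \<forall>q e. pres (L n) q e \<le> 1 \<longrightarrow> e - k n * q \<le> 1 \<longrightarrow> q \<le> 2 / (kmx l - \<kappa>)"
proof -
  have "(\<lambda>n. kmx (L n) - k n) \<longlonglongrightarrow> kmx l - \<kappa>" by (intro tendsto_diff kmx_lim k)
  then have "\<forall>\<^sub>F n in sequentially. (kmx l - \<kappa>) / 2 < kmx (L n) - k n"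
    by (rule order_tendstoD(1)) (use assms in simp)
  then show ?thesis
  proof (rule eventually_mono, intro allI impI)
    fix n q e assume a: "(kmx l - \<kappa>) / 2 < kmx (L n) - k n" and f: "pres (L n) q e \<le> 1" "e - k n * q \<le> 1"
    show "q \<le> 2 / (kmx l - \<kappa>)"
    proof (cases "q \<le> 0")
      case True
      then show ?thesis using assms by (meson divide_nonneg_nonneg diff_ge_0_iff_ge less_imp_le order_trans zero_le_numeral)
    next
      case False
      have "(kmx l - \<kappa>) / 2 * q \<le> (kmx (L n) - k n) * q" using a False by (intro mult_right_mono) auto
      also have "\<dots> \<le> 1" using koch.feasible_bounds(2)[OF kL f(1)] f(2) koch.kmx[OF kL, of n]
        by (simp add: algebra_simps)
      finally show ?thesis using assms by (simp add: field_simps)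
    qed
  qed
qed

text \<open>At \<open>\<kappa> = kmx l\<close> the limit is 0. For \<open>\<kappa>\<close> in
  between, and at 0 when \<open>l < 1/3\<close>, relevant \<open>q\<close> stay bounded. At 0 with
  \<open>l > 1/3\<close> or a constant parameter they may escape; there the value at 0 is eventually
  constant along the sequence and the chord bound suffices. The side condition excludes what
  remains.\<close>

lemma Dsp_lower:
  assumes side: "l \<noteq> 1/3 \<or> (\<forall>n. L n = l)" and x: "x < Dsp l \<kappa>"
  shows "\<forall>\<^sub>F n in sequentially. x < Dsp (L n) (k n)"
proof -
  have ln23: "0 < ln 2 / ln (3::real)" by simp
  consider "\<kappa> = kmx l" | "0 < \<kappa>" "\<kappa> < kmx l" | "\<kappa> = 0" "l < 1/3" | "\<kappa> = 0" "l > 1/3 \<or> (\<forall>n. L n = l)"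
    using kappa_range side by (cases "\<kappa> = 0"; cases "l < 1/3"; force)
  then show ?thesis
  proof cases
    case 1
    then have "x < 0" using x koch.Dsp_kmax[OF kl] koch.kmx[OF kl] by simp
    moreover have "Dsp (L n) (k n) \<ge> 0" for n using koch.Dsp_range[OF kL range_kmax(1,2)] by blast
    ultimately show ?thesis by (auto intro!: always_eventually intro: less_le_trans)
  next
    case 2
    have "\<forall>\<^sub>F n in sequentially. \<kappa> / 2 < k n" using k by (rule order_tendstoD(1)) (use 2 in simp)
    with q_upper[OF 2(2)]
    have "\<forall>\<^sub>F n in sequentially. \<forall>q e. pres (L n) q e \<le> 1 \<longrightarrow> e - k n * q \<le> 1 \<longrightarrow> \<bar>q\<bar> \<le> max (2 / (kmx l - \<kappa>)) (2 / \<kappa>)"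
    proof (rule eventually_elim2, intro allI impI)
      fix n q e
      assume a: "\<forall>q e. pres (L n) q e \<le> 1 \<longrightarrow> e - k n * q \<le> 1 \<longrightarrow> q \<le> 2 / (kmx l - \<kappa>)" and kn: "\<kappa> / 2 < k n"
        and f: "pres (L n) q e \<le> 1" "e - k n * q \<le> 1"
      have "- q \<le> 2 / \<kappa>"
      proof (cases "q \<ge> 0")
        case True
        then show ?thesis using 2 by (meson divide_nonneg_nonneg less_imp_le neg_le_0_iff_le order_trans zero_le_numeral)
      next
        case False
        have "e > 0" using koch.feasible_bounds(1)[OF kL f(1)] ln23 by linarith
        have "\<kappa> / 2 * (- q) \<le> k n * (- q)" using kn False by (intro mult_right_mono) auto
        also have "\<dots> \<le> 1" using f(2) \<open>e > 0\<close> by simp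
        finally show ?thesis using 2 by (simp add: field_simps)
      qed
      moreover have "q \<le> 2 / (kmx l - \<kappa>)" using a f by blast
      ultimately show "\<bar>q\<bar> \<le> max (2 / (kmx l - \<kappa>)) (2 / \<kappa>)" by (intro abs_leI) (simp_all only: le_max_iff_disj simp_thms)
    qed
    then show ?thesis using x by (rule Dsp_lower_bounded)
  next
    case 3
    define a where "a = - ln (6 * l - 1)"
    have a: "a > 0" using 3 koch_pos[OF kl] by (simp add: a_def)
    have lim: "(\<lambda>n. ln (6 * L n - 1)) \<longlonglongrightarrow> ln (6 * l - 1)" using koch_pos[OF kl] by (intro tendsto_intros L) auto
    have "\<forall>\<^sub>F n in sequentially. ln (6 * L n - 1) < - (a / 2)"
      using lim by (rule order_tendstoD(2)) (use a in \<open>simp add: a_def\<close>)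
    with q_upper
    have "\<forall>\<^sub>F n in sequentially. \<forall>q e. pres (L n) q e \<le> 1 \<longrightarrow> e - k n * q \<le> 1 \<longrightarrow> \<bar>q\<bar> \<le> max (2 / (kmx l - \<kappa>)) (2 * ln 6 / a)"
    proof (rule eventually_elim2, goal_cases)
      case 1
      then show ?case using 3 kmx_bounds[OF kl] by simp
    next
      case (2 n)
      show ?case
      proof (intro allI impI)
        fix q e assume f: "pres (L n) q e \<le> 1" "e - k n * q \<le> 1"
        have "- q \<le> 2 * ln 6 / a"
        proof (cases "q \<ge> 0")
          case True
          moreover have "0 \<le> 2 * ln 6 / a" using a by simp
          ultimately show ?thesis by linarith
        next
          case False
          have "a / 2 * (- q) \<le> - ln (6 * L n - 1) * (- q)" using 2 False by (intro mult_right_mono) auto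
          also have "\<dots> = q * ln (6 * L n - 1)" by simp
          also have "\<dots> \<le> e * ln 6" using koch.feasible_bounds(3)[OF kL f(1)] unfolding koch.c_def[OF kL] .
          also have "\<dots> \<le> (1 + k n * q) * ln 6" using f(2) by (intro mult_right_mono) auto
          also have "\<dots> \<le> 1 * ln 6" using kr(1)[of n] False by (intro mult_right_mono) (auto intro: mult_nonneg_nonpos)
          finally have "a * (- q) \<le> 2 * ln 6" by simp
          then show ?thesis using a by (simp add: pos_le_divide_eq mult.commute)
        qed
        moreover have "q \<le> 2 / (kmx l - \<kappa>)" using 2(1) f by blast
        ultimately show "\<bar>q\<bar> \<le> max (2 / (kmx l - \<kappa>)) (2 * ln 6 / a)" by (intro abs_leI) (simp_all only: le_max_iff_disj simp_thms)
      qed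
    qed
    then show ?thesis using x by (rule Dsp_lower_bounded)
  next
    case 4
    have ev: "\<forall>\<^sub>F n in sequentially. Dsp (L n) 0 = Dsp l 0"
    proof (cases "\<forall>n. L n = l")
      case False
      then have l3: "l > 1/3" using 4 by blast
      have "\<forall>\<^sub>F n in sequentially. 1/3 < L n" using L by (rule order_tendstoD(1)) (use l3 in simp)
      then show ?thesis
      proof (rule eventually_mono)
        fix n assume "1/3 < L n"
        then show "Dsp (L n) 0 = Dsp l 0"
          using koch.Dsp_0(1)[OF kL] koch.Dsp_0(1)[OF kl] l3 by (simp add: koch.c_def[OF kL] koch.c_def[OF kl])
      qed
    qed simp
    have "(\<lambda>n. (1 - k n / kmx (L n)) * Dsp l 0) \<longlonglongrightarrow> (1 - \<kappa> / kmx l) * Dsp l 0"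
      using kmx_bounds(1)[OF kl] by (intro tendsto_intros k kmx_lim) simp
    then have "\<forall>\<^sub>F n in sequentially. x < (1 - k n / kmx (L n)) * Dsp l 0"
      by (rule order_tendstoD(1)) (use x 4 in simp)
    with ev show ?thesis
    proof (rule eventually_elim2)
      fix n assume "Dsp (L n) 0 = Dsp l 0" "x < (1 - k n / kmx (L n)) * Dsp l 0"
      then show "x < Dsp (L n) (k n)" using Dsp_concave_0[OF kL kr(1) kr(2), of n] by simp
    qed
  qed
qed

lemma Dsp_tendsto: "l \<noteq> 1/3 \<or> (\<forall>n. L n = l) \<Longrightarrow> (\<lambda>n. Dsp (L n) (k n)) \<longlonglongrightarrow> Dsp l \<kappa>"
  by (rule order_tendstoI) (auto intro: Dsp_lower Dsp_upper)

end

lemma Dsp_continuous: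
  assumes "koch lam"
  shows "continuous_on {0..kmx lam} (Dsp lam)"
  unfolding continuous_on_sequentially comp_def
proof (intro ballI allI impI)
  fix x \<kappa> assume "\<kappa> \<in> {0..kmx lam}" "(\<forall>n. x n \<in> {0..kmx lam}) \<and> x \<longlonglongrightarrow> \<kappa>"
  then interpret koch_sequence "\<lambda>_. lam" x lam \<kappa>
    by unfold_locales (use assms in \<open>auto simp: koch_def\<close>)
  show "(\<lambda>n. Dsp lam (x n)) \<longlonglongrightarrow> Dsp lam \<kappa>" using Dsp_tendsto by simp
qed

text \<open>Rescaling by \<open>kmx\<close> puts all spectra on the common interval from 0 to 1. A
  failure would yield, by compactness, a subsequence along which both terms converge to the same
  value.\<close>

lemma Dsp_uniform:
  assumes l: "koch l" "l \<noteq> 1/3" and e: "\<epsilon> > 0"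
  shows "\<exists>\<delta>>0. \<forall>lam. koch lam \<longrightarrow> \<bar>lam - l\<bar> < \<delta> \<longrightarrow>
    (\<forall>u\<in>{0..1}. \<bar>Dsp lam (u * kmx lam) - Dsp l (u * kmx l)\<bar> < \<epsilon>)"
proof (rule ccontr)
  assume "\<not> ?thesis"
  then have "\<forall>n. \<exists>lam u. koch lam \<and> \<bar>lam - l\<bar> < 1 / Suc n \<and> u \<in> {0..1} \<and> \<epsilon> \<le> \<bar>Dsp lam (u * kmx lam) - Dsp l (u * kmx l)\<bar>"
    by (metis not_less of_nat_0_less_iff zero_less_Suc zero_less_divide_1_iff)
  then obtain L u where L: "\<And>n. koch (L n)" "\<And>n. \<bar>L n - l\<bar> < 1 / Suc n" and u: "\<And>n. u n \<in> {0..1}"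
    and big: "\<And>n. \<epsilon> \<le> \<bar>Dsp (L n) (u n * kmx (L n)) - Dsp l (u n * kmx l)\<bar>" by metis
  obtain v r where v: "v \<in> {0..1::real}" "strict_mono (r :: nat \<Rightarrow> nat)" "(u \<circ> r) \<longlonglongrightarrow> v"
    using u compact_Icc[of 0 "1::real"] unfolding compact_def by metis
  have "(\<lambda>n. L n - l) \<longlonglongrightarrow> 0"
    by (rule Lim_null_comparison[OF always_eventually LIMSEQ_inverse_real_of_nat])
       (use L(2) in \<open>auto simp: inverse_eq_divide less_imp_le\<close>)
  then have "L \<longlonglongrightarrow> l" by (simp add: LIM_zero_iff)
  then have "(L \<circ> r) \<longlonglongrightarrow> l" using v(2) by (rule LIMSEQ_subseq_LIMSEQ)
  then have Lr: "(\<lambda>n. L (r n)) \<longlonglongrightarrow> l" by (simp add: comp_def)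
  have ur: "(\<lambda>n. u (r n)) \<longlonglongrightarrow> v" using v(3) by (simp add: comp_def)
  have pos: "0 < kmx (L n)" for n using kmx_bounds[OF L(1)] by simp
  have posl: "0 < kmx l" using kmx_bounds[OF l(1)] by simp
  have u01: "0 \<le> u n" "u n \<le> 1" for n using u[of n] by auto
  have klim: "(\<lambda>n. kmx (L (r n))) \<longlonglongrightarrow> kmx l"
    unfolding kmx_def using koch_pos[OF l(1)] by (intro tendsto_intros Lr) auto
  have "koch_sequence (\<lambda>n. L (r n)) (\<lambda>n. u (r n) * kmx (L (r n))) l (v * kmx l)"
  proof (rule koch_sequence.intro)
    show "(\<lambda>n. u (r n) * kmx (L (r n))) \<longlonglongrightarrow> v * kmx l" by (intro tendsto_mult ur klim)
    show "0 \<le> u (r n) * kmx (L (r n))" "u (r n) * kmx (L (r n)) \<le> kmx (L (r n))" for n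
      using u01[of "r n"] pos[of "r n"] by (auto intro: mult_left_le_one_le)
  qed (rule L(1) l(1) Lr)+
  then have 1: "(\<lambda>n. Dsp (L (r n)) (u (r n) * kmx (L (r n)))) \<longlonglongrightarrow> Dsp l (v * kmx l)"
    by (rule koch_sequence.Dsp_tendsto) (use l(2) in blast)
  have "koch_sequence (\<lambda>_. l) (\<lambda>n. u (r n) * kmx l) l (v * kmx l)"
  proof (rule koch_sequence.intro)
    show "(\<lambda>n. u (r n) * kmx l) \<longlonglongrightarrow> v * kmx l" by (intro tendsto_mult ur tendsto_const)
    show "0 \<le> u (r n) * kmx l" "u (r n) * kmx l \<le> kmx l" for n
      using u01[of "r n"] posl by (auto intro: mult_left_le_one_le)
  qed (rule l(1) tendsto_const)+
  then have 2: "(\<lambda>n. Dsp l (u (r n) * kmx l)) \<longlonglongrightarrow> Dsp l (v * kmx l)"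
    by (rule koch_sequence.Dsp_tendsto) simp
  have "(\<lambda>n. \<bar>Dsp (L (r n)) (u (r n) * kmx (L (r n))) - Dsp l (u (r n) * kmx l)\<bar>) \<longlonglongrightarrow> \<bar>Dsp l (v * kmx l) - Dsp l (v * kmx l)\<bar>"
    by (intro tendsto_rabs tendsto_diff 1 2)
  then have "\<epsilon> \<le> \<bar>Dsp l (v * kmx l) - Dsp l (v * kmx l)\<bar>"
    by (rule LIMSEQ_le_const) (use big in auto)
  then show False using e by simp
qed

section \<open>Graphs of the spectra and their Hausdorff distance\<close>

lemma spectrum_eq:
  assumes "koch lam" "\<alpha> \<in> {alpha_min lam..1}"
  shows "spectrum_F (F lam) \<alpha> = ereal (Dsp lam (1 - \<alpha>))"
  using koch.spectrum_Dsp(1)[OF assms(1), of "1 - \<alpha>"] assms koch.kmax(4)[OF assms(1)] by simp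

lemma spectrum_empty:
  assumes "koch lam" "\<alpha> \<notin> {alpha_min lam..1}"
  shows "spectrum_F (F lam) \<alpha> = -\<infinity>"
proof -
  have "hoelder_exp (F lam) x \<noteq> ereal \<alpha>" if "x \<in> {0..1}" for x
    using koch.hoelder_range[OF assms(1) that] assms(2) by auto
  then have "{x \<in> {0..1}. hoelder_exp (F lam) x = ereal \<alpha>} = {}" by blast
  then show ?thesis unfolding spectrum_F_def hdim_def by simp
qed

lemma graph_spec_eq:
  assumes "koch lam"
  shows "graph_spec lam = (\<lambda>\<kappa>. (1 - \<kappa>, Dsp lam \<kappa>)) ` {0..kmx lam}"
proof -
  have a: "alpha_min lam = 1 - kmx lam" using kmx_bounds[OF assms] by simp
  have "{alpha_min lam..1} = (\<lambda>\<kappa>. 1 - \<kappa>) ` {0..kmx lam}" unfolding a by (simp add: image_diff_atLeastAtMost)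
  moreover have "graph_spec lam = (\<lambda>\<alpha>. (\<alpha>, Dsp lam (1 - \<alpha>))) ` {alpha_min lam..1}"
    unfolding graph_spec_def by (intro image_cong refl) (simp add: spectrum_eq[OF assms])
  ultimately have "graph_spec lam = (\<lambda>\<alpha>. (\<alpha>, Dsp lam (1 - \<alpha>))) ` (\<lambda>\<kappa>. 1 - \<kappa>) ` {0..kmx lam}" by (simp only:)
  then show ?thesis unfolding image_image by simp
qed

lemma graph_compact:
  assumes "koch lam"
  shows "compact (graph_spec lam)" "graph_spec lam \<noteq> {}"
  unfolding graph_spec_eq[OF assms] using kmx_bounds[OF assms]
  by (auto intro!: compact_continuous_image continuous_intros Dsp_continuous assms)

text \<open>Points of the two graphs with the same relative position \<open>u\<close> are matched,
  so uniform closeness bounds both one-sided distances at once.\<close>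

lemma graph_continuous:
  assumes l: "koch l" "l \<noteq> 1/3" and e: "\<epsilon> > 0"
  shows "\<exists>\<delta>>0. \<forall>lam. koch lam \<longrightarrow> \<bar>lam - l\<bar> < \<delta> \<longrightarrow> hausdist (graph_spec lam) (graph_spec l) < \<epsilon>"
proof -
  obtain \<delta>1 where d1: "\<delta>1 > 0" "\<And>lam u. koch lam \<Longrightarrow> \<bar>lam - l\<bar> < \<delta>1 \<Longrightarrow> u \<in> {0..1} \<Longrightarrow>
     \<bar>Dsp lam (u * kmx lam) - Dsp l (u * kmx l)\<bar> < \<epsilon> / 3" using Dsp_uniform[OF l, of "\<epsilon> / 3"] e by auto
  have "isCont kmx l" unfolding kmx_def[abs_def] using koch_pos[OF l(1)] by (intro continuous_intros) auto
  then obtain \<delta>2 where d2: "\<delta>2 > 0" "\<And>lam. \<bar>lam - l\<bar> < \<delta>2 \<Longrightarrow> \<bar>kmx lam - kmx l\<bar> < \<epsilon> / 3"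
    using e unfolding continuous_at_eps_delta dist_real_def by (metis divide_pos_pos zero_less_numeral)
  have "hausdist (graph_spec lam) (graph_spec l) < \<epsilon>" if k: "koch lam" and d: "\<bar>lam - l\<bar> < min \<delta>1 \<delta>2" for lam
  proof -
    define g where "g lam u = (1 - u * kmx lam, Dsp lam (u * kmx lam))" for lam u
    have img: "graph_spec lam = g lam ` {0..1}" if "koch lam" for lam
    proof -
      have "{0..kmx lam} = (\<lambda>u. u * kmx lam) ` {0..1}" using kmx_bounds(1)[OF that]
        by (simp add: image_mult_atLeastAtMost_if' mult.commute)
      then show ?thesis unfolding graph_spec_eq[OF that] g_def[abs_def] by (simp add: image_image)
    qed
    have near: "dist (g lam u) (g l u) \<le> 2 * \<epsilon> / 3" if u: "u \<in> {0..1}" for u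
    proof -
      have "dist (g lam u) (g l u) \<le> \<bar>dist (1 - u * kmx lam) (1 - u * kmx l)\<bar> + \<bar>dist (Dsp lam (u * kmx lam)) (Dsp l (u * kmx l))\<bar>"
        unfolding g_def dist_Pair_Pair by (rule sqrt_sum_squares_le_sum_abs)
      also have "\<bar>dist (1 - u * kmx lam) (1 - u * kmx l)\<bar> \<le> \<epsilon> / 3"
      proof -
        have "dist (1 - u * kmx lam) (1 - u * kmx l) = \<bar>u * (kmx l - kmx lam)\<bar>" by (simp add: dist_real_def algebra_simps)
        also have "\<dots> \<le> 1 * \<bar>kmx lam - kmx l\<bar>" unfolding abs_mult using u by (intro mult_mono) auto
        also have "\<dots> \<le> \<epsilon> / 3" using d2(2)[of lam] d by simp
        finally show ?thesis by simp
      qed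
      also have "\<bar>dist (Dsp lam (u * kmx lam)) (Dsp l (u * kmx l))\<bar> \<le> \<epsilon> / 3"
        using d1(2)[OF k _ u] d by (simp add: dist_real_def)
      finally show ?thesis by simp
    qed
    have A: "infdist a (graph_spec l) \<le> 2 * \<epsilon> / 3" if a: "a \<in> graph_spec lam" for a
    proof -
      obtain u where u: "u \<in> {0..1}" "a = g lam u" using a unfolding img[OF k] by blast
      show ?thesis unfolding img[OF l(1)] u(2) by (rule infdist_le2[OF imageI]) (rule u(1), rule near[OF u(1)])
    qed
    have B: "infdist b (graph_spec lam) \<le> 2 * \<epsilon> / 3" if b: "b \<in> graph_spec l" for b
    proof -
      obtain u where u: "u \<in> {0..1}" "b = g l u" using b unfolding img[OF l(1)] by blast
      have "dist (g l u) (g lam u) \<le> 2 * \<epsilon> / 3" using near[OF u(1)] by (simp add: dist_commute)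
      with imageI[OF u(1), of "g lam"] show ?thesis unfolding img[OF k] u(2) by (rule infdist_le2)
    qed
    have "hausdist (graph_spec lam) (graph_spec l) \<le> 2 * \<epsilon> / 3"
      unfolding hausdist_def using A B graph_compact(2)[OF k] graph_compact(2)[OF l(1)]
      by (intro max.boundedI cSUP_least) auto
    then show ?thesis using e by simp
  qed
  then show ?thesis using d1(1) d2(1) by (intro exI[of _ "min \<delta>1 \<delta>2"]) auto
qed

lemma koch_third: "koch (1/3)"
proof -
  have "sqrt 2 < sqrt 4" by (simp only: real_sqrt_less_iff)
  then show ?thesis by (simp add: koch_def)
qed

text \<open>For \<open>lam > 1/3\<close> the point \<open>(1, ln 2 / ln 3)\<close> belongs to the graph, whereas at \<open>lam = 1/3\<close>
  the value at 1 is larger, because type 2 then leaves the growth rate of the slope unchanged.\<close>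
lemma graph_discontinuous:
  "\<exists>\<epsilon>>0. \<forall>\<delta>>0. \<exists>lam. koch lam \<and> \<bar>lam - 1/3\<bar> < \<delta> \<and> \<epsilon> \<le> hausdist (graph_spec lam) (graph_spec (1/3))"
proof -
  let ?G = "graph_spec (1/3)" and ?P = "(1 :: real, ln 2 / ln 3 :: real)"
  have c: "koch.c (1/3) = 2" using koch.c_def[OF koch_third] by simp
  have "?P \<notin> ?G" using koch.Dsp_0(2)[OF koch_third c] unfolding graph_spec_eq[OF koch_third] by auto
  then have "infdist ?P ?G \<noteq> 0"
    using in_closed_iff_infdist_zero[OF compact_imp_closed[OF graph_compact(1)] graph_compact(2)] koch_third by blast
  then have e: "infdist ?P ?G > 0" using infdist_nonneg[of ?P ?G] by simp
  show ?thesis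
  proof (rule exI[of _ "infdist ?P ?G"], intro conjI e allI impI)
    fix \<delta> :: real assume d: "\<delta> > 0"
    \<comment> \<open>The bound 1/10 keeps the parameter below 5/6; approaching from above puts it
      in the regime \<open>c > 2\<close>.\<close>
    define lam where "lam = 1/3 + min (\<delta> / 2) (1/10)"
    have l: "lam > 1/3" "\<bar>lam - 1/3\<bar> < \<delta>" "lam < 5/6" using d by (auto simp: lam_def min_def)
    have k: "koch lam" using koch_third l by (simp add: koch_def)
    have "Dsp lam 0 = ln 2 / ln 3" using koch.Dsp_0(1)[OF k] l by (simp add: koch.c_def[OF k])
    then have P: "?P \<in> graph_spec lam" unfolding graph_spec_eq[OF k] using kmx_bounds(1)[OF k]
      by (intro image_eqI[of _ _ 0]) auto
    have "compact ((\<lambda>a. infdist a ?G) ` graph_spec lam)"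
      by (intro compact_continuous_image continuous_intros graph_compact k)
    then have "bdd_above ((\<lambda>a. infdist a ?G) ` graph_spec lam)" by (intro bounded_imp_bdd_above compact_imp_bounded)
    then have "infdist ?P ?G \<le> (SUP a\<in>graph_spec lam. infdist a ?G)" using P by (intro cSUP_upper)
    then have "infdist ?P ?G \<le> hausdist (graph_spec lam) ?G" unfolding hausdist_def by simp
    then show "\<exists>lam. koch lam \<and> \<bar>lam - 1/3\<bar> < \<delta> \<and> infdist ?P ?G \<le> hausdist (graph_spec lam) ?G" using k l by blast
  qed
qed

lemma spectrum_properties:
  assumes k: "koch lam"
  shows "{\<alpha>. spectrum_F (F lam) \<alpha> \<noteq> -\<infinity>} = {alpha_min lam..1}"
    "\<forall>\<alpha> \<in> {alpha_min lam..1}. spectrum_F (F lam) \<alpha> = tau_star lam (\<alpha> + gam lam - 1)"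
    "\<forall>x \<in> {alpha_min lam..1}. \<forall>y \<in> {alpha_min lam..1}. \<forall>t::real. x \<noteq> y \<and> 0 < t \<and> t < 1 \<longrightarrow>
       spectrum_F (F lam) (t * x + (1 - t) * y)
         > ereal t * spectrum_F (F lam) x + ereal (1 - t) * spectrum_F (F lam) y"
    "spectrum_F (F lam) (alpha_L lam) = 1"
    "\<forall>\<alpha>. spectrum_F (F lam) \<alpha> \<le> 1"
proof -
  interpret koch lam by fact
  have am: "alpha_min lam = 1 - kmax" by (rule kmax(4))
  show "{\<alpha>. spectrum_F (F lam) \<alpha> \<noteq> -\<infinity>} = {alpha_min lam..1}"
  proof (rule set_eqI)
    fix \<alpha>
    show "\<alpha> \<in> {\<alpha>. spectrum_F (F lam) \<alpha> \<noteq> -\<infinity>} \<longleftrightarrow> \<alpha> \<in> {alpha_min lam..1}"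
      using spectrum_eq[OF k, of \<alpha>] spectrum_empty[OF k, of \<alpha>] by (cases "\<alpha> \<in> {alpha_min lam..1}") simp_all
  qed
  show "\<forall>\<alpha> \<in> {alpha_min lam..1}. spectrum_F (F lam) \<alpha> = tau_star lam (\<alpha> + gam lam - 1)"
  proof
    fix \<alpha> assume a: "\<alpha> \<in> {alpha_min lam..1}"
    then have "tau_star lam (1 - (1 - \<alpha>) + gam lam - 1) = ereal (Dsp lam (1 - \<alpha>))"
      unfolding am by (intro tau_star_Dsp) auto
    then show "spectrum_F (F lam) \<alpha> = tau_star lam (\<alpha> + gam lam - 1)" using spectrum_eq[OF k a] by simp
  qed
  show "\<forall>x \<in> {alpha_min lam..1}. \<forall>y \<in> {alpha_min lam..1}. \<forall>t::real. x \<noteq> y \<and> 0 < t \<and> t < 1 \<longrightarrow>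
       spectrum_F (F lam) (t * x + (1 - t) * y)
         > ereal t * spectrum_F (F lam) x + ereal (1 - t) * spectrum_F (F lam) y"
  proof (intro ballI allI impI, elim conjE)
    fix x y t :: real
    assume x: "x \<in> {alpha_min lam..1}" and y: "y \<in> {alpha_min lam..1}" and t: "x \<noteq> y" "0 < t" "t < 1"
    have z: "t * x + (1 - t) * y \<in> {alpha_min lam..1}"
      using convexD[OF convex_real_interval(5) x y, of t "1 - t"] t by simp
    have "t * Dsp lam (1 - x) + (1 - t) * Dsp lam (1 - y) < Dsp lam (t * (1 - x) + (1 - t) * (1 - y))"
      using x y t unfolding am by (intro Dsp_strict_concave) auto
    also have "t * (1 - x) + (1 - t) * (1 - y) = 1 - (t * x + (1 - t) * y)" by (simp add: algebra_simps)
    finally show "spectrum_F (F lam) (t * x + (1 - t) * y)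
         > ereal t * spectrum_F (F lam) x + ereal (1 - t) * spectrum_F (F lam) y"
      unfolding spectrum_eq[OF k x] spectrum_eq[OF k y] spectrum_eq[OF k z] by simp
  qed
  have cc: "c\<^sup>2 = 36 * lam\<^sup>2" by (simp add: c_def power_mult_distrib)
  show "spectrum_F (F lam) (alpha_L lam) = 1"
    using spectrum_Dsp(1)[OF Dsp_max(1,2)] Dsp_max(3) unfolding alpha_L_def cc by simp
  show "\<forall>\<alpha>. spectrum_F (F lam) \<alpha> \<le> 1"
  proof
    fix \<alpha> show "spectrum_F (F lam) \<alpha> \<le> 1"
    proof (cases "\<alpha> \<in> {alpha_min lam..1}")
      case True
      then have "Dsp lam (1 - \<alpha>) \<le> 1" using Dsp_range[of "1 - \<alpha>"] unfolding am by auto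
      then show ?thesis using spectrum_eq[OF k True] by simp
    qed (simp add: spectrum_empty[OF k])
  qed
qed

theorem theorem1p9:
  shows
  "(\<forall>lam \<in> {sqrt 2 / 6 <..< 5/6}.
      {\<alpha>. spectrum_F (F lam) \<alpha> \<noteq> -\<infinity>} = {alpha_min lam..1}
    \<and> (\<forall>\<alpha> \<in> {alpha_min lam..1}. spectrum_F (F lam) \<alpha> = tau_star lam (\<alpha> + gam lam - 1))
    \<and> (\<forall>x \<in> {alpha_min lam..1}. \<forall>y \<in> {alpha_min lam..1}. \<forall>t::real. x \<noteq> y \<and> 0 < t \<and> t < 1 \<longrightarrow>
          spectrum_F (F lam) (t * x + (1 - t) * y)
            > ereal t * spectrum_F (F lam) x + ereal (1 - t) * spectrum_F (F lam) y)
    \<and> spectrum_F (F lam) (alpha_L lam) = 1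
    \<and> (\<forall>\<alpha>. spectrum_F (F lam) \<alpha> \<le> 1))
 \<and> (\<forall>lam \<in> {sqrt 2 / 6 <..< 5/6}. compact (graph_spec lam) \<and> graph_spec lam \<noteq> {})
 \<and> (\<forall>lam0 \<in> {sqrt 2 / 6 <..< 5/6}. lam0 \<noteq> 1/3 \<longrightarrow>
      (\<forall>\<epsilon>>0. \<exists>\<delta>>0. \<forall>lam \<in> {sqrt 2 / 6 <..< 5/6}. \<bar>lam - lam0\<bar> < \<delta> \<longrightarrow>
          hausdist (graph_spec lam) (graph_spec lam0) < \<epsilon>))
 \<and> \<not> (\<forall>\<epsilon>>0. \<exists>\<delta>>0. \<forall>lam \<in> {sqrt 2 / 6 <..< 5/6}. \<bar>lam - 1/3\<bar> < \<delta> \<longrightarrow>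
          hausdist (graph_spec lam) (graph_spec (1/3)) < \<epsilon>)"
proof -
  have k: "lam \<in> {sqrt 2 / 6 <..< 5/6} \<longleftrightarrow> koch lam" for lam by (simp add: koch_def)
  show ?thesis
  proof (intro conjI ballI impI allI)
    fix lam :: real assume "lam \<in> {sqrt 2 / 6 <..< 5/6}"
    then have kl: "koch lam" by (simp only: k)
    note P = spectrum_properties[OF kl]
    show "{\<alpha>. spectrum_F (F lam) \<alpha> \<noteq> -\<infinity>} = {alpha_min lam..1}" by (rule P)
    show "spectrum_F (F lam) \<alpha> = tau_star lam (\<alpha> + gam lam - 1)" if "\<alpha> \<in> {alpha_min lam..1}" for \<alpha>
      using P(2) that by blast
    show "spectrum_F (F lam) (t * x + (1 - t) * y)
            > ereal t * spectrum_F (F lam) x + ereal (1 - t) * spectrum_F (F lam) y"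
      if "x \<in> {alpha_min lam..1}" "y \<in> {alpha_min lam..1}" "x \<noteq> y \<and> 0 < t \<and> t < 1" for x y t
      using P(3) that by blast
    show "spectrum_F (F lam) (alpha_L lam) = 1" by (rule P)
    show "spectrum_F (F lam) \<alpha> \<le> 1" for \<alpha> using P(5) by blast
  next
    fix lam :: real assume "lam \<in> {sqrt 2 / 6 <..< 5/6}"
    then have kl: "koch lam" by (simp only: k)
    show "compact (graph_spec lam)" "graph_spec lam \<noteq> {}" by (rule graph_compact[OF kl])+
  next
    fix lam0 \<epsilon> :: real assume "lam0 \<in> {sqrt 2 / 6 <..< 5/6}" "lam0 \<noteq> 1/3" "\<epsilon> > 0"
    then show "\<exists>\<delta>>0. \<forall>lam \<in> {sqrt 2 / 6 <..< 5/6}. \<bar>lam - lam0\<bar> < \<delta> \<longrightarrow>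
          hausdist (graph_spec lam) (graph_spec lam0) < \<epsilon>"
      using graph_continuous[of lam0 \<epsilon>] unfolding Ball_def k by blast
  next
    show "\<not> (\<forall>\<epsilon>>0. \<exists>\<delta>>0. \<forall>lam \<in> {sqrt 2 / 6 <..< 5/6}. \<bar>lam - 1/3\<bar> < \<delta> \<longrightarrow>
          hausdist (graph_spec lam) (graph_spec (1/3)) < \<epsilon>)"
      using graph_discontinuous unfolding Ball_def k by (meson not_less)
  qed
qed

end
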